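(* Let $k$ be either $3$ or an even integer with $k\ge 4$. Let $(G_n)$ be a sequence of graphs where $G_n$ is an $(n,d,\lambda)$-graph with $d^{k-1}/n\gg \lambda^{k-2}$, i.e. $d^{k-1}/(n\lambda^{k-2})\to\infty$. Then for every fixed $\epsilon>0$ and all sufficiently large $n$, $G=G_n$ satisfies: (i) for every subgraph $H\subseteq G$ with $\Delta(H)\le (1/2-\epsilon)d$, the graph $G-H$ contains a cycle of length $t$ for every $k\le t\le n$; (ii) there is a subgraph $H\subseteq G$ with $\Delta(H)\le(1/2+\epsilon)d$ such that $G-H$ fails to contain a cycle of length $t$ for some $k\le t\le n$. (That is, $G$ has local resilience $(1/2+o(1))d$ with respect to containing cycles of length $t$ for all $k\le t\le n$.)
   Context: An $(n,d,\lambda)$-graph is a $d$-regular graph on $n$ vertices such that every eigenvalue of its adjacency matrix other than the largest one has absolute value at most $\lambda$. $G-H$ denotes $G$ with the edges of $H$ deleted. The local resilience of a graph with respect to a monotone increasing property is the minimum $r$ such that deleting at most $r$ edges at each vertex yields a graph without the property. *)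

theory Defs
  imports
    Complex_Main
    "Jordan_Normal_Form.Char_Poly"
    "Graph_Theory.Graph_Theory"
begin

text \<open>
  A finite simple graph is a \<^locale>\<open>pair_graph\<close>: a finite, loop-free, symmetric digraph without
  multiple arcs, each undirected edge \<open>uv\<close> being represented by the two arcs \<open>(u,v)\<close> and \<open>(v,u)\<close>.
  Hence the degree of a vertex is its out-degree.
\<close>

definition max_degree :: "'a pair_pre_digraph \<Rightarrow> nat" where
  "max_degree G = Max (insert 0 (out_degree (with_proj G) ` pverts G))"

text \<open>\<open>H\<close> must itself be an undirected graph: \<^const>\<open>subgraph\<close> alone does not force its arc set to
  be symmetric. It need not be spanning.\<close>

definition is_subgraph :: "'a pair_pre_digraph \<Rightarrow> 'a pair_pre_digraph \<Rightarrow> bool" where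
  "is_subgraph H G \<longleftrightarrow> pair_graph H \<and> subgraph (with_proj H) (with_proj G)"

definition delete_edges :: "'a pair_pre_digraph \<Rightarrow> 'a pair_pre_digraph \<Rightarrow> 'a pair_pre_digraph" where
  "delete_edges G H = \<lparr> pverts = pverts G, parcs = parcs G - parcs H \<rparr>"

text \<open>The bound \<open>3 \<le> t\<close> excludes \<open>u,v,u\<close>, which \<^const>\<open>pre_digraph.cycle\<close> admits in a
  symmetric digraph.\<close>

definition contains_cycle :: "'a pair_pre_digraph \<Rightarrow> nat \<Rightarrow> bool" where
  "contains_cycle G t \<longleftrightarrow> 3 \<le> t \<and> (\<exists>p. pre_digraph.cycle (with_proj G) p \<and> length p = t)"

definition adjacency_matrix :: "'a list \<Rightarrow> 'a pair_pre_digraph \<Rightarrow> real mat" where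
  "adjacency_matrix vs G =
     Matrix.mat (length vs) (length vs) (\<lambda>(i, j). if (vs ! i, vs ! j) \<in> parcs G then 1 else 0)"

text \<open>
  The eigenvalues are taken with multiplicity, as the multiset of roots of the characteristic
  polynomial; the adjacency matrix is real symmetric, so all of them are real. Exactly one copy of
  the largest eigenvalue is exempt from the bound, so that \<open>lam \<ge> d\<close> when the graph is disconnected.
  The multiset does not depend on the enumeration \<open>vs\<close> of the vertices, since another enumeration
  gives a similar matrix.
\<close>

definition ndl_graph :: "nat \<Rightarrow> nat \<Rightarrow> real \<Rightarrow> 'a pair_pre_digraph \<Rightarrow> bool" where
  "ndl_graph n d lam G \<longleftrightarrow>
     pair_graph G \<and> card (pverts G) = n \<and>
     (\<forall>v \<in> pverts G. out_degree (with_proj G) v = d) \<and>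
     (\<exists>vs. distinct vs \<and> set vs = pverts G \<and>
        (let M = proots (char_poly (adjacency_matrix vs G))
         in \<forall>x \<in># M - {#Max_mset M#}. \<bar>x\<bar> \<le> lam))"

end

theory Submission
  imports Defs "Jordan_Normal_Form.Schur_Decomposition" "HOL-Analysis.Convex" "HOL-Real_Asymp.Real_Asymp"
begin

text \<open>
  By the expander mixing lemma, a set of vertices each of which keeps a positive fraction of its \<open>d\<close>
  neighbours inside a set \<open>B\<close> of smaller density is smaller than \<open>B\<close> by a factor of order
  \<open>(d/\<lambda>)\<^sup>2\<close>. Since \<open>G - H\<close> retains slightly more than half of every neighbourhood, its small sets
  expand by such factors until they exceed \<open>n/2\<close>, and the hypothesis on \<open>d\<close> and \<open>\<lambda>\<close> says exactly that
  about \<open>k/2\<close> rounds of expansion suffice.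

  Hamilton cycles come from Posa rotations of a longest path. As the number of rounds is bounded, the
  path can be cut into boundedly many blocks such that each round uses pivots from one block only; the
  other blocks remain common to all rotated paths. The rotations at the two ends are then independent,
  and as both sets of end vertices see more than half of all vertices, Dirac's crossing argument closes
  the path. Cycles of linear length \<open>t\<close> are Hamilton cycles of \<open>t\<close>-vertex subsets into which all
  degrees are inherited proportionally. Shorter ones are obtained from a piece of a Hamilton cycle by
  growing neighbourhoods from its two ends until they meet. Triangles need a separate count.

  For the converse, delete the edges inside the two sides of a maximum cut.
\<close>

section \<open>Rotations preserving common blocks\<close>

text \<open>Working with blocks creates an obstacle: a vertex with many neighbours in a single block
  loses them once that block is used up. Such vertices must not become ends. Forbidding this costs
  pivots, namely the path neighbours of these vertices, so a vertex with many neighbours among the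
  forbidden pivots has to be excluded as well, and so on. The mixing bound shows that this process
  stops at a tiny set. The ends of the longest path may themselves lie in that set; ordinary Posa
  rotations, using pivots anywhere, replace them first and cut one block each. Choosing a rich block
  among \<open>M\<close> costs a factor \<open>M\<close> per round. As \<open>M\<close> depends only
  on \<epsilon> and the number of rounds, the divergence in the hypothesis absorbs it. The first
  round yields order \<open>d\<close> ends by the degrees alone and every further one gains order
  \<open>(d/lam)^2\<close>. Hence \<open>m\<close> rounds need
  \<open>d * (d/lam)^(2 * m - 2)\<close> to be a large multiple of \<open>n\<close>, which for
  \<open>k = 2 * m\<close> is the hypothesis.\<close>

definition dgr :: "('a \<Rightarrow> 'a \<Rightarrow> bool) \<Rightarrow> 'a \<Rightarrow> 'a set \<Rightarrow> nat" where
  "dgr E v S = card {u \<in> S. E v u}"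

text \<open>Gaps of any length are allowed around the blocks. A rotation may therefore cut through
  one block, whose pieces pass into the gaps, without affecting the record of the others.\<close>

fun weaves :: "'a list list \<Rightarrow> 'a list \<Rightarrow> bool" where
  "weaves [] Q = True"
| "weaves (\<beta> # Bl) Q = (\<exists>\<gamma> \<sigma>. Q = \<gamma> @ \<beta> @ \<sigma> \<and> weaves Bl \<sigma>)"

lemma weaves_prepend: "weaves Bl Q \<Longrightarrow> weaves Bl (\<tau> @ Q)"
  by (cases Bl) (auto, metis append.assoc)

lemma weaves_append:
  "weaves (B1 @ B2) Q \<longleftrightarrow> (\<exists>Q1 Q2. Q = Q1 @ Q2 \<and> weaves B1 Q1 \<and> weaves B2 Q2)"
proof (induction B1 arbitrary: Q)
  case Nil
  then show ?case using weaves_prepend by fastforce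
next
  case (Cons \<beta> B1)
  show ?case
  proof
    assume "weaves ((\<beta> # B1) @ B2) Q"
    then obtain \<gamma> \<sigma> where "Q = \<gamma> @ \<beta> @ \<sigma>" "weaves (B1 @ B2) \<sigma>" by auto
    with Cons obtain Q1 Q2 where "\<sigma> = Q1 @ Q2" "weaves B1 Q1" "weaves B2 Q2" by blast
    with \<open>Q = \<gamma> @ \<beta> @ \<sigma>\<close> show "\<exists>Q1 Q2. Q = Q1 @ Q2 \<and> weaves (\<beta> # B1) Q1 \<and> weaves B2 Q2"
      by (intro exI[of _ "\<gamma> @ \<beta> @ Q1"] exI[of _ Q2]) auto
  next
    assume "\<exists>Q1 Q2. Q = Q1 @ Q2 \<and> weaves (\<beta> # B1) Q1 \<and> weaves B2 Q2"
    then obtain Q2 \<gamma> \<sigma> where *: "Q = \<gamma> @ \<beta> @ \<sigma> @ Q2" "weaves B1 \<sigma>" "weaves B2 Q2" by auto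
    then have "weaves (B1 @ B2) (\<sigma> @ Q2)" using Cons by blast
    moreover have "Q = \<gamma> @ \<beta> @ (\<sigma> @ Q2)" using * by simp
    ultimately show "weaves ((\<beta> # B1) @ B2) Q" unfolding append_Cons weaves.simps by blast
  qed
qed

lemma weaves_postpend: "weaves Bl Q \<Longrightarrow> weaves Bl (Q @ \<tau>)"
  using weaves_append[of Bl "[]" "Q @ \<tau>"] by (metis append_Nil2 weaves.simps(1))

lemma weaves_rev: "weaves Bl Q \<Longrightarrow> weaves (rev (map rev Bl)) (rev Q)"
proof (induction Bl arbitrary: Q)
  case (Cons \<beta> Bl)
  then obtain \<gamma> \<sigma> where *: "Q = \<gamma> @ \<beta> @ \<sigma>" "weaves Bl \<sigma>" by auto
  then have "weaves (rev (map rev Bl)) (rev \<sigma>)" using Cons by blast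
  moreover have "weaves [rev \<beta>] (rev \<beta> @ rev \<gamma>)" by force
  ultimately have "weaves (rev (map rev Bl) @ [rev \<beta>]) (rev \<sigma> @ rev \<beta> @ rev \<gamma>)"
    unfolding weaves_append by blast
  then show ?case using * by simp
qed simp

lemma weaves_concat: "weaves Bl (concat Bl)"
  by (induction Bl) auto

lemma weaves_split:
  "weaves (B1 @ \<beta> # B2) Q \<longleftrightarrow> (\<exists>\<rho> \<sigma>. Q = \<rho> @ \<beta> @ \<sigma> \<and> weaves B1 \<rho> \<and> weaves B2 \<sigma>)"
proof
  assume "weaves (B1 @ \<beta> # B2) Q"
  then obtain Q1 \<gamma> \<sigma> where "Q = Q1 @ \<gamma> @ \<beta> @ \<sigma>" "weaves B1 Q1" "weaves B2 \<sigma>"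
    unfolding weaves_append by auto
  then show "\<exists>\<rho> \<sigma>. Q = \<rho> @ \<beta> @ \<sigma> \<and> weaves B1 \<rho> \<and> weaves B2 \<sigma>"
    by (intro exI[of _ "Q1 @ \<gamma>"] exI[of _ \<sigma>]) (auto simp: weaves_postpend)
next
  assume "\<exists>\<rho> \<sigma>. Q = \<rho> @ \<beta> @ \<sigma> \<and> weaves B1 \<rho> \<and> weaves B2 \<sigma>"
  then obtain \<rho> \<sigma> where *: "Q = \<rho> @ \<beta> @ \<sigma>" "weaves B1 \<rho>" "weaves B2 \<sigma>" by auto
  have "weaves (\<beta> # B2) (\<beta> @ \<sigma>)" using *(3) by force
  with * show "weaves (B1 @ \<beta> # B2) Q" unfolding weaves_append by blast
qed

lemma weaves_infix:
  assumes "weaves Bl Q" "\<beta> \<in> set Bl"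
  shows "\<exists>\<rho> \<sigma>. Q = \<rho> @ \<beta> @ \<sigma>"
  using assms weaves_split by (metis in_set_conv_decomp_first)

text \<open>As a total function the path successor can be used for images and injectivity. If
  \<open>u\<close> is absent or stands last, the value is the unspecified
  \<open>hd []\<close>.\<close>

definition next_in :: "'a list \<Rightarrow> 'a \<Rightarrow> 'a" where
  "next_in \<beta> u = hd (tl (dropWhile (\<lambda>x. x \<noteq> u) \<beta>))"

lemma next_in: "distinct (\<alpha> @ u # v # \<gamma>) \<Longrightarrow> next_in (\<alpha> @ u # v # \<gamma>) u = v"
  by (induction \<alpha>) (auto simp: next_in_def)

lemma exists_large_part:
  fixes f :: "nat \<Rightarrow> 'a set"
  assumes "n > 0" "\<And>i. i < n \<Longrightarrow> finite (f i)"
  shows "\<exists>i<n. card (\<Union>i<n. f i) \<le> card (f i) * n"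
proof (rule ccontr)
  assume "\<not> ?thesis"
  then have *: "card (f i) * n < card (\<Union>i<n. f i)" if "i < n" for i using that by force
  have "card (\<Union>i<n. f i) \<le> (\<Sum>i<n. card (f i))" by (rule card_UN_le) simp
  then have "card (\<Union>i<n. f i) * n \<le> (\<Sum>i<n. card (f i) * n)"
    by (simp add: sum_distrib_right[symmetric])
  also have "\<dots> < (\<Sum>i<n. card (\<Union>i<n. f i))"
    using assms * by (intro sum_strict_mono) auto
  finally show False by simp
qed

text \<open>\<open>expansion\<close> is all that remains of the spectrum. A set of density \<sigma>
  should meet a neighbourhood in about \<sigma> * D vertices, so an excess of (\<tau> - \<sigma>) *
  D at every vertex of \<open>A\<close> forces \<open>A\<close> to be small. \<kappa> stands for the
  ratio of degree to \<lambda>. Both \<open>D\<close> and \<kappa> are parameters of their own, so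
  that the locale serves the whole graph as well as its induced subgraphs.\<close>

locale expander =
  fixes V :: "'a set" and E :: "'a \<Rightarrow> 'a \<Rightarrow> bool" and D \<kappa> \<epsilon> :: real
  assumes finV: "finite V" and sym: "E u v \<Longrightarrow> E v u" and irrefl: "\<not> E v v"
    and D_pos: "D > 0" and eps_pos: "\<epsilon> > 0" and eps_le: "\<epsilon> \<le> 1/2" and kappa_pos: "\<kappa> > 0"
    and mindeg: "v \<in> V \<Longrightarrow> (1/2 + \<epsilon>) * D \<le> dgr E v V"
    and expansion: "\<lbrakk>A \<subseteq> V; B \<subseteq> V; \<And>a. a \<in> A \<Longrightarrow> \<tau> * D \<le> dgr E a B;
        real (card B) \<le> \<sigma> * real (card V); \<sigma> < \<tau>\<rbrakk> \<Longrightarrow> ((\<tau> - \<sigma>) * \<kappa>)\<^sup>2 * card A \<le> card B"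
begin

definition pth :: "'a list \<Rightarrow> bool" where
  "pth xs \<longleftrightarrow> xs \<noteq> [] \<and> distinct xs \<and> set xs \<subseteq> V \<and> successively E xs"

lemma pth_rev: "pth xs \<Longrightarrow> pth (rev xs)"
  unfolding pth_def successively_rev using sym by (auto elim: successively_mono)

lemma pth_appendD: "pth (\<alpha> @ \<beta>) \<Longrightarrow> \<beta> \<noteq> [] \<Longrightarrow> pth \<beta>"
  "pth (\<alpha> @ \<beta>) \<Longrightarrow> \<alpha> \<noteq> [] \<Longrightarrow> pth \<alpha>"
  by (auto simp: pth_def successively_append_iff)

text \<open>Posa's rotation: the chord from the first vertex to \<open>v\<close> replaces the edge
  between \<open>u\<close> and \<open>v\<close>, and the part up to \<open>u\<close> is traversed
  backwards. Writing the first vertex as \<open>hd (\<alpha> @ [u])\<close> admits an empty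
  \<alpha>, where nothing changes.\<close>

lemma pth_rotate:
  assumes "pth (\<alpha> @ u # v # \<sigma>)" "E (hd (\<alpha> @ [u])) v"
  shows "pth (u # rev \<alpha> @ v # \<sigma>)"
proof -
  have "successively E (\<alpha> @ [u])" using assms by (auto simp: pth_def successively_append_iff)
  then have "successively E (rev (\<alpha> @ [u]))"
    unfolding successively_rev by (rule successively_mono) (auto intro: sym)
  then have "successively E (rev (\<alpha> @ [u]) @ v # \<sigma>)"
    using assms unfolding successively_append_iff
    by (auto simp: pth_def successively_append_iff last_rev split: if_splits)
  then have "successively E (u # rev \<alpha> @ v # \<sigma>)" by simp
  moreover have "distinct (u # rev \<alpha> @ v # \<sigma>)" "set (u # rev \<alpha> @ v # \<sigma>) \<subseteq> V"
    using assms(1) unfolding pth_def by auto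
  ultimately show ?thesis unfolding pth_def by simp
qed

definition cyc :: "'a list \<Rightarrow> bool" where
  "cyc xs \<longleftrightarrow> pth xs \<and> 3 \<le> length xs \<and> E (last xs) (hd xs)"

end

text \<open>\<open>X\<close> is meant to be the vertex set of a longest path, of whose length only
  \<open>maximal\<close> is retained: no path spanning \<open>X\<close> can be prolonged at its
  first vertex. Vertices of \<open>Bad\<close> must not become ends, and \<open>BN\<close> collects
  their neighbours on the path. There are \<open>M\<close> blocks, and \<open>m\<close> rounds for
  either end. The numerical bounds keep each of the three losses in \<open>deg_piv\<close> at most
  \<open>\<epsilon>/8 * D\<close>.\<close>

locale rotation_system = expander +
  fixes X Bad BN :: "'a set" and \<tau> :: real and M m :: nat
  assumes maximal: "\<lbrakk>pth Q; set Q = X; E (hd Q) u; u \<in> V\<rbrakk> \<Longrightarrow> u \<in> X"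
    and BN: "BN \<subseteq> V" "\<And>v. v \<in> V - Bad \<Longrightarrow> dgr E v BN \<le> \<epsilon>/8 * D"
    and tau: "2 * m * \<tau> \<le> \<epsilon>/8" "\<tau> > 0" and M: "M \<le> \<epsilon>/8 * D" "M > 2 * m" and XV: "X \<subseteq> V"
begin

text \<open>Both conditions concern the block alone and not its place in a path; hence they survive
  reversal and cutting.\<close>

definition fine :: "'a list \<Rightarrow> bool" where
  "fine \<beta> \<longleftrightarrow> (\<forall>v\<in>V - Bad. dgr E v (set \<beta>) \<le> \<tau> * D) \<and>
     (\<forall>\<alpha> u v \<gamma>. \<beta> = \<alpha> @ u # v # \<gamma> \<longrightarrow> (u \<in> Bad \<longrightarrow> v \<in> BN) \<and> (v \<in> Bad \<longrightarrow> u \<in> BN))"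

lemma fine_rev: "fine \<beta> \<Longrightarrow> fine (rev \<beta>)"
  unfolding fine_def
proof (intro conjI allI impI ballI; (elim conjE)?)
  fix \<alpha> u v \<gamma>
  assume *: "\<forall>\<alpha> u v \<gamma>. \<beta> = \<alpha> @ u # v # \<gamma> \<longrightarrow> (u \<in> Bad \<longrightarrow> v \<in> BN) \<and> (v \<in> Bad \<longrightarrow> u \<in> BN)"
    and "rev \<beta> = \<alpha> @ u # v # \<gamma>"
  then have "\<beta> = rev \<gamma> @ v # u # rev \<alpha>" by (simp add: rev_swap)
  with * show "u \<in> Bad \<Longrightarrow> v \<in> BN" "v \<in> Bad \<Longrightarrow> u \<in> BN" by blast+
qed auto

lemma fine_append:
  assumes "fine (\<beta> @ \<beta>')" shows "fine \<beta>" "fine \<beta>'"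
proof -
  have "dgr E v (set \<beta>) \<le> dgr E v (set (\<beta> @ \<beta>'))" "dgr E v (set \<beta>') \<le> dgr E v (set (\<beta> @ \<beta>'))" for v
    unfolding dgr_def by (intro card_mono; force)+
  then have "\<forall>v\<in>V - Bad. dgr E v (set \<beta>) \<le> \<tau> * D" "\<forall>v\<in>V - Bad. dgr E v (set \<beta>') \<le> \<tau> * D"
    using assms unfolding fine_def by (meson of_nat_mono order_trans)+
  moreover have "\<beta> @ \<beta>' = \<alpha> @ u # v # \<gamma> @ \<beta>'" if "\<beta> = \<alpha> @ u # v # \<gamma>" for \<alpha> u v \<gamma> using that by simp
  moreover have "\<beta> @ \<beta>' = (\<beta> @ \<alpha>) @ u # v # \<gamma>" if "\<beta>' = \<alpha> @ u # v # \<gamma>" for \<alpha> u v \<gamma> using that by simp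
  ultimately show "fine \<beta>" "fine \<beta>'" using assms unfolding fine_def by metis+
qed

text \<open>A rotation at \<open>v\<close> turns the vertex in front of it into an end, so that
  vertex must be known and outside \<open>Bad\<close>. The first vertex of a block is left out
  because what precedes it varies from path to path.\<close>

definition piv :: "'a list list \<Rightarrow> 'a set" where
  "piv Bl = {v. \<exists>\<beta>\<in>set Bl. \<exists>\<alpha> u \<gamma>. \<beta> = \<alpha> @ u # v # \<gamma> \<and> u \<notin> Bad}"

text \<open>The blocks in \<open>Bl\<close> survive intact, and in the same order, in all the paths joining \<open>A\<close> to \<open>B\<close>;
  this is what makes the rotations at the two ends independent of each other.\<close>

definition linked :: "'a set \<Rightarrow> 'a set \<Rightarrow> 'a list list \<Rightarrow> 'a list list \<Rightarrow> bool" where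
  "linked A B Bl Dr \<longleftrightarrow> A \<subseteq> V - Bad \<and> B \<subseteq> V - Bad \<and> A \<noteq> {} \<and> B \<noteq> {} \<and>
     (\<forall>\<beta>\<in>set Bl \<union> set Dr. fine \<beta>) \<and> X \<subseteq> set (concat Bl) \<union> set (concat Dr) \<and>
     length Bl + length Dr = M \<and>
     (\<forall>a\<in>A. \<forall>b\<in>B. \<exists>Q. pth Q \<and> set Q = X \<and> hd Q = a \<and> last Q = b \<and> weaves Bl Q)"

lemma linked_sym:
  assumes "linked A B Bl Dr"
  shows "linked B A (rev (map rev Bl)) Dr"
proof -
  have "\<exists>Q. pth Q \<and> set Q = X \<and> hd Q = b \<and> last Q = a \<and> weaves (rev (map rev Bl)) Q"
    if "a \<in> A" "b \<in> B" for a b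
  proof -
    obtain Q where "pth Q" "set Q = X" "hd Q = a" "last Q = b" "weaves Bl Q"
      using assms \<open>a \<in> A\<close> \<open>b \<in> B\<close> unfolding linked_def by metis
    then show ?thesis
      by (intro exI[of _ "rev Q"]) (auto simp: pth_rev weaves_rev hd_rev last_rev)
  qed
  moreover have "fine \<beta>" if "\<beta> \<in> set (rev (map rev Bl))" for \<beta>
    using that assms fine_rev unfolding linked_def by auto
  moreover have "set (concat (rev (map rev Bl))) = set (concat Bl)" by auto
  ultimately show ?thesis using assms unfolding linked_def by auto
qed

lemma piv_subset:
  assumes "linked A B Bl Dr" shows "piv Bl \<subseteq> X"
proof
  fix v assume "v \<in> piv Bl"
  then obtain \<beta> where "\<beta> \<in> set Bl" "v \<in> set \<beta>" unfolding piv_def by force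
  moreover obtain Q where "set Q = X" "weaves Bl Q" using assms unfolding linked_def by blast
  ultimately show "v \<in> X" using weaves_infix[of Bl Q \<beta>] by auto
qed

lemma finX: "finite X"
  using XV finV finite_subset by blast

text \<open>By maximality all neighbours of \<open>a\<close> lie in \<open>X\<close>. One that is
  not a pivot opens a block, or follows a bad vertex and so lies in \<open>BN\<close>, or belongs to
  one of the at most \<open>2 * m\<close> blocks already used up. Each kind accounts for at most
  \<open>\<epsilon>/8 * D\<close> neighbours.\<close>

lemma deg_piv:
  assumes "linked A B Bl Dr" "a \<in> A" "length Dr \<le> 2 * m"
  shows "(1/2 + \<epsilon>/2) * D \<le> dgr E a (piv Bl)"
proof -
  have aV: "a \<in> V - Bad" using assms unfolding linked_def by auto
  obtain Q where Q: "pth Q" "set Q = X" "hd Q = a"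
    using assms unfolding linked_def by blast
  define P1 where "P1 = {u \<in> piv Bl. E a u}"
  define P2 where "P2 = hd ` set Bl"
  define P3 where "P3 = {u \<in> BN. E a u}"
  define P4 where "P4 = (\<lambda>i. {u \<in> set (Dr ! i). E a u})"
  have sub: "{u \<in> V. E a u} \<subseteq> P1 \<union> P2 \<union> P3 \<union> (\<Union>i<length Dr. P4 i)"
  proof
    fix u assume u: "u \<in> {u \<in> V. E a u}"
    then have "u \<in> X" using maximal Q by auto
    moreover have "X \<subseteq> set (concat Bl) \<union> set (concat Dr)"
      using assms(1) unfolding linked_def by blast
    ultimately consider "u \<in> set (concat Bl)" | "u \<in> set (concat Dr)" by blast
    then show "u \<in> P1 \<union> P2 \<union> P3 \<union> (\<Union>i<length Dr. P4 i)"
    proof cases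
      case 2
      then obtain \<beta> where "\<beta> \<in> set Dr" "u \<in> set \<beta>" by auto
      then obtain i where "i < length Dr" "Dr ! i = \<beta>" by (metis in_set_conv_nth)
      then show ?thesis using u \<open>u \<in> set \<beta>\<close> unfolding P4_def by auto
    next
      case 1
      then obtain \<beta> where b: "\<beta> \<in> set Bl" "u \<in> set \<beta>" by auto
      then obtain \<alpha> \<gamma> where \<beta>: "\<beta> = \<alpha> @ u # \<gamma>" by (meson split_list)
      show ?thesis
      proof (cases "\<alpha> = []")
        case True
        then show ?thesis using b \<beta> unfolding P2_def by force
      next
        case False
        then have \<beta>': "\<beta> = butlast \<alpha> @ last \<alpha> # u # \<gamma>" using \<beta> by simp
        have "fine \<beta>" using b assms unfolding linked_def by auto
        then have "last \<alpha> \<in> Bad \<longrightarrow> u \<in> BN" using \<beta>' unfolding fine_def by blast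
        moreover have "last \<alpha> \<notin> Bad \<Longrightarrow> u \<in> piv Bl" using b \<beta>' unfolding piv_def by blast
        ultimately show ?thesis using u unfolding P1_def P3_def by blast
      qed
    qed
  qed
  have fin: "finite P1" "finite P2" "finite P3" "\<And>i. finite (P4 i)"
    using piv_subset[OF assms(1)] finX finite_subset BN finV
    unfolding P1_def P2_def P3_def P4_def by (auto intro: finite_subset)
  have "dgr E a V \<le> card (P1 \<union> P2 \<union> P3 \<union> (\<Union>i<length Dr. P4 i))"
    unfolding dgr_def using sub fin by (intro card_mono) auto
  also have "\<dots> \<le> card (P1 \<union> P2 \<union> P3) + card (\<Union>i<length Dr. P4 i)" by (rule card_Un_le)
  also have "\<dots> \<le> card P1 + card P2 + card P3 + (\<Sum>i<length Dr. card (P4 i))"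
    using card_Un_le[of "P1 \<union> P2" P3] card_Un_le[of P1 P2] card_UN_le[of "{..<length Dr}" P4]
    by simp
  finally have "real (dgr E a V) \<le> card P1 + card P2 + card P3 + (\<Sum>i<length Dr. real (card (P4 i)))"
    by (simp flip: of_nat_sum of_nat_add)
  moreover have "real (card P2) \<le> \<epsilon>/8 * D"
  proof -
    have "card P2 \<le> length Bl" unfolding P2_def by (metis card_image_le card_length finite_set le_trans)
    then show ?thesis using assms(1) M unfolding linked_def by linarith
  qed
  moreover have "real (card P3) \<le> \<epsilon>/8 * D"
    using BN(2)[OF aV] unfolding P3_def dgr_def .
  moreover have "(\<Sum>i<length Dr. real (card (P4 i))) \<le> \<epsilon>/8 * D"
  proof -
    have "(\<Sum>i<length Dr. real (card (P4 i))) \<le> (\<Sum>i<length Dr. \<tau> * D)"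
    proof (intro sum_mono)
      fix i assume "i \<in> {..<length Dr}"
      then have "fine (Dr ! i)" using assms unfolding linked_def by auto
      then show "real (card (P4 i)) \<le> \<tau> * D" using aV unfolding fine_def P4_def dgr_def by auto
    qed
    also have "\<dots> = length Dr * (\<tau> * D)" by simp
    also have "\<dots> \<le> (2 * m) * (\<tau> * D)"
      using assms(3) tau D_pos by (intro mult_right_mono) auto
    also have "\<dots> = (2 * m * \<tau>) * D" by simp
    also have "\<dots> \<le> \<epsilon>/8 * D" using tau D_pos by (intro mult_right_mono) auto
    finally show ?thesis .
  qed
  moreover have "(1/2 + \<epsilon>) * D \<le> dgr E a V" using mindeg aV by auto
  ultimately have "(1/2 + \<epsilon>) * D - 3 * (\<epsilon>/8 * D) \<le> card P1" by linarith
  moreover have "(1/2 + \<epsilon>/2) * D \<le> (1/2 + \<epsilon>) * D - 3 * (\<epsilon>/8 * D)"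
    using eps_pos D_pos by (simp add: field_simps)
  ultimately show ?thesis unfolding P1_def dgr_def by linarith
qed

section \<open>Rounds of expansion, each followed by rotations in one block\<close>

definition reachable_piv :: "'a set \<Rightarrow> 'a list list \<Rightarrow> 'a set" where
  "reachable_piv A Bl = {v \<in> piv Bl. \<exists>a\<in>A. E a v}"

text \<open>\<open>expansion\<close> speaks only of target sets of bounded density. It is applied
  with \<open>\<tau> = 1/2 + \<epsilon>/2\<close> and \<open>\<sigma> = 1/2 + \<epsilon>/4\<close>,
  which explains the alternative: either the target is already denser than \<sigma>, or it outgrows
  \<open>A\<close> by the square of \<open>\<epsilon>/4 * \<kappa>\<close>.\<close>

lemma card_reachable_piv:
  assumes "linked A B Bl Dr" "length Dr \<le> 2 * m"
  shows "D/2 \<le> card (reachable_piv A Bl)"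
    and "(1/2 + \<epsilon>/4) * real (card V) < real (card (reachable_piv A Bl)) \<or>
         (\<epsilon>/4 * \<kappa>)\<^sup>2 * real (card A) \<le> real (card (reachable_piv A Bl))"
proof -
  have RV: "reachable_piv A Bl \<subseteq> V" using piv_subset[OF assms(1)] XV unfolding reachable_piv_def by auto
  have deg: "(1/2 + \<epsilon>/2) * D \<le> dgr E a (reachable_piv A Bl)" if "a \<in> A" for a
  proof -
    have "{u \<in> reachable_piv A Bl. E a u} = {u \<in> piv Bl. E a u}"
      using that unfolding reachable_piv_def by auto
    then show ?thesis using deg_piv[OF assms(1) that assms(2)] unfolding dgr_def by simp
  qed
  obtain a where "a \<in> A" using assms unfolding linked_def by auto
  have "dgr E a (reachable_piv A Bl) \<le> card (reachable_piv A Bl)"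
    unfolding dgr_def using RV finV finite_subset by (intro card_mono) auto
  then have "(1/2 + \<epsilon>/2) * D \<le> card (reachable_piv A Bl)" using deg[OF \<open>a \<in> A\<close>] by linarith
  moreover have "D/2 \<le> (1/2 + \<epsilon>/2) * D" using eps_pos D_pos by (simp add: field_simps)
  ultimately show "D/2 \<le> card (reachable_piv A Bl)" by linarith
  show "(1/2 + \<epsilon>/4) * card V < card (reachable_piv A Bl) \<or>
         (\<epsilon>/4 * \<kappa>)\<^sup>2 * card A \<le> card (reachable_piv A Bl)"
  proof (rule disjCI)
    assume "\<not> (\<epsilon>/4 * \<kappa>)\<^sup>2 * card A \<le> card (reachable_piv A Bl)"
    moreover have "A \<subseteq> V" using assms unfolding linked_def by auto
    ultimately show "(1/2 + \<epsilon>/4) * card V < card (reachable_piv A Bl)"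
      using expansion[where A = A and B = "reachable_piv A Bl" and \<tau> = "1/2 + \<epsilon>/2" and \<sigma> = "1/2 + \<epsilon>/4"] deg RV eps_pos
      by (force simp: not_le)
  qed
qed

text \<open>Among the remaining blocks, of which there are at most \<open>M\<close>, take one
  holding at least the average share of the reachable pivots, and rotate only there. The vertices in
  front of these pivots are the new first ends. A rotation does not touch the last vertex, so all
  pairs of ends stay joined.\<close>

lemma linked_step:
  assumes "linked A B Bl Dr" "length Dr < 2 * m"
  shows "\<exists>A' Bl' Dr'. linked A' B Bl' Dr' \<and> length Dr' = Suc (length Dr) \<and>
           card (reachable_piv A Bl) \<le> card A' * M"
proof -
  define N where "N = (\<lambda>i. {v. \<exists>\<alpha> u \<gamma>. Bl ! i = \<alpha> @ u # v # \<gamma> \<and> u \<notin> Bad \<and> (\<exists>a\<in>A. E a v)})"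
  have lenBl: "length Bl + length Dr = M" using assms unfolding linked_def by simp
  have Bl0: "0 < length Bl" using lenBl assms M by auto
  have eq: "reachable_piv A Bl = (\<Union>i<length Bl. N i)"
  proof (intro Set.set_eqI iffI)
    fix v assume "v \<in> reachable_piv A Bl"
    then obtain \<beta> \<alpha> u \<gamma> where *: "\<beta> \<in> set Bl" "\<beta> = \<alpha> @ u # v # \<gamma>" "u \<notin> Bad" "\<exists>a\<in>A. E a v"
      unfolding reachable_piv_def piv_def by blast
    then obtain i where "i < length Bl" "Bl ! i = \<beta>" by (metis in_set_conv_nth)
    then have "v \<in> N i" using * unfolding N_def by blast
    then show "v \<in> (\<Union>i<length Bl. N i)" using \<open>i < length Bl\<close> by blast
  next
    fix v assume "v \<in> (\<Union>i<length Bl. N i)"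
    then obtain i where "i < length Bl" "v \<in> N i" by blast
    moreover from this have "Bl ! i \<in> set Bl" by simp
    ultimately show "v \<in> reachable_piv A Bl" unfolding reachable_piv_def piv_def N_def by blast
  qed
  have finN: "finite (N i)" for i
    by (rule finite_subset[of _ "set (Bl ! i)"]) (auto simp: N_def)
  obtain i where i: "i < length Bl" "card (reachable_piv A Bl) \<le> card (N i) * length Bl"
    using exists_large_part[OF Bl0, of N] finN unfolding eq by blast
  define \<beta> where "\<beta> = Bl ! i"
  define B1 where "B1 = take i Bl"
  define B2 where "B2 = drop (Suc i) Bl"
  have Bl: "Bl = B1 @ \<beta> # B2" unfolding B1_def B2_def \<beta>_def by (simp add: i id_take_nth_drop)
  define A' where "A' = {u. \<exists>\<alpha> v \<gamma>. \<beta> = \<alpha> @ u # v # \<gamma> \<and> u \<notin> Bad \<and> (\<exists>a\<in>A. E a v)}"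
  obtain a0 b0 Q0 where Q0: "pth Q0" "set Q0 = X" "weaves Bl Q0" "a0 \<in> A" "b0 \<in> B"
    using assms unfolding linked_def by (metis ex_in_conv)
  have "\<beta> \<in> set Bl" unfolding Bl by simp
  then obtain \<rho> \<sigma> where "Q0 = \<rho> @ \<beta> @ \<sigma>" using weaves_infix[OF Q0(3)] by blast
  then have \<beta>X: "distinct \<beta>" "set \<beta> \<subseteq> X" using Q0 by (auto simp: pth_def)
  have "N i \<subseteq> next_in \<beta> ` A'"
  proof
    fix v assume "v \<in> N i"
    then obtain \<alpha> u \<gamma> where *: "\<beta> = \<alpha> @ u # v # \<gamma>" "u \<notin> Bad" "\<exists>a\<in>A. E a v" unfolding N_def \<beta>_def by blast
    then have "u \<in> A'" unfolding A'_def by blast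
    moreover have "next_in \<beta> u = v" using \<beta>X(1) next_in unfolding *(1) by metis
    ultimately    show "v \<in> next_in \<beta> ` A'" by blast
  qed
  moreover have A'X: "A' \<subseteq> X" using \<beta>X unfolding A'_def by auto
  ultimately have cardA': "card (N i) \<le> card A'"
    using finX finite_subset by (meson surj_card_le)
  have card: "card (reachable_piv A Bl) \<le> card A' * M"
    using i(2) lenBl cardA' by (meson le_add1 le_trans mult_le_mono)
  have "D/2 \<le> card (reachable_piv A Bl)" using card_reachable_piv(1)[OF assms(1)] assms(2) by simp
  then have "0 < card (reachable_piv A Bl)" using D_pos by (cases "card (reachable_piv A Bl)") auto
  then have A'ne: "A' \<noteq> {}" using card by auto
  \<comment> \<open>Rotating at a pivot in \<beta> reverses all blocks before it and keeps those
    behind it, whichever pivot of \<beta> is taken. Hence one list \<open>Bl'\<close> serves all new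
    ends.\<close>
  define Bl' where "Bl' = rev (map rev B1) @ B2"
  have "linked A' B Bl' (\<beta> # Dr)"
    unfolding linked_def
  proof (intro conjI)
    show "A' \<subseteq> V - Bad" using A'X XV unfolding A'_def by auto
    show "B \<subseteq> V - Bad" "B \<noteq> {}" using assms unfolding linked_def by auto
    show "A' \<noteq> {}" by (fact A'ne)
    show "\<forall>\<beta>'\<in>set Bl' \<union> set (\<beta> # Dr). fine \<beta>'"
      using assms(1) fine_rev unfolding linked_def Bl Bl'_def by auto
    show "X \<subseteq> set (concat Bl') \<union> set (concat (\<beta> # Dr))"
      using assms(1) unfolding linked_def Bl Bl'_def by auto
    show "length Bl' + length (\<beta> # Dr) = M" using lenBl unfolding Bl Bl'_def by simp
    show "\<forall>a\<in>A'. \<forall>b\<in>B. \<exists>Q. pth Q \<and> set Q = X \<and> hd Q = a \<and> last Q = b \<and> weaves Bl' Q"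
    proof (intro ballI)
      fix u b assume "u \<in> A'" "b \<in> B"
      then obtain \<alpha> v \<gamma> a where *: "\<beta> = \<alpha> @ u # v # \<gamma>" "a \<in> A" "E a v" unfolding A'_def by blast
      obtain Q where Q: "pth Q" "set Q = X" "hd Q = a" "last Q = b" "weaves Bl Q"
        using assms * \<open>b \<in> B\<close> unfolding linked_def by blast
      obtain \<rho> \<sigma> where rs: "Q = \<rho> @ \<beta> @ \<sigma>" "weaves B1 \<rho>" "weaves B2 \<sigma>"
        using Q(5) unfolding Bl weaves_split by blast
      define R where "R = u # rev (\<rho> @ \<alpha>) @ v # \<gamma> @ \<sigma>"
      have Qeq: "Q = (\<rho> @ \<alpha>) @ u # v # \<gamma> @ \<sigma>" using rs * by simp
      have "hd ((\<rho> @ \<alpha>) @ [u]) = a"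
      proof (cases "\<rho> @ \<alpha>")
        case Nil
        then show ?thesis using Q(3) Qeq by auto
      next
        case (Cons w ws)
        then show ?thesis using Q(3) Qeq by (metis hd_append2 list.distinct(1))
      qed
      then have "pth R" using pth_rotate[of "\<rho> @ \<alpha>" u v "\<gamma> @ \<sigma>"] Q(1) Qeq *(3) unfolding R_def by auto
      moreover have "set R = X" using Q(2) unfolding R_def Qeq by auto
      moreover have "last R = b" using Q(4) unfolding R_def Qeq by auto
      moreover have "weaves Bl' R"
      proof -
        have "weaves (rev (map rev B1)) ((u # rev \<alpha>) @ rev \<rho>)" using weaves_rev[OF rs(2)] weaves_prepend by blast
        moreover have "weaves B2 ((v # \<gamma>) @ \<sigma>)" using rs(3) weaves_prepend by blast
        ultimately have "weaves Bl' (((u # rev \<alpha>) @ rev \<rho>) @ (v # \<gamma>) @ \<sigma>)"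
          unfolding Bl'_def weaves_append by blast
        then show ?thesis unfolding R_def by simp
      qed
      ultimately show "\<exists>Q. pth Q \<and> set Q = X \<and> hd Q = u \<and> last Q = b \<and> weaves Bl' Q"
        unfolding R_def by (metis list.sel(1))
    qed
  qed
  then show ?thesis using card by (intro exI[of _ A'] exI[of _ Bl'] exI[of _ "\<beta> # Dr"]) auto
qed

text \<open>The first round gains \<open>D/2\<close> from the degrees alone. Each later one gains
  the factor \<open>(\<epsilon>/4 * \<kappa>)\<^sup>2\<close> by expansion, and every round loses
  \<open>M\<close> by the choice of a block. The minimum accounts for saturation; the 2 in
  \<open>2 * M\<close> comes from \<open>D/2\<close> and from the density 1/2 at which expansion may
  stop.\<close>

lemma linked_steps:
  assumes "linked A B Bl Dr" "length Dr + Suc i \<le> 2 * m" "2 * M \<le> (\<epsilon>/4 * \<kappa>)\<^sup>2"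
  shows "\<exists>A' Bl' Dr'. linked A' B Bl' Dr' \<and> length Dr' = length Dr + Suc i \<and>
           min (D * ((\<epsilon>/4 * \<kappa>)\<^sup>2 / M) ^ i) (card V) \<le> card A' * (2 * M)"
  using assms(2)
proof (induction i)
  case 0
  obtain A' Bl' Dr' where *: "linked A' B Bl' Dr'" "length Dr' = Suc (length Dr)"
    "card (reachable_piv A Bl) \<le> card A' * M"
    using linked_step[OF assms(1)] 0 by auto
  have "D/2 \<le> card (reachable_piv A Bl)" using card_reachable_piv(1)[OF assms(1)] 0 by auto
  then have "D/2 \<le> card A' * M" using *(3) by (metis of_nat_mono order_trans)
  then have "min (D * ((\<epsilon>/4 * \<kappa>)\<^sup>2 / M) ^ 0) (card V) \<le> card A' * (2 * M)" by simp
  then show ?case using * by (metis One_nat_def add_Suc_right add.right_neutral)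
next
  case (Suc i)
  define K where "K = (\<epsilon>/4 * \<kappa>)\<^sup>2"
  have M0: "real M > 0" using M by simp
  obtain A1 Bl1 Dr1 where 1: "linked A1 B Bl1 Dr1" "length Dr1 = length Dr + Suc i"
    "min (D * (K / M) ^ i) (card V) \<le> card A1 * (2 * M)"
    using Suc unfolding K_def by auto
  obtain A' Bl' Dr' where *: "linked A' B Bl' Dr'" "length Dr' = Suc (length Dr1)"
    "card (reachable_piv A1 Bl1) \<le> card A' * M"
    using linked_step[OF 1(1)] 1 Suc by auto
  have *: "linked A' B Bl' Dr'" "length Dr' = length Dr + Suc (Suc i)"
    "real (card (reachable_piv A1 Bl1)) \<le> card A' * M"
    using * 1 by (simp_all flip: of_nat_mult)
  have "(1/2 + \<epsilon>/4) * card V < card (reachable_piv A1 Bl1) \<or>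
         K * card A1 \<le> card (reachable_piv A1 Bl1)"
    using card_reachable_piv(2)[OF 1(1)] 1 Suc unfolding K_def by auto
  then have "min (D * (K/M) ^ Suc i) (card V) \<le> card A' * (2 * M)"
  proof
    assume "(1/2 + \<epsilon>/4) * card V < card (reachable_piv A1 Bl1)"
    moreover have "1/2 * card V \<le> (1/2 + \<epsilon>/4) * card V" using eps_pos by (intro mult_right_mono) auto
    ultimately have "1/2 * card V \<le> card A' * M" using *(3) by linarith
    then show ?thesis by simp
  next
    assume "K * card A1 \<le> card (reachable_piv A1 Bl1)"
    then have "K * card A1 \<le> card A' * M" using *(3) by linarith
    then have K: "(K/M) * (card A1 * (2*M)) \<le> card A' * (2 * M)"
      using M0 by (simp add: field_simps)
    have KM: "K/M \<ge> 1" using assms(3) M0 unfolding K_def by (simp add: field_simps)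
    have "(K/M) * min (D * (K / M) ^ i) (card V) \<le> (K/M) * (card A1 * (2*M))"
      using 1(3) KM by (intro mult_left_mono) auto
    moreover have "min (D * (K/M) ^ Suc i) (card V) \<le> (K/M) * min (D * (K / M) ^ i) (card V)"
    proof (cases "D * (K / M) ^ i \<le> card V")
      case True
      then show ?thesis by (simp add: mult.left_commute min_def)
    next
      case False
      have "1 * real (card V) \<le> (K/M) * card V" using KM by (intro mult_right_mono) auto
      then show ?thesis using False by (simp add: min_def)
    qed
    ultimately show ?thesis using K by linarith
  qed
  then show ?case using * unfolding K_def by blast
qed

text \<open>Close a path \<open>a \<dots> u v \<dots> b\<close> by the two chords \<open>av\<close> and \<open>ub\<close>.\<close>

lemma linked_closes:
  assumes "linked A B Bl Dr" "length Dr \<le> 2 * m"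
    "card V \<le> card A * (2 * M)" "card V \<le> card B * (2 * M)" "2 * M \<le> (\<epsilon>/4 * \<kappa>)\<^sup>2" "3 \<le> card X"
  shows "\<exists>C. cyc C \<and> set C = X"
proof -
  define Bl' where "Bl' = rev (map rev Bl)"
  have lBA: "linked B A Bl' Dr" unfolding Bl'_def using linked_sym[OF assms(1)] .
  have X0: "0 < card X" and XN: "card X \<le> card V" using assms XV finV card_mono by auto
  have M0: "real M > 0" using M by simp
  \<comment> \<open>One more expansion, without rotation, carries each set of ends past half of all
    vertices: the ends number at least |V| / (2M), and the expansion factor is at least 2M.\<close>
  have half: "card V / 2 < card (reachable_piv S L)"
    if "linked S T L Dr" "card V \<le> card S * (2 * M)" for S T L
  proof -
    have "(1/2 + \<epsilon>/4) * card V < card (reachable_piv S L) \<or>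
         (\<epsilon>/4 * \<kappa>)\<^sup>2 * card S \<le> card (reachable_piv S L)"
      using card_reachable_piv(2)[OF that(1) assms(2)] .
    moreover have "real (card V) \<le> (\<epsilon>/4 * \<kappa>)\<^sup>2 * card S"
    proof -
      have "real (card V) \<le> real (card S) * (2 * M)" using that(2) by (metis of_nat_le_iff of_nat_mult of_nat_numeral)
      also have "\<dots> \<le> real (card S) * (\<epsilon>/4 * \<kappa>)\<^sup>2" using assms(5) by (intro mult_left_mono) auto
      finally show ?thesis by (simp add: mult.commute)
    qed
    moreover have "card V / 2 < card V" "card V / 2 \<le> (1/2 + \<epsilon>/4) * card V"
      using X0 XN eps_pos by (auto simp: field_simps)
    ultimately show ?thesis by linarith
  qed
  define S where "S = reachable_piv A Bl"
  define T where "T = reachable_piv B Bl'"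
  have "card V / 2 < card S" using half[OF assms(1,3)] unfolding S_def .
  moreover have "card V / 2 < card T" using half[OF lBA assms(4)] unfolding T_def .
  ultimately have ST: "card V < card S + card T" by linarith
  obtain Q0 where Q0: "pth Q0" "set Q0 = X" "weaves Bl Q0" using assms unfolding linked_def by blast
  \<comment> \<open>A pivot of the reversed blocks has, read forwards, its successor inside the same
    block. This successor is therefore the same on every path, and can be read off the single path
    \<open>Q0\<close>.\<close>
  have Tnext: "\<exists>\<beta>\<in>set Bl. \<exists>\<alpha> \<gamma>. \<beta> = \<alpha> @ u # next_in Q0 u # \<gamma>" if uT0: "u \<in> T" for u
  proof -
    have "u \<in> piv Bl'" using uT0 unfolding T_def reachable_piv_def by blast
    then obtain \<beta> \<alpha> w \<gamma> where "\<beta> \<in> set Bl'" "\<beta> = \<alpha> @ w # u # \<gamma>"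
      unfolding piv_def by blast
    then have b: "rev \<beta> \<in> set Bl" "rev \<beta> = rev \<gamma> @ u # w # rev \<alpha>" unfolding Bl'_def by (auto, metis rev.simps(2) rev_append rev_rev_ident append.assoc append_Cons append_Nil)
    then obtain \<rho> \<sigma> where "Q0 = \<rho> @ rev \<beta> @ \<sigma>" using weaves_infix[OF Q0(3)] by blast
    then have "Q0 = (\<rho> @ rev \<gamma>) @ u # w # rev \<alpha> @ \<sigma>" using b by simp
    then have "next_in Q0 u = w" using next_in[of "\<rho> @ rev \<gamma>" u w "rev \<alpha> @ \<sigma>"] Q0(1) unfolding pth_def by auto
    then show ?thesis using b by blast
  qed
  have TX: "T \<subseteq> X" "S \<subseteq> X"
    using piv_subset[OF lBA] piv_subset[OF assms(1)] unfolding S_def T_def reachable_piv_def by blast+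
  have nextX: "next_in Q0 ` T \<subseteq> X"
  proof
    fix w assume "w \<in> next_in Q0 ` T"
    then obtain u where "u \<in> T" "w = next_in Q0 u" by auto
    then obtain \<beta> \<alpha> \<gamma> where "\<beta>\<in>set Bl" "\<beta> = \<alpha> @ u # w # \<gamma>" using Tnext by blast
    then show "w \<in> X" using weaves_infix[OF Q0(3)] Q0(2) by force
  qed
  have inj: "inj_on (next_in Q0) T"
  proof (rule inj_onI)
    fix u u' assume "u \<in> T" "u' \<in> T" and eq: "next_in Q0 u = next_in Q0 u'"
    have rep: "\<exists>\<alpha> \<gamma>. Q0 = \<alpha> @ u # next_in Q0 u # \<gamma>" if uT: "u \<in> T" for u
    proof -
      obtain \<beta> \<alpha> \<gamma> where *: "\<beta>\<in>set Bl" "\<beta> = \<alpha> @ u # next_in Q0 u # \<gamma>" using Tnext[OF uT] by blast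
      then obtain \<rho> \<sigma> where "Q0 = \<rho> @ \<beta> @ \<sigma>" using weaves_infix[OF Q0(3)] by blast
      then have "Q0 = (\<rho> @ \<alpha>) @ u # next_in Q0 u # (\<gamma> @ \<sigma>)"
        by (subst (asm) *(2)) simp
      then show ?thesis by blast
    qed
    obtain \<alpha> \<gamma> \<alpha>' \<gamma>' where 1: "Q0 = \<alpha> @ u # next_in Q0 u # \<gamma>" "Q0 = \<alpha>' @ u' # next_in Q0 u # \<gamma>'"
      using rep \<open>u \<in> T\<close> \<open>u' \<in> T\<close> eq by metis
    define w where "w = next_in Q0 u"
    have "(\<alpha> @ [u]) @ w # \<gamma> = (\<alpha>' @ [u']) @ w # \<gamma>'" "distinct ((\<alpha> @ [u]) @ w # \<gamma>)"
      using 1 Q0(1) unfolding w_def pth_def by auto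
    from this(2) have "w \<notin> set (\<alpha> @ [u])" "w \<notin> set \<gamma>" by auto
    from append_Cons_eq_iff[OF this] have "\<alpha> @ [u] = \<alpha>' @ [u']"
      using \<open>(\<alpha> @ [u]) @ w # \<gamma> = (\<alpha>' @ [u']) @ w # \<gamma>'\<close> by blast
    then show "u = u'" by simp
  qed
  have "\<exists>u\<in>T. next_in Q0 u \<in> S"
  proof (rule ccontr)
    assume "\<not> ?thesis"
    then have "next_in Q0 ` T \<inter> S = {}" by blast
    then have "card (next_in Q0 ` T) + card S = card (next_in Q0 ` T \<union> S)"
      using TX finX finite_subset by (metis card_Un_disjoint finite_imageI)
    also have "\<dots> \<le> card V" using nextX TX XV finV by (intro card_mono) auto
    finally show False using ST card_image[OF inj] by simp
  qed
  then obtain u where u: "u \<in> T" "next_in Q0 u \<in> S" by blast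
  define v where "v = next_in Q0 u"
  obtain \<beta> \<alpha> \<gamma> where \<beta>: "\<beta>\<in>set Bl" "\<beta> = \<alpha> @ u # v # \<gamma>" using Tnext u unfolding v_def by blast
  obtain a b where ab: "a \<in> A" "E a v" "b \<in> B" "E b u"
    using u unfolding v_def S_def T_def reachable_piv_def by blast
  obtain Q where Q: "pth Q" "set Q = X" "hd Q = a" "last Q = b" "weaves Bl Q"
    using assms ab unfolding linked_def by blast
  then obtain \<rho> \<sigma> where "Q = \<rho> @ \<beta> @ \<sigma>" using weaves_infix \<beta>(1) by metis
  then have Qeq: "Q = (\<rho> @ \<alpha> @ [u]) @ (v # \<gamma> @ \<sigma>)" using \<beta> by simp
  define C where "C = (\<rho> @ \<alpha> @ [u]) @ rev (v # \<gamma> @ \<sigma>)"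
  have "last (v # \<gamma> @ \<sigma>) = b" using Q(4) unfolding Qeq by simp
  then have hdC: "hd (rev (v # \<gamma> @ \<sigma>)) = b" by (simp only: hd_rev)
  have "successively E (v # \<gamma> @ \<sigma>)" "successively E (\<rho> @ \<alpha> @ [u])"
    using Q(1) unfolding Qeq pth_def successively_append_iff by blast+
  moreover from this have "successively E (rev (v # \<gamma> @ \<sigma>))"
    unfolding successively_rev by (elim successively_mono) (auto intro: sym)
  ultimately have "successively E C"
    unfolding C_def using hdC ab sym by (subst successively_append_iff) auto
  then have "pth C" using Q(1) unfolding C_def Qeq pth_def by auto
  moreover have "set C = X" using Q(2) unfolding C_def Qeq by auto
  moreover from this have "3 \<le> length C" using assms(6) card_length[of C] by simp
  moreover have "E (last C) (hd C)"
  proof -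
    have "last C = v" unfolding C_def by (simp add: last_rev)
    moreover have "hd C = hd Q" unfolding C_def Qeq by (metis append_is_Nil_conv hd_append2 not_Cons_self2)
    ultimately show ?thesis using ab Q sym by auto
  qed
  ultimately show ?thesis unfolding cyc_def by auto
qed

text \<open>\<open>m\<close> rounds are spent on the first end; then the picture is reversed and
  \<open>m\<close> more are spent on the other. The second series leaves the first set of ends
  intact, which is why \<open>linked\<close> quantifies over all pairs of ends.\<close>

lemma spanning_cycle_of_good_ends:
  assumes P: "pth P" "set P = X" "concat Bl = P" "length Bl = M" "\<forall>\<beta>\<in>set Bl. fine \<beta>"
    and ends: "hd P \<notin> Bad" "last P \<notin> Bad"
    and m: "m > 0" and K: "2 * M \<le> (\<epsilon>/4 * \<kappa>)\<^sup>2" "card V \<le> D * ((\<epsilon>/4 * \<kappa>)\<^sup>2 / M) ^ (m - 1)"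
    and "3 \<le> card X"
  shows "\<exists>C. cyc C \<and> set C = X"
proof -
  have "hd P \<in> X" "last P \<in> X" using P(1,2) unfolding pth_def by auto
  moreover have "weaves Bl P" using weaves_concat P by metis
  moreover have "X \<subseteq> set (concat Bl)" using P by blast
  ultimately have 0: "linked {hd P} {last P} Bl []"
    unfolding linked_def using P(1,2,4,5) ends XV by (simp del: set_concat) blast
  obtain A Bl1 Dr1 where 1: "linked A {last P} Bl1 Dr1" "length Dr1 = m"
    "card V \<le> real (card A * (2 * M))"
    using linked_steps[OF 0, of "m - 1"] m K by (auto simp: min_def split: if_splits)
  have sy: "linked {last P} A (rev (map rev Bl1)) Dr1" using linked_sym 1 by blast
  obtain B Bl2 Dr2 where 2: "linked B A Bl2 Dr2" "length Dr2 = 2 * m"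
    "card V \<le> real (card B * (2 * M))"
    using linked_steps[OF sy, of "m - 1"] m K 1 by (auto simp: min_def split: if_splits)
  have "card V \<le> card A * (2 * M)" "card V \<le> card B * (2 * M)" using 1(3) 2(3) by linarith+
  then show ?thesis using linked_closes[OF 2(1)] 2(2) assms by auto
qed

end

section \<open>Rotations from an arbitrary end\<close>

definition adj_in :: "'a list \<Rightarrow> 'a \<Rightarrow> 'a \<Rightarrow> bool" where
  "adj_in Q x y \<longleftrightarrow> (\<exists>\<alpha> \<beta>. Q = \<alpha> @ x # y # \<beta> \<or> Q = \<alpha> @ y # x # \<beta>)"

text \<open>A rotation destroys only the adjacency of \<open>u\<close> and \<open>v\<close>, and
  that pair contains the new first vertex.\<close>

lemma adj_in_rotate:
  assumes "adj_in (\<alpha> @ u # v # \<sigma>) x y" "x \<noteq> u" "y \<noteq> u"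
  shows "adj_in (u # rev \<alpha> @ v # \<sigma>) x y"
proof -
  have *: "(\<exists>\<alpha>1 \<alpha>2. \<alpha> = \<alpha>1 @ x # y # \<alpha>2) \<or> (\<exists>\<alpha>1 \<alpha>2. v # \<sigma> = \<alpha>1 @ x # y # \<alpha>2)"
    if eq: "\<alpha> @ u # v # \<sigma> = \<gamma> @ x # y # \<delta>" and ne: "x \<noteq> u" "y \<noteq> u" for x y \<gamma> \<delta>
  proof -
    from eq consider us where "\<gamma> @ us = \<alpha>" "x # y # \<delta> = us @ u # v # \<sigma>"
      | us where "\<gamma> = \<alpha> @ us" "us @ x # y # \<delta> = u # v # \<sigma>"
      unfolding append_eq_append_conv2 by auto
    then show ?thesis
    proof cases
      case 1
      then obtain us' where "us = x # y # us'"
        using ne by (cases us; cases "tl us") auto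
      then show ?thesis using 1 by auto
    next
      case 2
      then obtain us' where "us = u # us'" using ne by (cases us) auto
      then have "v # \<sigma> = us' @ x # y # \<delta>" using 2 by simp
      then show ?thesis by blast
    qed
  qed
  have "(\<exists>\<alpha>1 \<alpha>2. \<alpha> = \<alpha>1 @ x # y # \<alpha>2) \<or> (\<exists>\<alpha>1 \<alpha>2. v # \<sigma> = \<alpha>1 @ x # y # \<alpha>2) \<or>
        (\<exists>\<alpha>1 \<alpha>2. \<alpha> = \<alpha>1 @ y # x # \<alpha>2) \<or> (\<exists>\<alpha>1 \<alpha>2. v # \<sigma> = \<alpha>1 @ y # x # \<alpha>2)"
    using assms * unfolding adj_in_def by metis
  then obtain x' y' where xy: "(x' = x \<and> y' = y) \<or> (x' = y \<and> y' = x)"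
    and or: "(\<exists>\<alpha>1 \<alpha>2. \<alpha> = \<alpha>1 @ x' # y' # \<alpha>2) \<or> (\<exists>\<alpha>1 \<alpha>2. v # \<sigma> = \<alpha>1 @ x' # y' # \<alpha>2)" by metis
  from or have "adj_in (u # rev \<alpha> @ v # \<sigma>) x' y'"
  proof (elim disjE exE)
    fix \<alpha>1 \<alpha>2 assume "\<alpha> = \<alpha>1 @ x' # y' # \<alpha>2"
    then have "u # rev \<alpha> @ v # \<sigma> = (u # rev \<alpha>2) @ y' # x' # (rev \<alpha>1 @ v # \<sigma>)" by simp
    then show ?thesis unfolding adj_in_def by blast
  next
    fix \<alpha>1 \<alpha>2 assume "v # \<sigma> = \<alpha>1 @ x' # y' # \<alpha>2"
    then have "u # rev \<alpha> @ v # \<sigma> = (u # rev \<alpha> @ \<alpha>1) @ x' # y' # \<alpha>2" by simp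
    then show ?thesis unfolding adj_in_def by blast
  qed
  then show ?thesis using xy unfolding adj_in_def by blast
qed

lemma adj_in_cases:
  assumes "distinct (\<alpha> @ u # v # \<sigma>)" "adj_in (\<alpha> @ u # v # \<sigma>) w v"
  shows "w = u \<or> (\<exists>\<sigma>'. \<sigma> = w # \<sigma>')"
proof -
  have v: "v \<notin> set (\<alpha> @ [u])" "v \<notin> set \<sigma>" using assms(1) by auto
  from assms(2) consider \<gamma> \<beta> where "\<alpha> @ u # v # \<sigma> = \<gamma> @ w # v # \<beta>" | \<gamma> \<beta> where "\<alpha> @ u # v # \<sigma> = \<gamma> @ v # w # \<beta>"
    unfolding adj_in_def by blast
  then show ?thesis
  proof cases
    case 1
    then have "(\<alpha> @ [u]) @ v # \<sigma> = (\<gamma> @ [w]) @ v # \<beta>" by simp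
    then have "\<alpha> @ [u] = \<gamma> @ [w]" using append_Cons_eq_iff[OF v] by blast
    then show ?thesis by simp
  next
    case 2
    then have "(\<alpha> @ [u]) @ v # \<sigma> = \<gamma> @ v # w # \<beta>" by simp
    then have "\<sigma> = w # \<beta>" using append_Cons_eq_iff[OF v] by blast
    then show ?thesis by simp
  qed
qed

lemma card_adj_in:
  assumes "distinct P" "finite S"
  shows "finite {w. \<exists>e\<in>S. adj_in P e w}" "card {w. \<exists>e\<in>S. adj_in P e w} \<le> 2 * card S"
proof -
  have sub: "{w. \<exists>e\<in>S. adj_in P e w} \<subseteq> next_in P ` S \<union> next_in (rev P) ` S"
  proof
    fix w assume "w \<in> {w. \<exists>e\<in>S. adj_in P e w}"
    then obtain e \<alpha> \<beta> where "e \<in> S" and "P = \<alpha> @ e # w # \<beta> \<or> P = \<alpha> @ w # e # \<beta>"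
      unfolding adj_in_def by blast
    then show "w \<in> next_in P ` S \<union> next_in (rev P) ` S"
    proof (elim disjE)
      assume "P = \<alpha> @ e # w # \<beta>"
      then have "next_in P e = w" using next_in assms(1) by metis
      then show ?thesis using \<open>e \<in> S\<close> by blast
    next
      assume "P = \<alpha> @ w # e # \<beta>"
      then have "rev P = rev \<beta> @ e # w # rev \<alpha>" by simp
      then have "next_in (rev P) e = w" using next_in assms(1) by (metis distinct_rev)
      then show ?thesis using \<open>e \<in> S\<close> by blast
    qed
  qed
  then show "finite {w. \<exists>e\<in>S. adj_in P e w}" using assms(2) by (meson finite_UnI finite_imageI finite_subset)
  have "card {w. \<exists>e\<in>S. adj_in P e w} \<le> card (next_in P ` S \<union> next_in (rev P) ` S)"
    using sub assms(2) by (intro card_mono) auto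
  also have "\<dots> \<le> card S + card S"
    using card_Un_le[of "next_in P ` S" "next_in (rev P) ` S"] card_image_le[OF assms(2), of "next_in P"]
      card_image_le[OF assms(2), of "next_in (rev P)"] by linarith
  finally show "card {w. \<exists>e\<in>S. adj_in P e w} \<le> 2 * card S" by simp
qed

context rotation_system
begin

text \<open>\<open>stay\<close> turns \<open>r\<close> into an upper bound on the number of
  rotations, so that the sets of ends increase with \<open>r\<close>. In contrast to
  \<open>linked_step\<close>, any vertex of the path may serve as pivot and bad ends are allowed;
  this is how a path with bad ends gets repaired.\<close>

inductive rotated :: "'a list \<Rightarrow> nat \<Rightarrow> 'a list \<Rightarrow> bool" for P where
  start: "rotated P 0 P"
| stay: "rotated P r Q \<Longrightarrow> rotated P (Suc r) Q"
| turn: "rotated P r (\<alpha> @ u # v # \<sigma>) \<Longrightarrow> E (hd (\<alpha> @ [u])) v \<Longrightarrow> rotated P (Suc r) (u # rev \<alpha> @ v # \<sigma>)"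

lemma rotated_pth:
  "rotated P r Q \<Longrightarrow> pth P \<Longrightarrow> pth Q \<and> set Q = set P \<and> last Q = last P"
proof (induction rule: rotated.induct)
  case (turn r \<alpha> u v \<sigma>)
  then have "pth (u # rev \<alpha> @ v # \<sigma>)" using pth_rotate by blast
  then show ?case using turn by auto
qed auto

text \<open>The cut between \<open>u\<close> and \<open>v\<close> splits one block in two, and
  pieces and reversals of fine blocks are fine.\<close>

lemma rotated_blocks:
  "rotated P r Q \<Longrightarrow> concat Bl = P \<Longrightarrow> \<forall>\<beta>\<in>set Bl. fine \<beta> \<Longrightarrow>
     \<exists>Bl'. concat Bl' = Q \<and> (\<forall>\<beta>\<in>set Bl'. fine \<beta>) \<and> length Bl' \<le> length Bl + r"
proof (induction rule: rotated.induct)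
  case start
  then show ?case by (intro exI[of _ Bl]) auto
next
  case (stay r Q)
  then show ?case using le_SucI by (metis add_Suc_right)
next
  case (turn r \<alpha> u v \<sigma>)
  then obtain Bl' where Bl': "concat Bl' = (\<alpha> @ [u]) @ v # \<sigma>" "\<forall>\<beta>\<in>set Bl'. fine \<beta>"
    "length Bl' \<le> length Bl + r" by auto
  then have "Bl' \<noteq> []" by auto
  then obtain B1 \<beta> \<beta>' B2 where s: "Bl' = B1 @ (\<beta> @ \<beta>') # B2" "\<alpha> @ [u] = concat B1 @ \<beta>" "v # \<sigma> = \<beta>' @ concat B2"
    using Bl'(1) unfolding concat_eq_append_conv by (auto split: if_splits)
  define R where "R = rev (map rev (B1 @ [\<beta>])) @ \<beta>' # B2"
  have "rev (\<alpha> @ [u]) = concat (rev (map rev (B1 @ [\<beta>])))"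
    unfolding s(2) by (simp add: rev_concat rev_map)
  then have "concat R = u # rev \<alpha> @ v # \<sigma>" unfolding R_def s(3) by simp
  moreover have "fine (\<beta> @ \<beta>')" using Bl'(2) s(1) by auto
  from fine_append[OF this] have "fine \<beta>" "fine \<beta>'" .
  then have "\<forall>\<beta>\<in>set R. fine \<beta>" using fine_rev Bl'(2) s(1) unfolding R_def by auto
  moreover have "length R \<le> length Bl + Suc r" using Bl'(3) unfolding R_def s(1) by simp
  ultimately show ?case by blast
qed

definition ends :: "'a list \<Rightarrow> nat \<Rightarrow> 'a set" where
  "ends P r = {hd Q |Q. rotated P r Q}"

lemma ends_mono: "ends P r \<subseteq> ends P (Suc r)"
  unfolding ends_def using rotated.stay by blast

lemma ends_0: "hd P \<in> ends P r"
proof (induction r)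
  case 0
  then show ?case unfolding ends_def using rotated.start by blast
qed (use ends_mono in blast)

lemma ends_subset: "pth P \<Longrightarrow> ends P r \<subseteq> set P"
  unfolding ends_def using rotated_pth by (force simp: pth_def)

lemma adj_in_rotated:
  "rotated P r Q \<Longrightarrow> adj_in P x y \<Longrightarrow> adj_in Q x y \<or> x \<in> ends P r \<or> y \<in> ends P r"
proof (induction rule: rotated.induct)
  case (stay r Q)
  then show ?case using ends_mono by blast
next
  case (turn r \<alpha> u v \<sigma>)
  have "u \<in> ends P (Suc r)" unfolding ends_def using rotated.turn[OF turn.hyps] by (smt (verit) list.sel(1) mem_Collect_eq)
  moreover have "adj_in (\<alpha> @ u # v # \<sigma>) x y \<or> x \<in> ends P (Suc r) \<or> y \<in> ends P (Suc r)"
    using turn ends_mono by blast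
  ultimately show ?case using adj_in_rotate by metis
qed auto

text \<open>Posa's lemma. Let \<open>v\<close> be adjacent to an end of a rotated path. If neither
  \<open>v\<close> nor its two neighbours on \<open>P\<close> ever become ends, these two still
  surround \<open>v\<close> on the rotated path, and rotating at \<open>v\<close> makes one of them
  an end, a contradiction. So \<open>v\<close> lies in the new set of ends \<open>S\<close>, or next
  to it on \<open>P\<close>, or is the last vertex (the first one is in \<open>S\<close>). This
  gives \<open>3 * card S + 1\<close>, at most \<open>4 * card S\<close>.\<close>

lemma card_nbrs_ends:
  assumes "pth P" "set P = X"
  shows "card {v \<in> V. \<exists>s\<in>ends P r. E s v} \<le> 4 * card (ends P (Suc r))"
proof -
  define S where "S = ends P (Suc r)"
  have finS: "finite S" using ends_subset[OF assms(1)] finite_subset unfolding S_def by blast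
  have "{v \<in> V. \<exists>s\<in>ends P r. E s v} \<subseteq> S \<union> {w. \<exists>e\<in>S. adj_in P e w} \<union> {last P}"
  proof (rule subsetI, rule ccontr)
    fix v assume "v \<in> {v \<in> V. \<exists>s\<in>ends P r. E s v}"
      and no: "v \<notin> S \<union> {w. \<exists>e\<in>S. adj_in P e w} \<union> {last P}"
    then obtain Q where Q: "rotated P r Q" "E (hd Q) v" "v \<in> V" unfolding ends_def by blast
    have Q': "pth Q" "set Q = X" using rotated_pth[OF Q(1) assms(1)] assms(2) by auto
    have "v \<in> set Q" using maximal[OF Q' Q(2,3)] Q' by simp
    moreover have "v \<noteq> hd Q" using Q(2) irrefl by auto
    ultimately obtain \<alpha>' \<sigma> where "Q = \<alpha>' @ v # \<sigma>" "\<alpha>' \<noteq> []"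
      by (metis append_Nil list.sel(1) split_list)
    then obtain \<alpha> u where Qe: "Q = \<alpha> @ u # v # \<sigma>" by (metis append.assoc append_Cons append_Nil rev_exhaust)
    have hdQ: "hd (\<alpha> @ [u]) = hd Q" unfolding Qe by (cases \<alpha>) auto
    have "rotated P (Suc r) (u # rev \<alpha> @ v # \<sigma>)"
      using rotated.turn[of P r \<alpha> u v \<sigma>] Q(1,2) hdQ Qe by simp
    then have uS: "u \<in> S" unfolding S_def ends_def by (smt (verit) list.sel(1) mem_Collect_eq)
    have "v \<in> set P" using \<open>v \<in> set Q\<close> Q' assms by simp
    then obtain \<gamma> \<delta> where P: "P = \<gamma> @ v # \<delta>" by (meson split_list)
    have "\<gamma> \<noteq> []" using P no ends_0[of P "Suc r"] unfolding S_def by auto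
    moreover have "\<delta> \<noteq> []" using P no by auto
    ultimately obtain \<gamma>' w1 w2 \<delta>' where gd: "\<gamma> = \<gamma>' @ [w1]" "\<delta> = w2 # \<delta>'" by (meson list.exhaust rev_exhaust)
    have P': "P = \<gamma>' @ w1 # v # w2 # \<delta>'" using P gd by simp
    then have a1: "adj_in P w1 v" unfolding adj_in_def by blast
    have "P = (\<gamma>' @ [w1]) @ v # w2 # \<delta>'" using P' by simp
    then have a2: "adj_in P w2 v" unfolding adj_in_def by blast
    have "w1 \<notin> S" "w2 \<notin> S" "v \<notin> S" using no a1 a2 by blast+
    then have "adj_in Q w1 v" "adj_in Q w2 v" using adj_in_rotated[OF Q(1)] a1 a2 ends_mono unfolding S_def by blast+
    moreover have "distinct (\<alpha> @ u # v # \<sigma>)" using Q' Qe unfolding pth_def by blast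
    ultimately have "w1 = u \<or> (\<exists>\<sigma>'. \<sigma> = w1 # \<sigma>')" "w2 = u \<or> (\<exists>\<sigma>'. \<sigma> = w2 # \<sigma>')"
      using adj_in_cases unfolding Qe by metis+
    moreover have "w1 \<noteq> w2" using P' assms(1) unfolding pth_def by auto
    ultimately show False using \<open>w1 \<notin> S\<close> \<open>w2 \<notin> S\<close> uS by auto
  qed
  then have "card {v \<in> V. \<exists>s\<in>ends P r. E s v} \<le> card (S \<union> {w. \<exists>e\<in>S. adj_in P e w} \<union> {last P})"
    using finS card_adj_in(1)[of P S] assms(1) unfolding pth_def by (intro card_mono) (auto simp del: mem_Collect_eq)
  also have "\<dots> \<le> card S + 2 * card S + 1"
    using card_Un_le[of "S \<union> {w. \<exists>e\<in>S. adj_in P e w}" "{last P}"]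
      card_Un_le[of S "{w. \<exists>e\<in>S. adj_in P e w}"] card_adj_in(2)[of P S] finS assms(1) unfolding pth_def by force
  also have "\<dots> \<le> 4 * card S"
  proof -
    have "S \<noteq> {}" unfolding S_def using ends_0 by blast
    then have "0 < card S" using finS by (simp add: card_gt_0_iff)
    then show ?thesis by simp
  qed
  finally show ?thesis unfolding S_def .
qed

text \<open>The growth argument of \<open>linked_steps\<close>, where \<open>card_nbrs_ends\<close>
  costs a factor 4 in place of the \<open>M\<close> for the choice of a block; hence also 8 in place
  of \<open>2 * M\<close>.\<close>

lemma card_ends:
  assumes "pth P" "set P = X" "4 \<le> (\<epsilon>/4 * \<kappa>)\<^sup>2"
  shows "min (D * ((\<epsilon>/4 * \<kappa>)\<^sup>2 / 4) ^ i) (card V) \<le> 8 * real (card (ends P (Suc i)))"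
proof -
  define K where "K = (\<epsilon>/4 * \<kappa>)\<^sup>2"
  define N where "N = (\<lambda>r. {v \<in> V. \<exists>s\<in>ends P r. E s v})"
  have endsV: "ends P r \<subseteq> V" for r using ends_subset[OF assms(1)] assms(2) XV by blast
  have N4: "real (card (N r)) \<le> 4 * card (ends P (Suc r))" for r
    using card_nbrs_ends[OF assms(1,2), of r] unfolding N_def by linarith
  have deg: "(1/2 + \<epsilon>) * D \<le> dgr E s (N r)" if "s \<in> ends P r" for s r
  proof -
    have "{u \<in> N r. E s u} = {u \<in> V. E s u}" using that unfolding N_def by auto
    then show ?thesis using mindeg[of s] endsV that unfolding dgr_def by auto
  qed
  have NV: "N r \<subseteq> V" for r unfolding N_def by auto
  have ND: "D / 2 \<le> card (N r)" for r
  proof -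
    have "dgr E (hd P) (N r) \<le> card (N r)"
      unfolding dgr_def using finite_subset[OF NV finV] by (intro card_mono) auto
    moreover have "(1/2 + \<epsilon>) * D \<le> dgr E (hd P) (N r)" using deg ends_0 by blast
    moreover have "D / 2 \<le> (1/2 + \<epsilon>) * D" using eps_pos D_pos by (simp add: field_simps)
    ultimately show ?thesis by linarith
  qed
  have NK: "card V / 2 < card (N r) \<or> K * card (ends P r) \<le> card (N r)" for r
  proof (rule disjCI)
    assume "\<not> K * card (ends P r) \<le> card (N r)"
    moreover have "K = (((1/2 + \<epsilon>) - (1/2 + 3*\<epsilon>/4)) * \<kappa>)\<^sup>2" unfolding K_def by simp
    ultimately have "(1/2 + 3*\<epsilon>/4) * card V < card (N r)"
      using expansion[where A = "ends P r" and B = "N r" and \<tau> = "1/2 + \<epsilon>" and \<sigma> = "1/2 + 3*\<epsilon>/4"]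
        deg NV endsV eps_pos by (force simp: not_le)
    moreover have "1/2 * card V \<le> (1/2 + 3*\<epsilon>/4) * card V" using eps_pos by (intro mult_right_mono) auto
    ultimately show "card V / 2 < card (N r)" by simp
  qed
  show ?thesis
    unfolding K_def[symmetric]
  proof (induction i)
    case 0
    then show ?case using ND[of 0] N4[of 0] by simp
  next
    case (Suc i)
    consider "card V / 2 < card (N (Suc i))" | "K * card (ends P (Suc i)) \<le> card (N (Suc i))"
      using NK by blast
    then show ?case
    proof cases
      case 1
      then show ?thesis using N4[of "Suc i"] by linarith
    next
      case 2
      have K4: "1 \<le> K / 4" using assms(3) unfolding K_def by simp
      have "(K/4) * min (D * (K / 4) ^ i) (card V) \<le> (K/4) * (8 * real (card (ends P (Suc i))))"
        using Suc K4 by (intro mult_left_mono) auto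
      moreover have "min (D * (K/4) ^ Suc i) (card V) \<le> (K/4) * min (D * (K / 4) ^ i) (card V)"
      proof (cases "D * (K / 4) ^ i \<le> card V")
        case True
        then show ?thesis by (simp add: mult.left_commute min_def)
      next
        case False
        have "1 * real (card V) \<le> (K/4) * card V" using K4 by (intro mult_right_mono) auto
        then show ?thesis using False by (simp add: min_def)
      qed
      ultimately show ?thesis using 2 N4[of "Suc i"] by simp
    qed
  qed
qed

lemma good_end:
  assumes "pth P" "set P = X" "concat Bl = P" "\<forall>\<beta>\<in>set Bl. fine \<beta>"
    and "4 \<le> (\<epsilon>/4 * \<kappa>)\<^sup>2" "m > 0" "card V \<le> D * ((\<epsilon>/4 * \<kappa>)\<^sup>2 / 4) ^ (m - 1)"
    and "finite Bad" "8 * card Bad < card V"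
  shows "\<exists>Q Bl'. pth Q \<and> set Q = X \<and> last Q = last P \<and> hd Q \<notin> Bad \<and> concat Bl' = Q \<and>
           (\<forall>\<beta>\<in>set Bl'. fine \<beta>) \<and> length Bl' \<le> length Bl + m"
proof -
  have "card V \<le> 8 * real (card (ends P m))"
    using card_ends[OF assms(1,2,5), of "m - 1"] assms(6,7) by (simp add: min_def split: if_splits)
  then have "card Bad < card (ends P m)" using assms(9) by linarith
  then have "\<not> ends P m \<subseteq> Bad" using card_mono[OF assms(8), of "ends P m"] by linarith
  then obtain Q where Q: "rotated P m Q" "hd Q \<notin> Bad" unfolding ends_def by blast
  then show ?thesis using rotated_pth[OF Q(1) assms(1)] rotated_blocks[OF Q(1) assms(3,4)] assms(2) by blast
qed

lemma fine_Nil: "fine []"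
  unfolding fine_def dgr_def using tau D_pos by auto

text \<open>Either end is first moved out of \<open>Bad\<close> by ordinary rotations. For each end
  these create up to \<open>m\<close> new blocks, for which the bound on \<open>length Bl\<close>
  leaves room.\<close>

lemma spanning_cycle:
  assumes P: "pth P" "set P = X" "concat Bl = P" "\<forall>\<beta>\<in>set Bl. fine \<beta>" "length Bl + 2 * m \<le> M"
    and m: "m > 0" and K: "2 * M \<le> (\<epsilon>/4 * \<kappa>)\<^sup>2" "card V \<le> D * ((\<epsilon>/4 * \<kappa>)\<^sup>2 / M) ^ (m - 1)"
    and M4: "M \<ge> 4" and Bad: "finite Bad" "8 * card Bad < card V"
  shows "\<exists>C. cyc C \<and> set C = X"
proof -
  have K4: "4 \<le> (\<epsilon>/4 * \<kappa>)\<^sup>2" using K M4 by linarith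
  have "D * ((\<epsilon>/4 * \<kappa>)\<^sup>2 / M) ^ (m - 1) \<le> D * ((\<epsilon>/4 * \<kappa>)\<^sup>2 / 4) ^ (m - 1)"
    using D_pos M4 by (intro mult_left_mono power_mono divide_left_mono) auto
  then have K': "card V \<le> D * ((\<epsilon>/4 * \<kappa>)\<^sup>2 / 4) ^ (m - 1)" using K by linarith
  obtain Q Bl1 where Q: "pth Q" "set Q = X" "hd Q \<notin> Bad" "concat Bl1 = Q"
    "\<forall>\<beta>\<in>set Bl1. fine \<beta>" "length Bl1 \<le> length Bl + m"
    using good_end[OF P(1-4) K4 m K' Bad] by blast
  have r: "concat (rev (map rev Bl1)) = rev Q" "\<forall>\<beta>\<in>set (rev (map rev Bl1)). fine \<beta>"
    "pth (rev Q)" "set (rev Q) = X"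
    using Q fine_rev pth_rev by (auto simp: rev_concat rev_map)
  obtain R Bl2 where R: "pth R" "set R = X" "last R = hd Q" "hd R \<notin> Bad" "concat Bl2 = R"
    "\<forall>\<beta>\<in>set Bl2. fine \<beta>" "length Bl2 \<le> length Bl1 + m"
    using good_end[OF r(3,4,1,2) K4 m K' Bad] by (auto simp: last_rev)
  \<comment> \<open>Padding by empty blocks: \<open>linked\<close> asks for exactly \<open>M\<close>
    of them.\<close>
  define Bl3 where "Bl3 = Bl2 @ replicate (M - length Bl2) []"
  have "concat Bl3 = R" unfolding Bl3_def using R by simp
  moreover have "length Bl3 = M" unfolding Bl3_def using R Q P by simp
  moreover have "\<forall>\<beta>\<in>set Bl3. fine \<beta>" using R fine_Nil unfolding Bl3_def by auto
  moreover have "3 \<le> card X"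
  proof -
    have "hd R \<in> V" using R(1) XV unfolding pth_def by auto
    then have "(1/2 + \<epsilon>) * D \<le> dgr E (hd R) V" using mindeg by blast
    moreover have "dgr E (hd R) V \<le> card X"
      unfolding dgr_def using maximal R(1,2) finX by (intro card_mono) auto
    moreover have "4 \<le> 1/16 * D"
    proof -
      have "4 \<le> \<epsilon>/8 * D" using M M4 by linarith
      also have "\<dots> \<le> 1/16 * D" using eps_le D_pos by (intro mult_right_mono) auto
      finally show ?thesis .
    qed
    moreover have "1/2 * D \<le> (1/2 + \<epsilon>) * D" using eps_pos D_pos by (intro mult_right_mono) auto
    ultimately show ?thesis by linarith
  qed
  ultimately show ?thesis using spanning_cycle_of_good_ends[of R Bl3] R Q m K by metis
qed

end

section \<open>Hamilton cycles in expanders\<close>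

lemma chunks:
  assumes "L > 0"
  shows "\<exists>Bl. concat Bl = xs \<and> (\<forall>\<beta>\<in>set Bl. length \<beta> \<le> L) \<and> length Bl \<le> length xs div L + 1"
proof (induction xs rule: length_induct)
  case (1 xs)
  show ?case
  proof (cases "length xs \<le> L")
    case True
    then show ?thesis by (intro exI[of _ "[xs]"]) auto
  next
    case False
    then have "length (drop L xs) < length xs" using assms by simp
    then obtain Bl where Bl: "concat Bl = drop L xs" "\<forall>\<beta>\<in>set Bl. length \<beta> \<le> L"
      "length Bl \<le> length (drop L xs) div L + 1"
      using 1 by blast
    have "length (drop L xs) div L + 1 = length xs div L"
      using False assms by (simp add: div_if)
    then show ?thesis using Bl by (intro exI[of _ "take L xs # Bl"]) auto
  qed
qed

context expander
begin

text \<open>A set of vertices sending many edges into a small set is itself tiny, so the closure of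
  \<open>U0\<close> under ``many neighbours in \<open>\<Psi> U\<close>'' stays small.\<close>

lemma small_closed_set:
  fixes f s :: nat and \<tau> :: real
  assumes "U0 \<subseteq> V" and mono: "\<And>A B. A \<subseteq> B \<Longrightarrow> \<Psi> A \<subseteq> \<Psi> B"
    and \<Psi>: "\<And>U. U \<subseteq> V \<Longrightarrow> \<Psi> U \<subseteq> V \<and> card (\<Psi> U) \<le> f + 3 * card U"
    and \<tau>: "\<tau> > 0" and s: "f + 3 * s \<le> \<tau>/2 * card V"
      "card U0 + (f + 3 * s) / (\<tau>/2 * \<kappa>)\<^sup>2 < s"
  shows "\<exists>U. U0 \<subseteq> U \<and> U \<subseteq> V \<and> card U < s \<and> (\<forall>v\<in>V - U. dgr E v (\<Psi> U) < \<tau> * D)"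
proof -
  \<comment> \<open>The family caps the size at \<open>s\<close>, but expansion keeps each of its
    members strictly below the cap. A maximal member can thus be stopped only by being
    closed.\<close>
  define F where "F = {U. U0 \<subseteq> U \<and> U \<subseteq> V \<and> card U \<le> s \<and> (\<forall>v\<in>U - U0. \<tau> * D \<le> dgr E v (\<Psi> U))}"
  have k: "(\<tau>/2 * \<kappa>)\<^sup>2 > 0" using \<tau> kappa_pos by simp
  have "0 \<le> (f + 3 * s) / (\<tau>/2 * \<kappa>)\<^sup>2" by simp
  then have "real (card U0) < s" using s(2) by linarith
  then have "U0 \<in> F" unfolding F_def using assms(1) by simp
  moreover have "finite F" unfolding F_def using finV by (auto intro: finite_subset[of _ "Pow V"])
  ultimately obtain U where U: "U \<in> F" "\<And>W. W \<in> F \<Longrightarrow> U \<subseteq> W \<Longrightarrow> U = W"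
    using finite_has_maximal2[of F U0] by metis
  have UV: "U \<subseteq> V" and U0U: "U0 \<subseteq> U" and Us: "card U \<le> s" using U unfolding F_def by auto
  have "card (\<Psi> U) \<le> f + 3 * s" using \<Psi>[OF UV] Us by linarith
  then have \<Psi>s: "real (card (\<Psi> U)) \<le> f + 3 * s" by (simp flip: of_nat_le_iff)
  have "((\<tau> - \<tau>/2) * \<kappa>)\<^sup>2 * card (U - U0) \<le> card (\<Psi> U)"
    using expansion[where A = "U - U0" and B = "\<Psi> U" and \<tau> = \<tau> and \<sigma> = "\<tau>/2"]
      U(1) UV \<Psi>[OF UV] \<Psi>s s \<tau> unfolding F_def by fastforce
  then have "(\<tau>/2 * \<kappa>)\<^sup>2 * card (U - U0) \<le> f + 3 * s" using \<Psi>s by simp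
  then have "card (U - U0) \<le> (f + 3 * s) / (\<tau>/2 * \<kappa>)\<^sup>2" using k by (simp add: field_simps)
  moreover have "card U \<le> card U0 + card (U - U0)"
    using U0U UV finV by (metis card_Un_le Diff_partition)
  ultimately have less: "card U < s" using s(2) by linarith
  have "dgr E v (\<Psi> U) < \<tau> * D" if v: "v \<in> V - U" for v
  proof (rule ccontr)
    assume neg: "\<not> dgr E v (\<Psi> U) < \<tau> * D"
    have le: "dgr E w (\<Psi> U) \<le> dgr E w (\<Psi> (insert v U))" for w
      unfolding dgr_def using mono[of U "insert v U"] \<Psi>[of "insert v U"] v UV finV
      by (intro card_mono) (auto intro: finite_subset)
    have "insert v U \<in> F"
      unfolding F_def
    proof (intro CollectI conjI ballI)
      show "card (insert v U) \<le> s" using less v finite_subset[OF UV finV] by simp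
      fix w assume "w \<in> insert v U - U0"
      then have "\<tau> * D \<le> dgr E w (\<Psi> U)" using neg U(1) unfolding F_def by auto
      then show "\<tau> * D \<le> dgr E w (\<Psi> (insert v U))" using le[of w] by linarith
    qed (use v UV U0U in auto)
    then show False using U(2) v by blast
  qed
  then show ?thesis using U0U UV less by blast
qed

text \<open>This is connectedness. A set closed under neighbours keeps all its degrees; if it had at
  most half of the vertices, \<open>expansion\<close> from the set into itself would make it larger
  than itself. Both \<open>S\<close> and its complement are closed, and they cannot both exceed one
  half.\<close>

lemma closed_subset_eq:
  assumes "\<epsilon>/2 * \<kappa> > 1" "S \<subseteq> V" "S \<noteq> {}" and closed: "\<And>u v. u \<in> S \<Longrightarrow> v \<in> V \<Longrightarrow> E u v \<Longrightarrow> v \<in> S"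
  shows "S = V"
proof (rule ccontr)
  have half: "card V / 2 < card T"
    if T: "T \<subseteq> V" "T \<noteq> {}" "\<And>u v. u \<in> T \<Longrightarrow> v \<in> V \<Longrightarrow> E u v \<Longrightarrow> v \<in> T" for T
  proof (rule ccontr)
    assume "\<not> ?thesis"
    moreover have "1/2 * real (card V) \<le> (1/2 + \<epsilon>/2) * real (card V)"
      using eps_pos by (intro mult_right_mono) auto
    ultimately have small: "real (card T) \<le> (1/2 + \<epsilon>/2) * real (card V)" by linarith
    have deg: "(1/2 + \<epsilon>) * D \<le> dgr E a T" if "a \<in> T" for a
    proof -
      have "{u \<in> V. E a u} = {u \<in> T. E a u}" using that T by blast
      then show ?thesis using mindeg[of a] T(1) that unfolding dgr_def by auto
    qed
    have "(\<epsilon>/2 * \<kappa>)\<^sup>2 * card T \<le> card T"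
      using expansion[where A = T and B = T and \<tau> = "1/2 + \<epsilon>" and \<sigma> = "1/2 + \<epsilon>/2"]
        deg small T(1) eps_pos by auto
    moreover have "0 < card T" using T finV by (meson card_gt_0_iff finite_subset)
    ultimately have "(\<epsilon>/2 * \<kappa>)\<^sup>2 \<le> 1" by simp
    moreover have "1 < (\<epsilon>/2 * \<kappa>)\<^sup>2" using assms(1) by (simp add: one_less_power)
    ultimately show False by linarith
  qed
  assume "S \<noteq> V"
  then have "V - S \<noteq> {}" using assms(2) by blast
  then have "card V / 2 < card (V - S)" using closed sym by (intro half) auto
  moreover have "card V / 2 < card S" using half assms(2,3) closed by blast
  moreover have "card (V - S) + card S = card V"
    using assms(2) finV by (metis card_Diff_subset card_mono finite_subset le_add_diff_inverse2)
  ultimately show False by linarith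
qed

text \<open>\<tau> is chosen with \<open>2 * m * \<tau> = \<epsilon>/8\<close>. The lower bound on
  \<open>M\<close> provides for at most \<open>4/\<tau> + 1\<close> initial blocks, for the
  \<open>2 * m\<close> cuts made while repairing the ends, and for \<open>M \<ge> 4\<close>. Apart
  from the growth condition in \<open>K\<close>, the remaining conditions ask that \<open>D\<close>,
  \<kappa> and \<open>card V\<close> be large.\<close>

lemma hamilton_cycle:
  fixes m M :: nat and \<tau> :: real
  defines "\<tau> \<equiv> \<epsilon> / (16 * m)"
  assumes m: "m > 0" and V: "V \<noteq> {}" and Mb: "4/\<tau> + 2 * m + 4 \<le> M" "M \<le> \<epsilon>/8 * D"
    and K: "2 * M \<le> (\<epsilon>/4 * \<kappa>)\<^sup>2" "card V \<le> D * ((\<epsilon>/4 * \<kappa>)\<^sup>2 / M) ^ (m - 1)"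
    and k1: "192 * M < \<epsilon> * (\<tau>/2 * \<kappa>)\<^sup>2" and k2: "6 \<le> (\<epsilon>/16 * \<kappa>)\<^sup>2" and k3: "\<epsilon>/2 * \<kappa> > 1"
    and N: "96 \<le> \<epsilon> * card V" "4 \<le> \<tau> * card V"
  shows "\<exists>C. cyc C \<and> set C = V"
proof -
  define n where "n = card V"
  have n0: "n > 0" unfolding n_def using V finV by (simp add: card_gt_0_iff)
  have \<tau>0: "\<tau> > 0" unfolding \<tau>_def using eps_pos m by simp
  obtain v0 where v0: "v0 \<in> V" using V by blast
  have "pth [v0]" unfolding pth_def using v0 by simp
  moreover have len: "length Q \<le> n" if "pth Q" for Q
    using that finV unfolding pth_def n_def by (metis card_mono distinct_card)
  ultimately obtain P where P: "pth P" "\<And>Q. pth Q \<Longrightarrow> length Q \<le> length P"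
    using ex_has_greatest_nat[of pth "[v0]" length "Suc n"] by (metis le_imp_less_Suc)
  define X where "X = set P"
  have XV: "X \<subseteq> V" using P(1) unfolding X_def pth_def by simp
  have maximal: "u \<in> X" if "pth Q" "set Q = X" "E (hd Q) u" "u \<in> V" for Q u
  proof (rule ccontr)
    assume "u \<notin> X"
    then have "pth (u # Q)" using that sym unfolding pth_def by (cases Q) auto
    moreover have "length Q = length P" using that P(1) unfolding X_def pth_def by (metis distinct_card)
    ultimately show False using P(2)[of "u # Q"] by simp
  qed
  \<comment> \<open>Blocks get density at most \<tau>/2, half of the share that a heavy vertex sees
    in one of them, so that expansion makes heavy vertices rare.\<close>
  define L where "L = nat \<lfloor>\<tau>/2 * n\<rfloor>"
  have L: "1 \<le> L" "L \<le> \<tau>/2 * n" "\<tau>/4 * n \<le> L"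
    using N(2) unfolding L_def n_def by linarith+
  obtain Bl where Bl: "concat Bl = P" "\<forall>\<beta>\<in>set Bl. length \<beta> \<le> L" "length Bl \<le> length P div L + 1"
    using chunks[of L P] L by auto
  have "real (length P div L) \<le> real (length P) / L" by (simp add: of_nat_div_le_of_nat)
  also have "\<dots> \<le> n / L" using len[OF P(1)] L by (intro divide_right_mono) auto
  also have "\<dots> \<le> n / (\<tau>/4 * n)"
    using L \<tau>0 n0 by (intro divide_left_mono) auto
  also have "\<dots> = 4/\<tau>" using n0 \<tau>0 by (auto simp: field_simps)
  finally have "real (length Bl) \<le> 4/\<tau> + 1" using Bl(3) by linarith
  then have lenBl: "length Bl + 2 * m \<le> M" using Mb(1) by linarith
  have blockV: "set \<beta> \<subseteq> V" "card (set \<beta>) \<le> L" if "\<beta> \<in> set Bl" for \<beta>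
  proof -
    have "set \<beta> \<subseteq> set P" using that unfolding Bl(1)[symmetric] by auto
    then show "set \<beta> \<subseteq> V" using XV unfolding X_def by blast
    show "card (set \<beta>) \<le> L" using Bl(2) that card_length[of \<beta>] le_trans by blast
  qed
  define heavy where "heavy = (\<lambda>\<beta>. {v \<in> V. \<tau> * D \<le> dgr E v (set \<beta>)})"
  define U0 where "U0 = (\<Union>\<beta>\<in>set Bl. heavy \<beta>)"
  \<comment> \<open>\<open>3 * s\<close> has to stay within density \<open>\<epsilon>/16\<close>,
    half the threshold \<open>\<epsilon>/8\<close> used for the closure. One half of
    \<open>s\<close> is reserved for \<open>U0\<close>, the other for what the closure adds.\<close>
  define s where "s = nat \<lfloor>\<epsilon>/48 * n\<rfloor>"
  have s: "s \<le> \<epsilon>/48 * n" "\<epsilon>/96 * n \<le> s" "1 \<le> s" using N(1) eps_pos unfolding s_def n_def by linarith+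
  have kk: "0 < (\<tau>/2 * \<kappa>)\<^sup>2" using \<tau>0 kappa_pos by simp
  have heavy: "real (card (heavy \<beta>)) \<le> n / (\<tau>/2 * \<kappa>)\<^sup>2" if "\<beta> \<in> set Bl" for \<beta>
  proof -
    have "((\<tau> - \<tau>/2) * \<kappa>)\<^sup>2 * card (heavy \<beta>) \<le> card (set \<beta>)"
      using blockV[OF that] L \<tau>0 unfolding heavy_def n_def
      by (intro expansion[where \<tau> = \<tau> and \<sigma> = "\<tau>/2"]) auto
    also have "\<dots> \<le> n" unfolding n_def using blockV(1)[OF that] finV by (simp add: card_mono)
    finally show ?thesis using kk by (simp add: field_simps)
  qed
  have "card U0 \<le> (\<Sum>\<beta>\<in>set Bl. card (heavy \<beta>))" unfolding U0_def by (rule card_UN_le) simp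
  then have "real (card U0) \<le> (\<Sum>\<beta>\<in>set Bl. real (card (heavy \<beta>)))" by (simp flip: of_nat_sum)
  also have "\<dots> \<le> real (card (set Bl)) * (n / (\<tau>/2 * \<kappa>)\<^sup>2)" using heavy by (intro sum_bounded_above) auto
  also have "\<dots> \<le> M * (n / (\<tau>/2 * \<kappa>)\<^sup>2)"
    using lenBl card_length[of Bl] by (intro mult_right_mono) auto
  also have "\<dots> < \<epsilon>/192 * n"
  proof -
    show ?thesis using n0 k1 kk by (simp add: field_simps)
  qed
  also have "\<dots> \<le> s / 2" using s by linarith
  finally have U0s: "card U0 < s / 2" .
  \<comment> \<open>A vertex with many neighbours that are adjacent on the path to bad vertices must
    be bad too, which makes the choice of \<open>Bad\<close> circular;
    \<open>small_closed_set\<close> resolves this.\<close>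
  define \<Psi> where "\<Psi> = (\<lambda>U. {w. \<exists>e\<in>U. adj_in P e w})"
  have dP: "distinct P" using P(1) unfolding pth_def by simp
  have "\<Psi> U \<subseteq> V" for U
  proof
    fix w assume "w \<in> \<Psi> U"
    then have "w \<in> set P" unfolding \<Psi>_def adj_in_def by auto
    then show "w \<in> V" using XV unfolding X_def by blast
  qed
  moreover have "card (\<Psi> U) \<le> 0 + 3 * card U" if "U \<subseteq> V" for U
    using card_adj_in(2)[OF dP finite_subset[OF that finV]] unfolding \<Psi>_def by linarith
  ultimately have \<Psi>: "\<Psi> U \<subseteq> V \<and> card (\<Psi> U) \<le> 0 + 3 * card U" if "U \<subseteq> V" for U using that by blast
  have "\<exists>U. U0 \<subseteq> U \<and> U \<subseteq> V \<and> card U < s \<and> (\<forall>v\<in>V - U. dgr E v (\<Psi> U) < \<epsilon>/8 * D)"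
  proof (rule small_closed_set[where f = 0])
    show "U0 \<subseteq> V" unfolding U0_def heavy_def by auto
    show "\<Psi> A \<subseteq> \<Psi> B" if "A \<subseteq> B" for A B using that unfolding \<Psi>_def by blast
    show "\<Psi> U \<subseteq> V \<and> card (\<Psi> U) \<le> 0 + 3 * card U" if "U \<subseteq> V" for U using \<Psi>[OF that] .
    show "real (0 + 3 * s) \<le> \<epsilon>/8/2 * card V" using s unfolding n_def by simp
    have "(0 + 3 * s) / (\<epsilon>/8/2 * \<kappa>)\<^sup>2 \<le> (3 * s) / 6"
      using k2 eps_pos kappa_pos by (simp only: add_0 of_nat_mult) (intro divide_left_mono; simp)
    then show "card U0 + real (0 + 3 * s) / (\<epsilon>/8/2 * \<kappa>)\<^sup>2 < s" using U0s by simp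
  qed (use eps_pos in auto)
  then obtain Bad where Bad: "U0 \<subseteq> Bad" "Bad \<subseteq> V" "card Bad < s" "\<forall>v\<in>V - Bad. dgr E v (\<Psi> Bad) < \<epsilon>/8 * D"
    by blast
  interpret rotation_system V E D \<kappa> \<epsilon> X Bad "\<Psi> Bad" \<tau> M m
  proof unfold_locales
    show "2 * m * \<tau> \<le> \<epsilon> / 8" unfolding \<tau>_def using m by simp
    have "0 < 4/\<tau>" using \<tau>0 by simp
    then show "2 * m < M" using Mb(1) by linarith
  qed (use maximal \<Psi>[OF Bad(2)] Bad \<tau>0 Mb XV in \<open>auto intro: less_imp_le\<close>)
  have "fine \<beta>" if b: "\<beta> \<in> set Bl" for \<beta>
    unfolding fine_def
  proof (intro conjI ballI allI impI)
    fix v assume "v \<in> V - Bad"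
    then have "v \<notin> heavy \<beta>" using Bad(1) b unfolding U0_def by blast
    then show "dgr E v (set \<beta>) \<le> \<tau> * D" using \<open>v \<in> V - Bad\<close> unfolding heavy_def by auto
  next
    fix \<alpha> u v \<gamma> assume "\<beta> = \<alpha> @ u # v # \<gamma>"
    moreover obtain B1 B2 where "Bl = B1 @ \<beta> # B2" using b by (meson split_list)
    ultimately have "P = (concat B1 @ \<alpha>) @ u # v # (\<gamma> @ concat B2)" using Bl(1) by auto
    then have "adj_in P u v" "adj_in P v u" unfolding adj_in_def by blast+
    then show "u \<in> Bad \<Longrightarrow> v \<in> \<Psi> Bad" "v \<in> Bad \<Longrightarrow> u \<in> \<Psi> Bad" unfolding \<Psi>_def by blast+
  qed
  then have fineBl: "\<forall>\<beta>\<in>set Bl. fine \<beta>" by blast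
  have "0 < 4/\<tau>" using \<tau>0 by simp
  then have M4: "4 \<le> M" using Mb(1) by linarith
  have "8 * real (card Bad) < n"
  proof -
    have "(\<epsilon> / 6) * n \<le> 1 * real n" using eps_le by (intro mult_right_mono) auto
    then show ?thesis using Bad(3) s(1) by linarith
  qed
  then have "8 * card Bad < card V" unfolding n_def by linarith
  then obtain C where C: "cyc C" "set C = X"
    using spanning_cycle[OF P(1) _ Bl(1) fineBl lenBl m K M4 _] finite_subset[OF Bad(2) finV] unfolding X_def by blast
  \<comment> \<open>Opening the cycle in front of any \<open>x\<close> gives a path spanning
    \<open>X\<close> that starts at \<open>x\<close>. Maximality then puts all neighbours of
    \<open>x\<close> into \<open>X\<close>.\<close>
  have "X = V"
  proof (rule closed_subset_eq[OF k3 XV])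
    show "X \<noteq> {}" unfolding X_def using P(1) unfolding pth_def by simp
    fix x w assume xw: "x \<in> X" "w \<in> V" "E x w"
    obtain \<alpha> \<beta> where ab: "C = \<alpha> @ x # \<beta>" using xw C by (meson split_list)
    define Q where "Q = (x # \<beta>) @ \<alpha>"
    have sC: "successively E (\<alpha> @ x # \<beta>)" "E (last (\<alpha> @ x # \<beta>)) (hd (\<alpha> @ x # \<beta>))"
      using C(1) unfolding ab cyc_def pth_def by auto
    have "\<alpha> = [] \<or> E (last (x # \<beta>)) (hd \<alpha>)" using sC(2) by (cases \<alpha>) auto
    then have "successively E Q"
      using sC(1) unfolding Q_def successively_append_iff by auto
    then have "pth Q" using C(1) unfolding Q_def ab cyc_def pth_def by auto
    moreover have "set Q = X" using C(2) unfolding Q_def ab by auto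
    moreover have "hd Q = x" unfolding Q_def by simp
    ultimately show "w \<in> X" using maximal xw by blast
  qed
  then show ?thesis using C by blast
qed

end

section \<open>Short cycles in expanders\<close>

context expander
begin

lemma pth_Cons_snoc:
  assumes "pth Q" "u \<in> V - set Q" "w \<in> V - set Q" "u \<noteq> w" "E (hd Q) u" "E (last Q) w"
  shows "pth (u # Q @ [w])"
proof -
  have "successively E (u # Q @ [w])"
    using assms(1,6) sym[OF assms(5)] unfolding pth_def successively_Cons successively_append_iff
    by (cases Q) auto
  then show ?thesis using assms unfolding pth_def by auto
qed

lemma cyc_Cons:
  assumes "pth Q" "2 \<le> length Q" "z \<in> V - set Q" "E (hd Q) z" "E (last Q) z"
  shows "cyc (z # Q)"
  using assms sym[OF assms(4)] unfolding cyc_def pth_def by (cases Q) auto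

text \<open>The connecting path may depend on the pair of ends, but all these paths run inside
  \<open>W\<close>. Vertices outside \<open>W\<close> can therefore prolong any of them, and the
  common length \<open>l\<close> keeps control of the length of the final cycle.\<close>

definition grown :: "'a set \<Rightarrow> 'a set \<Rightarrow> 'a set \<Rightarrow> 'a set \<Rightarrow> 'a set \<Rightarrow> nat \<Rightarrow> bool" where
  "grown F Bad A B W l \<longleftrightarrow> A \<subseteq> V - Bad \<and> B \<subseteq> V - Bad \<and> A \<noteq> {} \<and> B \<noteq> {} \<and> W \<subseteq> V \<and> F \<subseteq> W \<and>
     (\<forall>a\<in>A. \<forall>b\<in>B. \<exists>Q. pth Q \<and> hd Q = a \<and> last Q = b \<and> length Q = l \<and> set Q \<subseteq> W)"

definition free_nbrs :: "'a set \<Rightarrow> 'a set \<Rightarrow> 'a set" where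
  "free_nbrs F A = {v \<in> V - F. \<exists>a\<in>A. E a v}"

lemma card_free_nbrs:
  assumes "A \<noteq> {}" "A \<subseteq> V" and deg: "\<And>a. a \<in> A \<Longrightarrow> dgr E a F < \<epsilon>/4 * D" and "F \<subseteq> V"
  shows "D/2 \<le> card (free_nbrs F A)"
    and "(1/2 + \<epsilon>/4) * real (card V) < real (card (free_nbrs F A)) \<or>
         (\<epsilon>/4 * \<kappa>)\<^sup>2 * real (card A) \<le> real (card (free_nbrs F A))"
proof -
  define R where "R = free_nbrs F A"
  have RV: "R \<subseteq> V" unfolding R_def free_nbrs_def by auto
  have deg: "(1/2 + \<epsilon>/2) * D \<le> dgr E a R" if "a \<in> A" for a
  proof -
    have "{u \<in> V. E a u} \<subseteq> {u \<in> R. E a u} \<union> {u \<in> F. E a u}"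
      using that unfolding R_def free_nbrs_def by auto
    then have "card {u \<in> V. E a u} \<le> card ({u \<in> R. E a u} \<union> {u \<in> F. E a u})"
      using RV assms(4) finV by (intro card_mono) (auto intro: finite_subset)
    also have "\<dots> \<le> card {u \<in> R. E a u} + card {u \<in> F. E a u}" by (rule card_Un_le)
    finally have "dgr E a V \<le> dgr E a R + dgr E a F" unfolding dgr_def .
    moreover have "(1/2 + \<epsilon>) * D \<le> dgr E a V" using mindeg assms(2) that by blast
    moreover have "(1/2 + \<epsilon>/2) * D + \<epsilon>/4 * D \<le> (1/2 + \<epsilon>) * D"
      using eps_pos D_pos by (simp add: field_simps)
    ultimately show ?thesis using deg[OF that] by linarith
  qed
  obtain a where "a \<in> A" using assms by auto
  have "dgr E a R \<le> card R"
    unfolding dgr_def using finite_subset[OF RV finV] by (intro card_mono) auto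
  then have "(1/2 + \<epsilon>/2) * D \<le> card R" using deg[OF \<open>a \<in> A\<close>] by linarith
  moreover have "D/2 \<le> (1/2 + \<epsilon>/2) * D" using eps_pos D_pos by (simp add: field_simps)
  ultimately show "D/2 \<le> card (free_nbrs F A)" unfolding R_def by linarith
  show "(1/2 + \<epsilon>/4) * real (card V) < real (card (free_nbrs F A)) \<or>
         (\<epsilon>/4 * \<kappa>)\<^sup>2 * real (card A) \<le> real (card (free_nbrs F A))"
    unfolding R_def[symmetric]
  proof (rule disjCI)
    assume "\<not> (\<epsilon>/4 * \<kappa>)\<^sup>2 * card A \<le> card R"
    then show "(1/2 + \<epsilon>/4) * card V < card R"
      using expansion[where A = A and B = R and \<tau> = "1/2 + \<epsilon>/2" and \<sigma> = "1/2 + \<epsilon>/4"] deg RV eps_pos assms(2)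
      by (force simp: not_le)
  qed
qed

text \<open>Since \<open>free_nbrs\<close> already avoids \<open>F\<close>, only
  \<open>W - F\<close> has to be removed from it. Among the remaining \<open>2 * c\<close>
  candidates on the side of \<open>B\<close>, at least \<open>c\<close> survive the choice of
  \<open>A'\<close>.\<close>

lemma grown_step:
  assumes g: "grown F Bad A B W l" and c: "0 < c"
    "2 * c + card (W - F) \<le> card (free_nbrs (F \<union> Bad) A)"
    "2 * c + card (W - F) \<le> card (free_nbrs (F \<union> Bad) B)"
  shows "\<exists>A' B' W'. grown F Bad A' B' W' (l + 2) \<and> card A' = c \<and> card B' = c \<and>
           card (W' - F) = card (W - F) + 2 * c"
proof -
  have WV: "W \<subseteq> V" and FW: "F \<subseteq> W" using g unfolding grown_def by auto
  have finW: "finite W" using WV finV finite_subset by blast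
  have sub: "2 * c \<le> card (free_nbrs (F \<union> Bad) S - W)"
    if "2 * c + card (W - F) \<le> card (free_nbrs (F \<union> Bad) S)" for S
  proof -
    have "free_nbrs (F \<union> Bad) S - W = free_nbrs (F \<union> Bad) S - (W - F)"
      unfolding free_nbrs_def by auto
    then have "card (free_nbrs (F \<union> Bad) S) - card (W - F) \<le> card (free_nbrs (F \<union> Bad) S - W)"
      using diff_card_le_card_Diff[of "W - F" "free_nbrs (F \<union> Bad) S"] finW by simp
    then show ?thesis using that by linarith
  qed
  obtain A' where A': "A' \<subseteq> free_nbrs (F \<union> Bad) A - W" "card A' = c"
    using sub[OF c(2)] obtain_subset_with_card_n[of c "free_nbrs (F \<union> Bad) A - W"] by auto
  have finA': "finite A'" using A'(2) c(1) by (metis card.infinite less_irrefl)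
  have "c \<le> card (free_nbrs (F \<union> Bad) B - W - A')"
    using diff_card_le_card_Diff[OF finA', of "free_nbrs (F \<union> Bad) B - W"] sub[OF c(3)] A'(2) by linarith
  then obtain B' where B': "B' \<subseteq> free_nbrs (F \<union> Bad) B - W - A'" "card B' = c"
    by (meson obtain_subset_with_card_n)
  have finB': "finite B'" using B'(2) c(1) by (metis card.infinite less_irrefl)
  define W' where "W' = W \<union> (A' \<union> B')"
  have "grown F Bad A' B' W' (l + 2)"
    unfolding grown_def
  proof (intro conjI ballI)
    show "A' \<subseteq> V - Bad" "B' \<subseteq> V - Bad" using A' B' unfolding free_nbrs_def by auto
    show "A' \<noteq> {}" "B' \<noteq> {}" using A'(2) B'(2) c(1) by auto
    show "W' \<subseteq> V" "F \<subseteq> W'" using A' B' WV FW unfolding W'_def free_nbrs_def by auto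
    fix u w assume "u \<in> A'" "w \<in> B'"
    then obtain a b where ab: "a \<in> A" "E a u" "b \<in> B" "E b w" using A' B' unfolding free_nbrs_def by blast
    then obtain Q where Q: "pth Q" "hd Q = a" "last Q = b" "length Q = l" "set Q \<subseteq> W"
      using g unfolding grown_def by blast
    have "u \<noteq> w" using \<open>u \<in> A'\<close> \<open>w \<in> B'\<close> B' by auto
    moreover have "u \<in> V - set Q" "w \<in> V - set Q" using \<open>u \<in> A'\<close> \<open>w \<in> B'\<close> A' B' Q unfolding free_nbrs_def by auto
    ultimately have "pth (u # Q @ [w])" using pth_Cons_snoc Q ab by auto
    then show "\<exists>Q. pth Q \<and> hd Q = u \<and> last Q = w \<and> length Q = l + 2 \<and> set Q \<subseteq> W'"
      using Q \<open>u \<in> A'\<close> \<open>w \<in> B'\<close> by (intro exI[of _ "u # Q @ [w]"]) (auto simp: W'_def)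
  qed
  moreover have "card (W' - F) = card (W - F) + 2 * c"
  proof -
    have "W' - F = (W - F) \<union> (A' \<union> B')" "A' \<inter> B' = {}" "(W - F) \<inter> (A' \<union> B') = {}"
      using A' B' FW unfolding W'_def by auto
    then show ?thesis using finW finA' finB' A' B' by (simp add: card_Un_disjoint)
  qed
  ultimately show ?thesis using A' B' by blast
qed

text \<open>The fronts have prescribed sizes \<open>c i\<close> instead of comprising all
  neighbours, so that the vertices spent so far are few compared with the next neighbourhoods. The
  count of vertices is \<open>\<sigma> + 1\<close> at the start, two more in each of
  \<open>m - 1\<close> rounds, and a common neighbour of the last fronts: in all
  \<open>\<sigma> + 2 * m\<close>.\<close>

lemma short_cycle:
  fixes c :: "nat \<Rightarrow> nat" and q :: real
  assumes g0: "grown F Bad {x} {y} F (Suc \<sigma>)" and FV: "F \<subseteq> V" and BadV: "Bad \<subseteq> V"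
    and deg: "\<And>v. v \<in> V - Bad \<Longrightarrow> dgr E v (F \<union> Bad) < \<epsilon>/4 * D"
    and m: "2 \<le> m" and c1: "1 \<le> c 0" "4 * c 0 \<le> D"
    and cS: "\<And>i. i < m - 2 \<Longrightarrow> c i \<le> c (Suc i) \<and> c (Suc i) \<le> q * c i"
    and top: "card V \<le> (\<epsilon>/4 * \<kappa>)\<^sup>2 * c (m - 2)" "8 * (m + 1) * c (m - 2) \<le> \<epsilon> * card V"
    and q: "2 * real m + 2 * q \<le> (\<epsilon>/4 * \<kappa>)\<^sup>2"
  shows "\<exists>C. cyc C \<and> length C = \<sigma> + 2 * m"
proof -
  define K where "K = (\<epsilon>/4 * \<kappa>)\<^sup>2"
  define n where "n = card V"
  have card: "D/2 \<le> card (free_nbrs (F \<union> Bad) A)"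
    "(1/2 + \<epsilon>/4) * n < card (free_nbrs (F \<union> Bad) A) \<or> K * card A \<le> card (free_nbrs (F \<union> Bad) A)"
    if "A \<subseteq> V - Bad" "A \<noteq> {}" for A
    using card_free_nbrs[of A "F \<union> Bad"] that deg FV BadV unfolding K_def n_def by blast+
  have ctop: "c i \<le> c (m - 2)" "1 \<le> c i" if "i \<le> m - 2" for i
  proof -
    show "c i \<le> c (m - 2)" using that
    proof (induction rule: inc_induct)
      case (step i)
      then show ?case using cS[of i] by linarith
    qed simp
    show "1 \<le> c i" using that
    proof (induction i)
      case (Suc i)
      then show ?case using cS[of i] by simp
    qed (use c1 in simp)
  qed
  have top': "8 * (m + 1) * real (c (m - 2)) \<le> \<epsilon> * n" using top(2) unfolding n_def by simp
  have n_eps: "\<epsilon> * n \<le> n / 2" using mult_right_mono[OF eps_le, of "real n"] by simp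
  have big: "\<exists>A B W. grown F Bad A B W (Suc \<sigma> + 2 * Suc i) \<and> card A = c i \<and> card B = c i \<and>
               card (W - F) \<le> 2 * Suc i * c i" if "i \<le> m - 2" for i
    using that
  proof (induction i)
    case 0
    have x: "{x} \<subseteq> V - Bad" "{y} \<subseteq> V - Bad" using g0 unfolding grown_def by auto
    have "D/2 \<le> card (free_nbrs (F \<union> Bad) {x})" "D/2 \<le> card (free_nbrs (F \<union> Bad) {y})"
      using card(1)[OF x(1)] card(1)[OF x(2)] by auto
    then have "2 * c 0 \<le> card (free_nbrs (F \<union> Bad) {x})" "2 * c 0 \<le> card (free_nbrs (F \<union> Bad) {y})"
      using c1(2) by linarith+
    then show ?case using grown_step[OF g0, of "c 0"] c1(1) by fastforce
  next
    case (Suc i)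
    then obtain A B W where g: "grown F Bad A B W (Suc \<sigma> + 2 * Suc i)" "card A = c i" "card B = c i"
      and w: "card (W - F) \<le> 2 * Suc i * c i" by auto
    have im: "i < m - 2" using Suc by simp
    have w': "card (W - F) \<le> 2 * m * c i" using w im by (meson mult_le_mono1 mult_le_mono2 le_trans Suc_leI less_imp_le_nat diff_le_self)
    have c': "c (Suc i) \<le> c (m - 2)" "c i \<le> c (m - 2)" "1 \<le> c (Suc i)" using ctop Suc by auto
    have "2 * c (Suc i) + card (W - F) \<le> card (free_nbrs (F \<union> Bad) S)"
      if S: "S \<subseteq> V - Bad" "S \<noteq> {}" "card S = c i" for S
      using card(2)[OF S(1,2)]
    proof
      assume h: "(1/2 + \<epsilon>/4) * n < card (free_nbrs (F \<union> Bad) S)"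
      have "real (2 * c (Suc i) + card (W - F)) \<le> real (2 * c (m - 2) + 2 * m * c (m - 2))"
        using c' w' by (intro of_nat_mono add_mono) (auto intro: order_trans[OF w'] simp: mult_le_mono)
      also have "\<dots> = 2 * (m + 1) * real (c (m - 2))" by (simp add: algebra_simps)
      also have "\<dots> \<le> 8 * (m + 1) * real (c (m - 2))" by (intro mult_right_mono) auto
      also have "\<dots> \<le> \<epsilon> * n" by (rule top')
      also have "\<dots> \<le> (1/2) * n" using n_eps by simp
      also have "\<dots> \<le> (1/2 + \<epsilon>/4) * n" using eps_pos by (intro mult_right_mono) auto
      finally show ?thesis using h by linarith
    next
      assume h: "K * card S \<le> card (free_nbrs (F \<union> Bad) S)"
      have "real (2 * c (Suc i) + card (W - F)) \<le> 2 * (q * c i) + real (2 * m * c i)"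
        unfolding of_nat_add using cS[OF im] of_nat_mono[OF w', where 'a = real] by (intro add_mono) auto
      also have "\<dots> = (2 * m + 2 * q) * real (c i)" by (simp add: algebra_simps)
      also have "\<dots> \<le> K * real (c i)" using q unfolding K_def by (intro mult_right_mono) auto
      finally show ?thesis using h unfolding S(3) by linarith
    qed
    then have "2 * c (Suc i) + card (W - F) \<le> card (free_nbrs (F \<union> Bad) A)"
      "2 * c (Suc i) + card (W - F) \<le> card (free_nbrs (F \<union> Bad) B)"
      using g unfolding grown_def by blast+
    then obtain A' B' W' where g': "grown F Bad A' B' W' (Suc \<sigma> + 2 * Suc i + 2)" "card A' = c (Suc i)"
      "card B' = c (Suc i)" "card (W' - F) = card (W - F) + 2 * c (Suc i)"
      using grown_step[OF g(1), of "c (Suc i)"] c' by auto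
    have "card (W' - F) \<le> 2 * Suc i * c (Suc i) + 2 * c (Suc i)"
      using g'(4) w mult_le_mono2[of "c i" "c (Suc i)" "2 * Suc i"] cS[OF im] by linarith
    then have "card (W' - F) \<le> 2 * Suc (Suc i) * c (Suc i)" by simp
    then show ?case using g' by (metis add.assoc mult_Suc_right add.commute)
  qed
  obtain A B W where g: "grown F Bad A B W (Suc \<sigma> + 2 * Suc (m - 2))" "card A = c (m - 2)" "card B = c (m - 2)"
    and w: "card (W - F) \<le> 2 * Suc (m - 2) * c (m - 2)" using big[of "m - 2"] by auto
  have w': "card (W - F) \<le> 2 * m * c (m - 2)" using w m
    by (meson le_trans mult_le_mono1 mult_le_mono2 Suc_diff_le diff_le_self Suc_leI diff_less less_le_trans zero_less_numeral)
  have half: "n < 2 * card (free_nbrs (F \<union> Bad) S - W)"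
    if S: "S \<subseteq> V - Bad" "S \<noteq> {}" "card S = c (m - 2)" for S
  proof -
    have finF: "finite (free_nbrs (F \<union> Bad) S)" unfolding free_nbrs_def using finV by auto
    have WV: "W \<subseteq> V" using g(1) unfolding grown_def by blast
    have eq: "free_nbrs (F \<union> Bad) S - W = free_nbrs (F \<union> Bad) S - (W - F)"
      unfolding free_nbrs_def by auto
    have "card (free_nbrs (F \<union> Bad) S) - card (W - F) \<le> card (free_nbrs (F \<union> Bad) S - W)"
      unfolding eq using diff_card_le_card_Diff finite_subset[OF WV finV] by blast
    then have d: "real (card (free_nbrs (F \<union> Bad) S)) \<le> card (free_nbrs (F \<union> Bad) S - W) + card (W - F)"
      by linarith
    have "(1/2 + \<epsilon>/4) * n \<le> card (free_nbrs (F \<union> Bad) S)"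
      using card(2)[OF S(1,2)]
    proof
      assume "K * card S \<le> card (free_nbrs (F \<union> Bad) S)"
      moreover have "real n \<le> K * c (m - 2)" using top(1) unfolding K_def n_def .
      moreover have "(1/2 + \<epsilon>/4) * n \<le> 1 * real n" using eps_le by (intro mult_right_mono) auto
      ultimately show ?thesis using S(3) by simp
    qed simp
    moreover have "real (card (W - F)) < \<epsilon>/4 * n"
    proof -
      have "real (card (W - F)) \<le> real (2 * m * c (m - 2))" using w' by (rule of_nat_mono)
      moreover have "1 \<le> c (m - 2)" using ctop by simp
      ultimately have "4 * real (card (W - F)) < 8 * (m + 1) * real (c (m - 2))" by (simp add: algebra_simps)
      then show ?thesis using top' by linarith
    qed
    ultimately have "1/2 * n < real (card (free_nbrs (F \<union> Bad) S - W))" using d by (simp add: algebra_simps)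
    then show ?thesis by linarith
  qed
  define S where "S = free_nbrs (F \<union> Bad) A - W"
  define T where "T = free_nbrs (F \<union> Bad) B - W"
  have "n < 2 * card S" "n < 2 * card T" unfolding S_def T_def using g by (intro half; auto simp: grown_def)+
  then have lt: "n < card S + card T" by linarith
  have STV: "S \<subseteq> V" "T \<subseteq> V" unfolding S_def T_def free_nbrs_def by auto
  have "S \<inter> T \<noteq> {}"
  proof
    assume "S \<inter> T = {}"
    then have "card S + card T = card (S \<union> T)" using STV finV by (metis card_Un_disjoint finite_subset)
    also have "\<dots> \<le> n" unfolding n_def using STV finV by (intro card_mono) auto
    finally show False using lt by simp
  qed
  then obtain z a b where z: "z \<in> V - W" "a \<in> A" "E a z" "b \<in> B" "E b z"
    unfolding S_def T_def free_nbrs_def by blast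
  then obtain Q where Q: "pth Q" "hd Q = a" "last Q = b" "length Q = Suc \<sigma> + 2 * Suc (m - 2)" "set Q \<subseteq> W"
    using g(1) unfolding grown_def by blast
  then have "cyc (z # Q)" using z by (intro cyc_Cons) auto
  moreover have "length (z # Q) = \<sigma> + 2 * m" using Q(4) m by simp
  ultimately show ?thesis by blast
qed

text \<open>The bad set depends on the vertices to be avoided and has to be fixed before a segment
  of \<open>R\<close> is chosen, so all of \<open>R\<close> is avoided. There are
  \<open>b + 1\<close> segments of \<open>\<sigma> + 1\<close> vertices that start at a position up
  to \<open>b\<close>; fewer than \<open>2 * s \<le> b\<close> of them have a bad end.\<close>

lemma short_cycles:
  fixes m b t :: nat
  assumes m: "2 \<le> m" and K: "16 * (m + 1) / \<epsilon> \<le> (\<epsilon>/4 * \<kappa>)\<^sup>2" "16 * (m + 1) / \<epsilon> \<le> card V"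
    and D: "8 \<le> D" "8 * card V \<le> D * ((\<epsilon>/4 * \<kappa>)\<^sup>2 * ((\<epsilon>/4 * \<kappa>)\<^sup>2 / 8) ^ (m - 2))"
    and b: "2 \<le> b" "40 * b \<le> \<epsilon> * card V" and k: "20 < (\<epsilon>/8 * \<kappa>)\<^sup>2"
    and R: "pth R" "length R = 2 * b + 1" and t: "2 * m \<le> t" "t \<le> b + 2 * m"
  shows "\<exists>C. cyc C \<and> length C = t"
proof -
  define F where "F = set R"
  define n where "n = card V"
  define s where "s = b div 2"
  have FV: "F \<subseteq> V" and cardF: "card F = 2 * b + 1"
    using R unfolding F_def pth_def by (auto simp: distinct_card)
  have s: "2 * s \<le> b" "b \<le> 4 * s" using b unfolding s_def by linarith+
  have "\<exists>U. {} \<subseteq> U \<and> U \<subseteq> V \<and> card U < s \<and> (\<forall>v\<in>V - U. dgr E v (F \<union> U) < \<epsilon>/4 * D)"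
  proof (rule small_closed_set[where f = "2 * b + 1"])
    show "F \<union> U \<subseteq> V \<and> card (F \<union> U) \<le> 2 * b + 1 + 3 * card U" if "U \<subseteq> V" for U
      using that FV card_Un_le[of F U] cardF by auto
    have s5: "real (2 * b + 1 + 3 * s) \<le> 5 * b" using s b by linarith
    then show "real (2 * b + 1 + 3 * s) \<le> \<epsilon>/4/2 * card V" using b(2) by linarith
    have "real (2 * b + 1 + 3 * s) / (\<epsilon>/4/2 * \<kappa>)\<^sup>2 \<le> 5 * b / (\<epsilon>/8 * \<kappa>)\<^sup>2"
      using s5 by (simp add: divide_right_mono)
    also have "\<dots> < 5 * b / 20" using k b(1) by (intro divide_strict_left_mono) auto
    also have "\<dots> \<le> s" using s by simp
    finally show "real (card ({}::'a set)) + real (2 * b + 1 + 3 * s) / (\<epsilon>/4/2 * \<kappa>)\<^sup>2 < s" by simp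
  qed (use eps_pos in auto)
  then obtain Bad where Bad: "Bad \<subseteq> V" "card Bad < s" "\<forall>v\<in>V - Bad. dgr E v (F \<union> Bad) < \<epsilon>/4 * D" by blast
  define \<sigma> where "\<sigma> = t - 2 * m"
  have \<sigma>: "\<sigma> \<le> b" using t unfolding \<sigma>_def by linarith
  have cardI: "card {i. i \<le> b \<and> R ! (i + j) \<in> Bad} < s" if "j \<le> b" for j
  proof -
    have "inj_on (\<lambda>i. R ! (i + j)) {i. i \<le> b \<and> R ! (i + j) \<in> Bad}"
      using R that unfolding pth_def by (intro inj_onI) (auto simp: nth_eq_iff_index_eq)
    then have "card {i. i \<le> b \<and> R ! (i + j) \<in> Bad} \<le> card Bad"
      by (rule card_inj_on_le) (use Bad finV finite_subset in auto)
    then show ?thesis using Bad(2) by linarith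
  qed
  have "\<exists>i\<le>b. R ! i \<notin> Bad \<and> R ! (i + \<sigma>) \<notin> Bad"
  proof (rule ccontr)
    assume "\<not> ?thesis"
    then have "{..b} \<subseteq> {i. i \<le> b \<and> R ! (i + 0) \<in> Bad} \<union> {i. i \<le> b \<and> R ! (i + \<sigma>) \<in> Bad}" by auto
    then have "card {..b} \<le> card ({i. i \<le> b \<and> R ! (i + 0) \<in> Bad} \<union> {i. i \<le> b \<and> R ! (i + \<sigma>) \<in> Bad})"
      by (intro card_mono) auto
    also have "\<dots> \<le> card {i. i \<le> b \<and> R ! (i + 0) \<in> Bad} + card {i. i \<le> b \<and> R ! (i + \<sigma>) \<in> Bad}"
      by (rule card_Un_le)
    also have "\<dots> < s + s" using cardI[of 0] cardI[OF \<sigma>] by linarith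
    finally show False using s by simp
  qed
  then obtain i where i: "i \<le> b" "R ! i \<notin> Bad" "R ! (i + \<sigma>) \<notin> Bad" by blast
  define Q where "Q = take (Suc \<sigma>) (drop i R)"
  have lenQ: "length Q = Suc \<sigma>" using R(2) i \<sigma> unfolding Q_def by simp
  have Rsplit: "R = take i R @ Q @ drop (Suc \<sigma>) (drop i R)" unfolding Q_def by (metis append_take_drop_id)
  have pQ: "pth Q" using R(1) Rsplit lenQ by (metis list.size(3) nat.distinct(1) pth_appendD append_is_Nil_conv)
  have hQ: "hd Q = R ! i" unfolding Q_def using R(2) i by (simp add: hd_drop_conv_nth)
  have lQ: "last Q = R ! (i + \<sigma>)"
    using lenQ R(2) i \<sigma> unfolding Q_def by (subst last_conv_nth) auto
  have QF: "set Q \<subseteq> F" unfolding F_def using set_take_subset set_drop_subset unfolding Q_def by fast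
  have "hd Q \<in> set Q" "last Q \<in> set Q" using pQ unfolding pth_def by auto
  then have g0: "grown F Bad {hd Q} {last Q} F (Suc \<sigma>)"
    using pQ lenQ QF FV i hQ lQ unfolding grown_def by auto
  define K where "K = (\<epsilon>/4 * \<kappa>)\<^sup>2"
  have eps16: "16 \<le> 16 * (m + 1) / \<epsilon>"
    using eps_pos eps_le by (simp add: field_simps)
  have K8: "1 \<le> K / 8" using K(1) eps16 unfolding K_def by linarith
  have n0: "0 < n" using K(2) eps16 unfolding n_def by (cases "card V") auto
  \<comment> \<open>Ideal front sizes: a geometric progression of ratio \<open>K/8\<close> ending at
    \<open>n/K\<close>, the size from which a further expansion by \<open>K\<close> fills
    \<open>V\<close>. By assumption it starts at \<open>D/8\<close> or below. Rounding up at most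
    doubles the ratio, whence \<open>q = 2 * (K/8)\<close>.\<close>
  define x where "x = (\<lambda>i. n / (K * (K / 8) ^ (m - 2 - i)))"
  define c where "c = (\<lambda>i. nat \<lceil>x i\<rceil>)"
  have x0: "0 < x i" for i unfolding x_def using n0 K8 by simp
  have cx: "x i \<le> c i" "c i \<le> x i + 1" "1 \<le> c i" for i using x0[of i] unfolding c_def by linarith+
  have xS: "x (Suc i) = (K/8) * x i" if "i < m - 2" for i
  proof -
    have "m - 2 - i = Suc (m - 2 - Suc i)" using that by simp
    then show ?thesis unfolding x_def using K8 by (simp add: field_simps)
  qed
  have xtop: "x (m - 2) = n / K" unfolding x_def by simp
  have "\<exists>C. cyc C \<and> length C = \<sigma> + 2 * m"
  proof (rule short_cycle[OF g0 FV Bad(1) _ m, where c = c and q = "2 * (K / 8)"])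
    show "dgr E v (F \<union> Bad) < \<epsilon>/4 * D" if "v \<in> V - Bad" for v using Bad(3) that by blast
    show "1 \<le> c 0" by (rule cx)
    have "x 0 \<le> D / 8"
    proof -
      have "0 < K * (K / 8) ^ (m - 2)" using K8 by simp
      then show ?thesis using D(2) unfolding x_def n_def K_def[symmetric] by (simp add: field_simps)
    qed
    then show "4 * c 0 \<le> D" using cx(2)[of 0] D(1) by simp
    fix i assume i: "i < m - 2"
    have "x i \<le> x (Suc i)" unfolding xS[OF i] using K8 x0[of i] by simp
    then have "c i \<le> c (Suc i)" unfolding c_def by (intro nat_mono ceiling_mono)
    moreover have "c (Suc i) \<le> (K/8) * x i + 1" using cx(2)[of "Suc i"] xS[OF i] by simp
    moreover have "(K/8) * x i \<le> (K/8) * c i" using cx(1)[of i] K8 by (intro mult_left_mono) auto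
    moreover have "1 \<le> (K/8) * c i" using K8 cx(3)[of i] mult_mono[of 1 "K/8" 1 "real (c i)"] by simp
    ultimately show "c i \<le> c (Suc i) \<and> c (Suc i) \<le> 2 * (K/8) * c i" by linarith
  next
    have "K * (n / K) = n" using K8 by simp
    moreover have "K * (n / K) \<le> K * c (m - 2)" using cx(1)[of "m - 2"] K8 unfolding xtop by (intro mult_left_mono) auto
    ultimately show "card V \<le> (\<epsilon>/4 * \<kappa>)\<^sup>2 * c (m - 2)" unfolding K_def n_def by simp
    have "8 * (m + 1) * real (c (m - 2)) \<le> 8 * (m + 1) * (n / K + 1)"
      using cx(2)[of "m - 2"] unfolding xtop by (intro mult_left_mono) auto
    also have "\<dots> = 8 * (m + 1) * n / K + 8 * (m + 1)" by (simp add: algebra_simps add_divide_distrib)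
    also have "8 * (m + 1) * n / K \<le> \<epsilon> * n / 2"
    proof -
      have "16 * (m + 1) \<le> \<epsilon> * K" using K(1) eps_pos unfolding K_def by (simp add: field_simps)
      then have "16 * (m + 1) * real n \<le> \<epsilon> * K * n" by (intro mult_right_mono) auto
      then show ?thesis using K8 by (simp add: field_simps)
    qed
    also have "real (8 * (m + 1)) \<le> \<epsilon> * n / 2"
      using K(2) eps_pos unfolding n_def by (simp add: field_simps)
    finally show "8 * (m + 1) * c (m - 2) \<le> \<epsilon> * card V" unfolding n_def by simp
    have "\<epsilon> * (16 * (m + 1)) \<le> 1 * real (16 * (m + 1))"
      using eps_le by (simp only: of_nat_mult) (intro mult_right_mono; simp)
    then have "16 * (m + 1) \<le> 16 * (m + 1) / \<epsilon>" using eps_pos by (simp add: field_simps)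
    then have "16 * real (m + 1) \<le> K" using K(1) unfolding K_def by simp
    then show "2 * real m + 2 * (2 * (K/8)) \<le> (\<epsilon>/4 * \<kappa>)\<^sup>2" unfolding K_def[symmetric] by simp
  qed
  then show ?thesis using t unfolding \<sigma>_def by simp
qed

end

section \<open>Cycles of all lengths from edge mixing\<close>

text \<open>At least \<open>\<tau> * D * card A\<close> edges run from \<open>A\<close> to
  \<open>B\<close>, while the main term of \<open>mix\<close> is at most
  \<open>\<sigma> * D * card A\<close>. The error term has to pay for the difference, and squaring
  gives \<open>expansion\<close>. On the subset \<open>W\<close> both \<open>D\<close> and \<kappa>
  are scaled by |W|/n, because the error term does not shrink with \<open>W\<close>.\<close>

lemma expander_of_mixing:
  fixes d n lam \<epsilon> :: real and E :: "'a \<Rightarrow> 'a \<Rightarrow> bool"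
  assumes W: "finite W" "W \<noteq> {}" and sym: "\<And>u v. E u v \<Longrightarrow> E v u" and irrefl: "\<And>v. \<not> E v v"
    and pos: "d > 0" "n > 0" "lam > 0" "\<epsilon> > 0" "\<epsilon> \<le> 1/2"
    and mix: "\<And>A B. A \<subseteq> W \<Longrightarrow> B \<subseteq> W \<Longrightarrow>
      (\<Sum>a\<in>A. real (dgr E a B)) \<le> d * card A * card B / n + lam * sqrt (card A * card B)"
    and deg: "\<And>v. v \<in> W \<Longrightarrow> (1/2 + \<epsilon>) * (d * card W / n) \<le> dgr E v W"
  shows "expander W E (d * card W / n) (d * card W / (n * lam)) \<epsilon>"
proof
  have w: "0 < card W" using W by (simp add: card_gt_0_iff)
  show "0 < d * card W / n" "0 < d * card W / (n * lam)" using w pos by auto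
  show "(1/2 + \<epsilon>) * (d * card W / n) \<le> dgr E v W" if "v \<in> W" for v using deg[OF that] .
  fix A B :: "'a set" and \<tau> \<sigma> :: real
  define D where "D = d * card W / n"
  assume AB: "A \<subseteq> W" "B \<subseteq> W" and dg: "\<And>a. a \<in> A \<Longrightarrow> \<tau> * (d * card W / n) \<le> dgr E a B"
    and B: "real (card B) \<le> \<sigma> * real (card W)" and st: "\<sigma> < \<tau>"
  show "((\<tau> - \<sigma>) * (d * card W / (n * lam)))\<^sup>2 * card A \<le> card B"
  proof (cases "card A = 0")
    case False
    define a b where "a = real (card A)" and "b = real (card B)"
    have a0: "0 < a" unfolding a_def using False by simp
    have "(\<tau> * D) * a \<le> (\<Sum>a\<in>A. real (dgr E a B))"
      using sum_mono[of A "\<lambda>_. \<tau> * D" "\<lambda>a. real (dgr E a B)"] dg unfolding D_def a_def by (simp add: mult.commute)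
    also have "\<dots> \<le> d * a * b / n + lam * sqrt (a * b)" using mix[OF AB] unfolding a_def b_def by simp
    also have "d * a * b / n \<le> d * a * (\<sigma> * card W) / n"
      using B pos a0 unfolding b_def by (intro divide_right_mono mult_left_mono) auto
    also have "d * a * (\<sigma> * card W) / n = (\<sigma> * D) * a" unfolding D_def by simp
    finally have "((\<tau> - \<sigma>) * D) * a \<le> lam * sqrt (a * b)" by (simp add: algebra_simps)
    then have "((\<tau> - \<sigma>) * (D / lam)) * a \<le> sqrt (a * b)" using pos by (simp add: field_simps)
    moreover have "0 \<le> ((\<tau> - \<sigma>) * (D / lam)) * a" using st a0 pos unfolding D_def by simp
    ultimately have "(((\<tau> - \<sigma>) * (D / lam)) * a)\<^sup>2 \<le> (sqrt (a * b))\<^sup>2" by (rule power_mono)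
    also have "\<dots> = a * b" unfolding a_def b_def by simp
    finally have "a * (((\<tau> - \<sigma>) * (D / lam))\<^sup>2 * a) \<le> a * b" by (simp add: power2_eq_square mult_ac)
    then have "((\<tau> - \<sigma>) * (D / lam))\<^sup>2 * a \<le> b" using a0 by simp
    then show ?thesis unfolding a_def b_def D_def by simp
  qed simp
qed (use W sym irrefl pos in auto)

section \<open>Derandomised choice of a vertex subset\<close>

text \<open>The right-hand side is the expectation of the left-hand side when every element of \<open>U\<close> enters
  \<open>W\<close> independently with probability \<open>q\<close>.\<close>

lemma conditional_expectations:
  fixes a b :: "'i \<Rightarrow> real" and q :: real
  assumes "finite U" "0 \<le> q" "q \<le> 1"
  shows "(\<And>i. i \<in> I \<Longrightarrow> N i \<subseteq> U) \<Longrightarrow> \<exists>W\<subseteq>U. (\<Sum>i\<in>I. c i * (\<Prod>u\<in>N i. if u \<in> W then a i else b i))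
    \<le> (\<Sum>i\<in>I. c i * (q * a i + (1 - q) * b i) ^ card (N i))"
  using assms(1)
proof (induction U arbitrary: N c rule: finite_induct)
  case empty
  then show ?case by (intro exI[of _ "{}"]) (auto intro!: sum_mono)
next
  case (insert x U)
  define e where "e = (\<lambda>i. q * a i + (1 - q) * b i)"
  define N' where "N' = (\<lambda>i. N i - {x})"
  \<comment> \<open>Deciding about \<open>x\<close> first multiplies the weight of term
    \<open>i\<close> by \<open>a i\<close> or \<open>b i\<close> if \<open>x\<close> belongs to
    \<open>N i\<close>. The target is the average of the two resulting bounds with weights
    \<open>q\<close> and \<open>1 - q\<close>, so one of the decisions does not exceed it.\<close>
  define c1 where "c1 = (\<lambda>i. c i * (if x \<in> N i then a i else 1))"
  define c0 where "c0 = (\<lambda>i. c i * (if x \<in> N i then b i else 1))"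
  have N'U: "N' i \<subseteq> U" if "i \<in> I" for i using insert.prems[OF that] unfolding N'_def by auto
  have finN: "finite (N i)" if "i \<in> I" for i using insert.prems[OF that] insert.hyps(1) finite_subset by blast
  obtain W1 where W1: "W1 \<subseteq> U" "(\<Sum>i\<in>I. c1 i * (\<Prod>u\<in>N' i. if u \<in> W1 then a i else b i)) \<le> (\<Sum>i\<in>I. c1 i * e i ^ card (N' i))"
    using insert.IH[of N' c1] N'U unfolding e_def by blast
  obtain W0 where W0: "W0 \<subseteq> U" "(\<Sum>i\<in>I. c0 i * (\<Prod>u\<in>N' i. if u \<in> W0 then a i else b i)) \<le> (\<Sum>i\<in>I. c0 i * e i ^ card (N' i))"
    using insert.IH[of N' c0] N'U unfolding e_def by blast
  define S1 S0 S where "S1 = (\<Sum>i\<in>I. c1 i * e i ^ card (N' i))"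
    and "S0 = (\<Sum>i\<in>I. c0 i * e i ^ card (N' i))" and "S = (\<Sum>i\<in>I. c i * e i ^ card (N i))"
  have "q * S1 + (1 - q) * S0 = (\<Sum>i\<in>I. q * (c1 i * e i ^ card (N' i)) + (1 - q) * (c0 i * e i ^ card (N' i)))"
    unfolding S1_def S0_def by (simp add: sum.distrib sum_distrib_left)
  also have "\<dots> = S"
    unfolding S_def
  proof (intro sum.cong refl)
    fix i assume i: "i \<in> I"
    show "q * (c1 i * e i ^ card (N' i)) + (1 - q) * (c0 i * e i ^ card (N' i)) = c i * e i ^ card (N i)"
    proof (cases "x \<in> N i")
      case True
      then have "card (N i) = Suc (card (N' i))" unfolding N'_def using card_Suc_Diff1[OF finN[OF i]] by metis
      moreover have "q * (c i * a i * z) + (1 - q) * (c i * b i * z) = c i * (e i * z)" for z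
        unfolding e_def by (simp add: algebra_simps)
      ultimately show ?thesis using True unfolding c1_def c0_def by simp
    next
      case False
      then show ?thesis unfolding c1_def c0_def N'_def by (simp add: algebra_simps)
    qed
  qed
  finally have S: "q * S1 + (1 - q) * S0 = S" .
  have "S1 \<le> S \<or> S0 \<le> S"
  proof (rule ccontr)
    assume "\<not> ?thesis"
    then have less: "S < S1" "S < S0" by auto
    have "S = q * S + (1 - q) * S" by (simp add: algebra_simps)
    also have "\<dots> < q * S1 + (1 - q) * S0"
    proof (cases "q = 0")
      case False
      then have "q * S < q * S1" using less assms by simp
      moreover have "(1 - q) * S \<le> (1 - q) * S0" using less assms by (intro mult_left_mono) auto
      ultimately show ?thesis by linarith
    qed (use less in simp)
    finally show False using S by simp
  qed
  then show ?case
  proof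
    assume h: "S1 \<le> S"
    have "(\<Sum>i\<in>I. c i * (\<Prod>u\<in>N i. if u \<in> insert x W1 then a i else b i))
        = (\<Sum>i\<in>I. c1 i * (\<Prod>u\<in>N' i. if u \<in> W1 then a i else b i))"
    proof (intro sum.cong refl)
      fix i assume i: "i \<in> I"
      have eq: "(\<Prod>u\<in>N' i. if u \<in> insert x W1 then a i else b i) = (\<Prod>u\<in>N' i. if u \<in> W1 then a i else b i)"
        unfolding N'_def by (intro prod.cong) auto
      show "c i * (\<Prod>u\<in>N i. if u \<in> insert x W1 then a i else b i) = c1 i * (\<Prod>u\<in>N' i. if u \<in> W1 then a i else b i)"
        unfolding eq[symmetric] c1_def N'_def using prod.remove[OF finN[OF i], of x "\<lambda>u. if u \<in> insert x W1 then a i else b i"]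
        using eq[unfolded N'_def] by (cases "x \<in> N i") auto
    qed
    then show ?thesis using W1 h unfolding S1_def S_def e_def by (intro exI[of _ "insert x W1"]) auto
  next
    assume h: "S0 \<le> S"
    have xW: "x \<notin> W0" using W0(1) insert.hyps(2) by blast
    have "(\<Sum>i\<in>I. c i * (\<Prod>u\<in>N i. if u \<in> W0 then a i else b i))
        = (\<Sum>i\<in>I. c0 i * (\<Prod>u\<in>N' i. if u \<in> W0 then a i else b i))"
    proof (intro sum.cong refl)
      fix i assume i: "i \<in> I"
      show "c i * (\<Prod>u\<in>N i. if u \<in> W0 then a i else b i) = c0 i * (\<Prod>u\<in>N' i. if u \<in> W0 then a i else b i)"
        unfolding c0_def N'_def using prod.remove[OF finN[OF i], of x "\<lambda>u. if u \<in> W0 then a i else b i"] xW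
        by (cases "x \<in> N i") auto
    qed
    then show ?thesis using W0 h unfolding S0_def S_def e_def by (intro exI[of _ W0]) auto
  qed
qed

text \<open>Chernoff's bound as a sum of exponential moments: one term for the size exceeding
  \<open>t\<close>, and one per vertex for its degree falling short. For a choice where the sum is
  below 1, every exponent is negative, so none of these events occurs. Filling up to exactly
  \<open>t\<close> vertices does not lower degrees.\<close>

lemma degree_preserving_subset:
  fixes \<eta> r :: real and t :: nat
  assumes V: "finite V" "V \<noteq> {}" and t: "t \<le> card V" and \<eta>: "0 < \<eta>" "\<eta> \<le> 1/2"
    and deg: "\<And>v. v \<in> V \<Longrightarrow> r \<le> dgr E v V"
    and small: "card V * exp (- (\<eta>\<^sup>2 * (t / card V) * r / 2)) + exp (- (\<eta>\<^sup>2 * t / 2)) < 1"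
  shows "\<exists>W\<subseteq>V. card W = t \<and> (\<forall>v\<in>V. (1 - 4 * \<eta>) * (t / card V) * dgr E v V \<le> dgr E v W)"
proof -
  define n where "n = card V"
  have n0: "0 < n" unfolding n_def using V by (simp add: card_gt_0_iff)
  \<comment> \<open>Lower than \<open>t/n\<close> by the factor \<open>1 + 2 * \<eta>\<close>, so
    that upward deviations of the size still end below \<open>t\<close>.\<close>
  define q where "q = t / (n * (1 + 2 * \<eta>))"
  have q: "0 \<le> q" "q \<le> 1"
  proof -
    show "0 \<le> q" unfolding q_def using \<eta> by simp
    have "real t \<le> real n * 1" using t unfolding n_def by simp
    also have "\<dots> \<le> n * (1 + 2 * \<eta>)" using \<eta> by (intro mult_left_mono) auto
    finally show "q \<le> 1" unfolding q_def using n0 \<eta> by (subst divide_le_eq_1_pos) auto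
  qed
  have q_half: "t / n / 2 \<le> q"
  proof -
    have "real n * (1 + 2 * \<eta>) \<le> real n * 2" using \<eta> by (intro mult_left_mono) auto
    then have "t / (n * 2) \<le> q" unfolding q_def using n0 \<eta> by (intro divide_left_mono) auto
    then show ?thesis by simp
  qed
  \<comment> \<open>\<open>None\<close> stands for the size of the subset, \<open>Some v\<close> for
    the degree of \<open>v\<close> into it.\<close>
  define N where "N = (\<lambda>i. case i of None \<Rightarrow> V | Some v \<Rightarrow> {u \<in> V. E v u})"
  define a where "a = (\<lambda>i::'a option. case i of None \<Rightarrow> exp \<eta> | Some v \<Rightarrow> exp (- \<eta>))"
  define c where "c = (\<lambda>i. case i of None \<Rightarrow> exp (- (\<eta> * t)) | Some v \<Rightarrow> exp (\<eta> * ((1 - 2 * \<eta>) * q * dgr E v V)))"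
  define I where "I = insert None (Some ` V)"
  have "\<exists>W\<subseteq>V. (\<Sum>i\<in>I. c i * (\<Prod>u\<in>N i. if u \<in> W then a i else 1))
    \<le> (\<Sum>i\<in>I. c i * (q * a i + (1 - q) * 1) ^ card (N i))"
    using conditional_expectations[OF V(1) q, of I N c a "\<lambda>_. 1"] unfolding N_def by (auto split: option.splits)
  then obtain W where W: "W \<subseteq> V" and le: "(\<Sum>i\<in>I. c i * (\<Prod>u\<in>N i. if u \<in> W then a i else 1))
    \<le> (\<Sum>i\<in>I. c i * (q * a i + (1 - q) * 1) ^ card (N i))" by blast
  have prodW: "(\<Prod>u\<in>N i. if u \<in> W then a i else 1) = a i ^ card (N i \<inter> W)" for i
  proof -
    have "finite (N i)" unfolding N_def using V by (auto split: option.splits)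
    then show ?thesis by (simp add: prod.If_cases)
  qed
  have one_plus: "(1 + x) ^ l \<le> exp (x * l)" if "0 \<le> 1 + x" for x :: real and l :: nat
  proof -
    have "(1 + x) ^ l \<le> exp x ^ l" using that exp_ge_add_one_self[of x] by (intro power_mono) auto
    then show ?thesis by (simp only: exp_of_nat2_mult)
  qed
  have termSome: "c (Some v) * (q * a (Some v) + (1 - q) * 1) ^ card (N (Some v)) \<le> exp (- (\<eta>\<^sup>2 * (t / n) * r / 2))"
    if v: "v \<in> V" for v
  proof -
    define l where "l = dgr E v V"
    have "exp (- \<eta>) \<le> 1 / (1 + \<eta>)"
      using exp_ge_add_one_self[of \<eta>] \<eta> by (simp add: exp_minus field_simps)
    also have "\<dots> \<le> 1 - \<eta> + \<eta>\<^sup>2" using \<eta> by (simp add: field_simps power2_eq_square)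
    finally have e1: "exp (- \<eta>) - 1 \<le> - \<eta> + \<eta>\<^sup>2" by simp
    have "(q * exp (- \<eta>) + (1 - q)) ^ l = (1 + q * (exp (- \<eta>) - 1)) ^ l" by (simp add: algebra_simps)
    also have "\<dots> \<le> exp (q * (exp (- \<eta>) - 1) * l)"
    proof (rule one_plus)
      have "0 \<le> (1 - q) + q * exp (- \<eta>)" using q by (intro add_nonneg_nonneg) auto
      then show "0 \<le> 1 + q * (exp (- \<eta>) - 1)" by (simp add: algebra_simps)
    qed
    also have "\<dots> \<le> exp (q * (- \<eta> + \<eta>\<^sup>2) * l)" using e1 q by (simp add: mult_left_mono mult_right_mono)
    finally have "c (Some v) * (q * a (Some v) + (1 - q) * 1) ^ l
        \<le> exp (\<eta> * ((1 - 2 * \<eta>) * q * l)) * exp (q * (- \<eta> + \<eta>\<^sup>2) * l)"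
      unfolding c_def a_def l_def by simp
    also have "\<dots> = exp (- (\<eta>\<^sup>2 * (q * l)))" by (simp add: exp_add[symmetric] algebra_simps power2_eq_square)
    also have "\<dots> \<le> exp (- (\<eta>\<^sup>2 * (t / n) * r / 2))"
    proof -
      have "(t / n / 2) * r \<le> (t / n / 2) * l" using deg[OF v] unfolding l_def by (intro mult_left_mono) auto
      also have "\<dots> \<le> q * l" using q_half by (intro mult_right_mono) auto
      finally have "\<eta>\<^sup>2 * ((t / n / 2) * r) \<le> \<eta>\<^sup>2 * (q * l)" by (intro mult_left_mono) auto
      then show ?thesis by simp
    qed
    finally show ?thesis unfolding l_def N_def dgr_def by simp
  qed
  have termNone: "c None * (q * a None + (1 - q) * 1) ^ card (N None) \<le> exp (- (\<eta>\<^sup>2 * t / 2))"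
  proof -
    have e1: "exp \<eta> - 1 \<le> \<eta> + \<eta>\<^sup>2" using exp_bound[of \<eta>] \<eta> by simp
    have "(q * exp \<eta> + (1 - q)) ^ n = (1 + q * (exp \<eta> - 1)) ^ n" by (simp add: algebra_simps)
    also have "\<dots> \<le> exp (q * (exp \<eta> - 1) * n)"
      using q \<eta> by (intro one_plus) auto
    also have "\<dots> \<le> exp (q * (\<eta> + \<eta>\<^sup>2) * n)" using e1 q by (simp add: mult_left_mono mult_right_mono)
    finally have "c None * (q * a None + (1 - q) * 1) ^ n \<le> exp (- (\<eta> * t)) * exp (q * (\<eta> + \<eta>\<^sup>2) * n)"
      unfolding c_def a_def by simp
    also have "\<dots> = exp (q * (\<eta> + \<eta>\<^sup>2) * n - \<eta> * t)" by (simp add: exp_add[symmetric])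
    also have "q * (\<eta> + \<eta>\<^sup>2) * n - \<eta> * t = - (\<eta>\<^sup>2 * t / (1 + 2 * \<eta>))"
    proof -
      define z where "z = t / (1 + 2 * \<eta>)"
      have "q * n = z" unfolding q_def z_def using n0 by simp
      then have "q * (\<eta> + \<eta>\<^sup>2) * n = (\<eta> + \<eta>\<^sup>2) * z" by (simp add: mult_ac)
      moreover have "t = (1 + 2 * \<eta>) * z" unfolding z_def using \<eta> by simp
      then have "\<eta> * t = \<eta> * ((1 + 2 * \<eta>) * z)" by simp
      ultimately have "q * (\<eta> + \<eta>\<^sup>2) * n - \<eta> * t = - (\<eta>\<^sup>2 * z)"
        by (simp add: algebra_simps power2_eq_square)
      then show ?thesis unfolding z_def by simp
    qed
    also have "exp (- (\<eta>\<^sup>2 * t / (1 + 2 * \<eta>))) \<le> exp (- (\<eta>\<^sup>2 * t / 2))"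
    proof -
      have "\<eta>\<^sup>2 * t / 2 \<le> \<eta>\<^sup>2 * t / (1 + 2 * \<eta>)" using \<eta> by (intro divide_left_mono) auto
      then show ?thesis by simp
    qed
    finally show ?thesis unfolding N_def n_def by simp
  qed
  have finI: "finite I" unfolding I_def using V by simp
  have pos: "0 \<le> c i * a i ^ card (N i \<inter> W)" for i
    unfolding c_def a_def by (auto split: option.splits)
  have "(\<Sum>i\<in>I. c i * (q * a i + (1 - q) * 1) ^ card (N i))
      = c None * (q * a None + (1 - q) * 1) ^ card (N None) + (\<Sum>v\<in>V. c (Some v) * (q * a (Some v) + (1 - q) * 1) ^ card (N (Some v)))"
    unfolding I_def using V by (subst sum.insert) (auto simp: sum.reindex)
  also have "\<dots> \<le> exp (- (\<eta>\<^sup>2 * t / 2)) + (\<Sum>v\<in>V. exp (- (\<eta>\<^sup>2 * (t / n) * r / 2)))"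
    using termNone termSome by (intro add_mono sum_mono) auto
  also have "\<dots> < 1" using small unfolding n_def by simp
  finally have lt1: "(\<Sum>i\<in>I. c i * a i ^ card (N i \<inter> W)) < 1" using le unfolding prodW by linarith
  have each: "c i * a i ^ card (N i \<inter> W) < 1" if "i \<in> I" for i
    using member_le_sum[OF that, of "\<lambda>i. c i * a i ^ card (N i \<inter> W)"] pos finI lt1 by fastforce
  have "exp (\<eta> * (card W - real t)) < 1"
    using each[of None] W unfolding I_def c_def a_def N_def
    by (simp add: Int_absorb1 exp_of_nat_mult[symmetric] exp_add[symmetric] algebra_simps exp_diff[symmetric] mult_exp_exp)
  then have "\<eta> * (card W - real t) < 0" by simp
  then have Wt: "card W \<le> t" using \<eta> by (simp add: mult_less_0_iff)
  have degW: "(1 - 4 * \<eta>) * (t / n) * dgr E v V \<le> dgr E v W" if v: "v \<in> V" for v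
  proof -
    have "N (Some v) \<inter> W = {u \<in> W. E v u}" using W unfolding N_def by auto
    then have "exp (\<eta> * ((1 - 2 * \<eta>) * q * dgr E v V)) * exp (- \<eta>) ^ dgr E v W < 1"
      using each[of "Some v"] v unfolding I_def c_def a_def dgr_def by simp
    then have "exp (\<eta> * ((1 - 2 * \<eta>) * q * dgr E v V) + - \<eta> * dgr E v W) < 1"
      unfolding exp_add exp_of_nat2_mult .
    then have "\<eta> * ((1 - 2 * \<eta>) * q * dgr E v V - dgr E v W) < 0" by (simp add: algebra_simps)
    then have "(1 - 2 * \<eta>) * q * dgr E v V < dgr E v W" using \<eta> by (simp add: mult_less_0_iff)
    moreover have "(1 - 4 * \<eta>) * (t / n) \<le> (1 - 2 * \<eta>) * q"
    proof -
      have "(1 - 4 * \<eta>) * (1 + 2 * \<eta>) \<le> 1 - 2 * \<eta>" using \<eta> by (simp add: algebra_simps)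
      then have "(1 - 4 * \<eta>) \<le> (1 - 2 * \<eta>) / (1 + 2 * \<eta>)" using \<eta> by (simp add: pos_le_divide_eq)
      then have "(1 - 4 * \<eta>) * (t / n) \<le> (1 - 2 * \<eta>) / (1 + 2 * \<eta>) * (t / n)" by (intro mult_right_mono) auto
      then show ?thesis unfolding q_def by (simp add: mult.commute[of "1 + 2 * \<eta>"])
    qed
    then have "(1 - 4 * \<eta>) * (t / n) * dgr E v V \<le> (1 - 2 * \<eta>) * q * dgr E v V" by (intro mult_right_mono) auto
    ultimately show ?thesis by linarith
  qed
  have finW: "finite W" using W V finite_subset by blast
  have "t - card W \<le> card (V - W)" using t W V by (simp add: card_Diff_subset[OF finW])
  then obtain W2 where W2: "W2 \<subseteq> V - W" "card W2 = t - card W" by (meson obtain_subset_with_card_n)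
  have finW2: "finite W2" using W2 V finite_subset by blast
  have "card (W \<union> W2) = t" using W2 Wt finW finW2 by (subst card_Un_disjoint) auto
  moreover have "dgr E v W \<le> dgr E v (W \<union> W2)" for v
    unfolding dgr_def using finW finW2 by (intro card_mono) auto
  then have "(1 - 4 * \<eta>) * (t / card V) * dgr E v V \<le> dgr E v (W \<union> W2)" if "v \<in> V" for v
    using degW[OF that] unfolding n_def by (meson of_nat_mono order_trans)
  ultimately show ?thesis using W W2(1) by (intro exI[of _ "W \<union> W2"]) blast
qed

text \<open>Lengths \<open>t\<close> from \<open>\<beta> * n\<close> on are handled in subsets of
  exactly \<open>t\<close> vertices, where \<open>D\<close> and \<kappa> shrink by a factor no
  smaller than \<beta>; this is why \<beta> accompanies \<open>d\<close> and \<kappa> in many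
  hypotheses. Sampling halves the margin \<epsilon>. For smaller \<open>t\<close> a path of about
  \<open>2 * \<beta> * n\<close> vertices is needed, and \<open>\<beta> = \<epsilon>/40\<close> is
  what \<open>short_cycles\<close> allows for its \<open>b\<close>.\<close>

lemma cycles_from_parameters:
  fixes V :: "'a set" and m M t :: nat and d lam \<epsilon> :: real and E :: "'a \<Rightarrow> 'a \<Rightarrow> bool"
  defines "n \<equiv> card V" and "\<beta> \<equiv> \<epsilon>/40" and "\<tau> \<equiv> (\<epsilon>/2) / (16 * m)" and "\<kappa> \<equiv> d / lam" and "\<eta> \<equiv> \<epsilon>/8"
  assumes V: "finite V" and sym: "\<And>u v. E u v \<Longrightarrow> E v u" and irrefl: "\<And>v. \<not> E v v"
    and \<epsilon>: "0 < \<epsilon>" "\<epsilon> \<le> 1/2" and m: "2 \<le> m" and lam: "0 < lam"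
    and mix: "\<And>A B. A \<subseteq> V \<Longrightarrow> B \<subseteq> V \<Longrightarrow>
      (\<Sum>a\<in>A. real (dgr E a B)) \<le> d * card A * card B / n + lam * sqrt (card A * card B)"
    and deg: "\<And>v. v \<in> V \<Longrightarrow> (1/2 + \<epsilon>) * d \<le> dgr E v V"
    and M: "4/\<tau> + 2 * m + 4 \<le> M" "M \<le> (\<epsilon>/2)/8 * (\<beta> * d)" "2 * M \<le> ((\<epsilon>/2)/4 * (\<beta> * \<kappa>))\<^sup>2"
      "192 * M < (\<epsilon>/2) * (\<tau>/2 * (\<beta> * \<kappa>))\<^sup>2"
    and k: "6 \<le> ((\<epsilon>/2)/16 * (\<beta> * \<kappa>))\<^sup>2" "1 < (\<epsilon>/2)/2 * (\<beta> * \<kappa>)" "20 < (\<epsilon>/8 * \<kappa>)\<^sup>2"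
      "16 * (m + 1) / \<epsilon> \<le> (\<epsilon>/4 * \<kappa>)\<^sup>2"
    and n: "96 \<le> (\<epsilon>/2) * (\<beta> * n)" "4 \<le> \<tau> * (\<beta> * n)" "16 * (m + 1) / \<epsilon> \<le> n"
    and d: "8 \<le> d" "n \<le> d * (((\<epsilon>/2)/4 * (\<beta> * \<kappa>))\<^sup>2 / M) ^ (m - 1)"
      "8 * n \<le> d * ((\<epsilon>/4 * \<kappa>)\<^sup>2 * ((\<epsilon>/4 * \<kappa>)\<^sup>2 / 8) ^ (m - 2))"
    and small: "n * exp (- (\<eta>\<^sup>2 * \<beta> * (d/2) / 2)) + exp (- (\<eta>\<^sup>2 * (\<beta> * n) / 2)) < 1"
    and t: "2 * m \<le> t" "t \<le> n"
  shows "\<exists>xs. distinct xs \<and> set xs \<subseteq> V \<and> successively E xs \<and> E (last xs) (hd xs) \<and> length xs = t"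
proof -
  have n0: "0 < n"
  proof (rule ccontr)
    assume "\<not> 0 < n"
    then show False using n(1) by simp
  qed
  have V0: "V \<noteq> {}" using n0 unfolding n_def by auto
  have \<beta>: "0 < \<beta>" "\<beta> \<le> 1/80" using \<epsilon> unfolding \<beta>_def by auto
  have \<tau>: "0 < \<tau>" using \<epsilon> m unfolding \<tau>_def by simp
  have \<kappa>: "0 < \<kappa>" using d(1) lam unfolding \<kappa>_def by simp
  have large: "\<exists>xs. distinct xs \<and> set xs \<subseteq> V \<and> successively E xs \<and> E (last xs) (hd xs) \<and> length xs = s"
    if s: "\<beta> * n \<le> s" "s \<le> n" for s :: nat
  proof -
    have ratio: "\<beta> \<le> s / n" using s n0 by (simp add: field_simps)
    have s0: "0 < s" using s(1) \<beta> n0 by (metis mult_pos_pos of_nat_0_less_iff less_le_trans)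
    have M0: "0 < real M" using M(1) \<tau> by (smt (verit) divide_pos_pos of_nat_0_le_iff)
    have "\<exists>W\<subseteq>V. card W = s \<and> (\<forall>v\<in>V. (1 - 4 * \<eta>) * (s / card V) * dgr E v V \<le> dgr E v W)"
    proof (rule degree_preserving_subset[OF V V0, where r = "d/2"])
      show "s \<le> card V" using s unfolding n_def by simp
      show "0 < \<eta>" "\<eta> \<le> 1/2" using \<epsilon> unfolding \<eta>_def by auto
      show "d/2 \<le> dgr E v V" if "v \<in> V" for v
      proof -
        have "1/2 * d \<le> (1/2 + \<epsilon>) * d" using \<epsilon> d(1) by (intro mult_right_mono) auto
        then show ?thesis using deg[OF that] by simp
      qed
      have "\<eta>\<^sup>2 * \<beta> * (d/2) \<le> \<eta>\<^sup>2 * (s / n) * (d/2)"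
        using ratio d(1) by (intro mult_right_mono mult_left_mono) auto
      then have "n * exp (- (\<eta>\<^sup>2 * (s / n) * (d/2) / 2)) \<le> n * exp (- (\<eta>\<^sup>2 * \<beta> * (d/2) / 2))"
        by (intro mult_left_mono) auto
      moreover have "\<eta>\<^sup>2 * (\<beta> * n) \<le> \<eta>\<^sup>2 * s" using s by (intro mult_left_mono) auto
      then have "exp (- (\<eta>\<^sup>2 * s / 2)) \<le> exp (- (\<eta>\<^sup>2 * (\<beta> * n) / 2))" by simp
      ultimately show "card V * exp (- (\<eta>\<^sup>2 * (s / card V) * (d/2) / 2)) + exp (- (\<eta>\<^sup>2 * s / 2)) < 1"
        using small unfolding n_def by linarith
    qed
    then obtain W where W: "W \<subseteq> V" "card W = s" "\<And>v. v \<in> V \<Longrightarrow> (1 - 4 * \<eta>) * (s / n) * dgr E v V \<le> dgr E v W"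
      unfolding n_def by blast
    have W0: "W \<noteq> {}" "finite W" using W s0 V finite_subset by auto
    interpret expander W E "d * card W / n" "d * card W / (n * lam)" "\<epsilon>/2"
    proof (rule expander_of_mixing[OF W0(2,1) sym irrefl])
      show "(1/2 + \<epsilon>/2) * (d * card W / n) \<le> dgr E v W" if "v \<in> W" for v
      proof -
        \<comment> \<open>Sampling loses the proportion \<open>4 * \<eta> = \<epsilon>/2\<close>.
          Expanded, the inequality comes down to \<open>\<epsilon> \<le> 1/2\<close>.\<close>
        have "1/2 + \<epsilon>/2 \<le> (1 - 4 * \<eta>) * (1/2 + \<epsilon>)"
          unfolding \<eta>_def using mult_left_mono[OF \<epsilon>(2), of "\<epsilon>/2"] \<epsilon>(1) by (simp add: field_simps)
        then have "(1/2 + \<epsilon>/2) * (d * s / n) \<le> (1 - 4 * \<eta>) * (1/2 + \<epsilon>) * (d * s / n)"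
          using d(1) by (intro mult_right_mono) auto
        also have "\<dots> = (1 - 4 * \<eta>) * (s / n) * ((1/2 + \<epsilon>) * d)" by simp
        also have "\<dots> \<le> (1 - 4 * \<eta>) * (s / n) * dgr E v V"
          using deg[of v] that W(1) \<epsilon> unfolding \<eta>_def by (intro mult_left_mono) auto
        also have "\<dots> \<le> dgr E v W" using W that by blast
        finally show ?thesis using W(2) by simp
      qed
      show "(\<Sum>a\<in>A. real (dgr E a B)) \<le> d * card A * card B / real n + lam * sqrt (card A * card B)"
        if "A \<subseteq> W" "B \<subseteq> W" for A B using mix[of A B] that W(1) by auto
    qed (use n0 lam d \<epsilon> in auto)
    define \<kappa>' where "\<kappa>' = d * card W / (n * lam)"
    have \<kappa>': "\<beta> * \<kappa> \<le> \<kappa>'"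
    proof -
      have "\<beta> * \<kappa> \<le> s / n * \<kappa>" using ratio \<kappa> by (intro mult_right_mono) auto
      then show ?thesis unfolding \<kappa>'_def \<kappa>_def W(2) by (simp add: mult_ac)
    qed
    have mono: "c * (\<beta> * \<kappa>) \<le> c * \<kappa>'" "(c * (\<beta> * \<kappa>))\<^sup>2 \<le> (c * \<kappa>')\<^sup>2" if "0 \<le> c" for c
    proof -
      show "c * (\<beta> * \<kappa>) \<le> c * \<kappa>'" using \<kappa>' that by (intro mult_left_mono)
      then show "(c * (\<beta> * \<kappa>))\<^sup>2 \<le> (c * \<kappa>')\<^sup>2" using \<beta> \<kappa> that by (intro power_mono) auto
    qed
    have "\<exists>C. cyc C \<and> set C = W"
    proof (rule hamilton_cycle[where m = m and M = M, unfolded \<kappa>'_def[symmetric]])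
      show "0 < m" using m by simp
      show "W \<noteq> {}" by (fact W0)
      show "4 / (\<epsilon>/2 / (16 * m)) + 2 * m + 4 \<le> M" using M(1) unfolding \<tau>_def .
      have "(\<epsilon>/2)/8 * (\<beta> * d) \<le> (\<epsilon>/2)/8 * (s / n * d)"
        using ratio d(1) \<epsilon> by (intro mult_left_mono mult_right_mono) auto
      then show "M \<le> \<epsilon>/2/8 * (d * card W / n)" using M(2) W(2) by (simp add: mult_ac)
      show "2 * M \<le> (\<epsilon>/2/4 * \<kappa>')\<^sup>2" using M(3) mono(2)[of "\<epsilon>/2/4"] \<epsilon> by linarith
      show "card W \<le> d * card W / n * ((\<epsilon>/2/4 * \<kappa>')\<^sup>2 / M) ^ (m - 1)"
      proof -
        have "n \<le> d * ((\<epsilon>/2/4 * \<kappa>')\<^sup>2 / M) ^ (m - 1)"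
        proof -
          have "d * (((\<epsilon>/2)/4 * (\<beta> * \<kappa>))\<^sup>2 / M) ^ (m - 1) \<le> d * ((\<epsilon>/2/4 * \<kappa>')\<^sup>2 / M) ^ (m - 1)"
            using \<epsilon> d(1) by (intro mult_left_mono power_mono[OF divide_right_mono[OF mono(2)]]) auto
          then show ?thesis using d(2) by linarith
        qed
        then have "(s / n) * n \<le> (s / n) * (d * ((\<epsilon>/2/4 * \<kappa>')\<^sup>2 / M) ^ (m - 1))" by (intro mult_left_mono) auto
        then show ?thesis using n0 W(2) by (simp add: mult_ac)
      qed
      have "(\<epsilon>/2) * (\<tau>/2 * (\<beta> * \<kappa>))\<^sup>2 \<le> (\<epsilon>/2) * (\<tau>/2 * \<kappa>')\<^sup>2" using mono(2)[of "\<tau>/2"] \<tau> \<epsilon> by (intro mult_left_mono) auto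
      then show "192 * M < \<epsilon>/2 * ((\<epsilon>/2 / (16 * m)) / 2 * \<kappa>')\<^sup>2" using M(4) unfolding \<tau>_def by linarith
      show "6 \<le> (\<epsilon>/2/16 * \<kappa>')\<^sup>2" using k(1) mono(2)[of "\<epsilon>/2/16"] \<epsilon> by linarith
      show "1 < \<epsilon>/2/2 * \<kappa>'" using k(2) mono(1)[of "\<epsilon>/2/2"] \<epsilon> by linarith
      have "(\<epsilon>/2) * (\<beta> * n) \<le> (\<epsilon>/2) * s" "\<tau> * (\<beta> * n) \<le> \<tau> * s" using s \<epsilon> \<tau> by (intro mult_left_mono; simp)+
      then show "96 \<le> \<epsilon>/2 * card W" "4 \<le> (\<epsilon>/2 / (16 * m)) * card W" using n(1,2) unfolding W(2) \<tau>_def by linarith+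
    qed
    then obtain C where C: "cyc C" "set C = W" by blast
    then have "distinct C" "successively E C" "E (last C) (hd C)" unfolding cyc_def pth_def by auto
    moreover from this have "length C = s" using C(2) W(2) by (metis distinct_card)
    ultimately show ?thesis using C(2) W(1) by blast
  qed
  show ?thesis
  proof (cases "\<beta> * n \<le> t")
    case True
    then show ?thesis using large t by blast
  next
    case False
    have "\<beta> * n \<le> n" using \<beta> by (intro mult_left_le_one_le) auto
    then obtain C where C: "distinct C" "set C \<subseteq> V" "successively E C" "length C = n" using large[of n] by blast
    define b where "b = nat \<lfloor>\<beta> * n\<rfloor>"
    have bn: "192 \<le> \<beta> * n"
    proof -
      have "(\<epsilon>/2) * (\<beta> * n) \<le> (1/2) * (\<beta> * n)" using \<epsilon> \<beta> by (intro mult_right_mono) auto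
      then show ?thesis using n(1) by linarith
    qed
    have b: "2 \<le> b" "b \<le> \<beta> * n" "\<beta> * n < b + 1" using bn unfolding b_def by linarith+
    have "80 * (\<beta> * n) \<le> n" using mult_right_mono[OF \<beta>(2), of "real n"] by simp
    then have bn': "2 * b + 1 \<le> n" using b bn by linarith
    interpret expander V E "d * card V / n" "d * card V / (n * lam)" \<epsilon>
      by (rule expander_of_mixing) (use V V0 sym irrefl n0 lam d \<epsilon> mix deg in \<open>auto simp: n_def\<close>)
    have D: "d * card V / n = d" "d * card V / (n * lam) = \<kappa>" using n0 unfolding \<kappa>_def n_def by auto
    define R where "R = take (2 * b + 1) C"
    have "successively E (take (2 * b + 1) C @ drop (2 * b + 1) C)" using C by simp
    then have "successively E R" unfolding R_def successively_append_iff by blast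
    then have R: "pth R" "length R = 2 * b + 1"
      using C bn' set_take_subset[of "2 * b + 1" C] unfolding R_def pth_def by (auto simp: take_eq_Nil)
    have "\<exists>C. cyc C \<and> length C = t"
    proof (rule short_cycles[where b = b and m = m, OF _ _ _ _ _ _ _ _ R, unfolded D])
      show "40 * b \<le> \<epsilon> * card V" using b(2) unfolding \<beta>_def n_def by simp
      show "t \<le> b + 2 * m" using False b(3) by linarith
    qed (use m k n d b t in \<open>auto simp: n_def\<close>)
    then obtain C' where "cyc C'" "length C' = t" by blast
    then show ?thesis unfolding cyc_def pth_def by blast
  qed
qed

lemma eventually_less_square:
  fixes a c :: real
  assumes "0 < a"
  shows "\<forall>\<^sub>F x in at_top. c < (a * x)\<^sup>2"
  using assms by real_asymp

text \<open>The order of quantifiers is the point: \<open>n0\<close>, \<open>k0\<close> and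
  \<open>C\<close> depend on \<epsilon> and \<open>m\<close> only. The condition
  \<open>card V \<le> (4 * d) ^ m\<close> makes \<open>d\<close> at least of the order of a power of
  \<open>n\<close>, so that the union bound of the sampling step, of the form
  \<open>n * exp (- const * d)\<close>, tends to 0.\<close>

lemma large_cycles_threshold:
  fixes m :: nat and \<epsilon> :: real
  assumes \<epsilon>: "0 < \<epsilon>" "\<epsilon> \<le> 1/2" and m: "2 \<le> m"
  obtains n0 k0 C where "\<And>(V::'a set) E (d::real) (lam::real) t. \<lbrakk>finite V; \<forall>u v. E u v \<longrightarrow> E v u; \<forall>v. \<not> E v v;
    0 < lam; 0 < d; n0 \<le> card V; k0 \<le> d / lam; C * real (card V) \<le> d * (d / lam) ^ (2 * m - 2);
    card V \<le> (4 * d) ^ m;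
    \<forall>A B. A \<subseteq> V \<longrightarrow> B \<subseteq> V \<longrightarrow> (\<Sum>a\<in>A. real (dgr E a B)) \<le> d * card A * card B / card V + lam * sqrt (card A * card B);
    \<forall>v\<in>V. (1/2 + \<epsilon>) * d \<le> dgr E v V; 2 * m \<le> t; t \<le> card V\<rbrakk> \<Longrightarrow>
       \<exists>xs. distinct xs \<and> set xs \<subseteq> V \<and> successively E xs \<and> E (last xs) (hd xs) \<and> length xs = t"
proof -
  define \<beta> \<tau> \<eta> where "\<beta> = \<epsilon>/40" and "\<tau> = (\<epsilon>/2) / (16 * m)" and "\<eta> = \<epsilon>/8"
  have pos: "0 < \<beta>" "0 < \<tau>" "0 < \<eta>" using \<epsilon> m unfolding \<beta>_def \<tau>_def \<eta>_def by auto
  define M where "M = nat \<lceil>4/\<tau>\<rceil> + 2 * m + 4"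
  have M: "4/\<tau> + 2 * m + 4 \<le> M" "0 < M" unfolding M_def by linarith+
  have "\<forall>\<^sub>F x in at_top. 2 * M < ((\<epsilon>/8 * \<beta>) * x)\<^sup>2 \<and> 192 * M / (\<epsilon>/2) < ((\<tau>/2 * \<beta>) * x)\<^sup>2 \<and>
      6 < ((\<epsilon>/32 * \<beta>) * x)\<^sup>2 \<and> 20 < (\<epsilon>/8 * x)\<^sup>2 \<and> 16 * (m + 1) / \<epsilon> < (\<epsilon>/4 * x)\<^sup>2 \<and> 5 / (\<epsilon> * \<beta>) < x"
    using \<epsilon> pos by (intro eventually_conj eventually_less_square eventually_gt_at_top) auto
  then obtain k0 where k0: "\<And>x. k0 \<le> x \<Longrightarrow> 2 * M < ((\<epsilon>/8 * \<beta>) * x)\<^sup>2 \<and> 192 * M / (\<epsilon>/2) < ((\<tau>/2 * \<beta>) * x)\<^sup>2 \<and>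
      6 < ((\<epsilon>/32 * \<beta>) * x)\<^sup>2 \<and> 20 < (\<epsilon>/8 * x)\<^sup>2 \<and> 16 * (m + 1) / \<epsilon> < (\<epsilon>/4 * x)\<^sup>2 \<and> 5 / (\<epsilon> * \<beta>) < x"
    unfolding eventually_at_top_linorder by blast
  \<comment> \<open>Up to rearrangement the two growth conditions read
    \<open>n \<le> c1 * d * \<kappa>^(2 * m - 2)\<close> and
    \<open>8 * n \<le> c2 * d * \<kappa>^(2 * m - 2)\<close>; \<open>C\<close> covers both.\<close>
  define c1 where "c1 = (((\<epsilon>/8 * \<beta>)\<^sup>2) / M) ^ (m - 1)"
  define c2 where "c2 = (\<epsilon>/4)\<^sup>2 * ((\<epsilon>/4)\<^sup>2 / 8) ^ (m - 2)"
  have c: "0 < c1" "0 < c2" unfolding c1_def c2_def using \<epsilon> pos M by auto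
  define C where "C = 1 / c1 + 8 / c2"
  define g where "g = \<eta>\<^sup>2 * \<beta> / 16"
  define p where "p = 1 / real m"
  have g: "0 < g" "0 < p" unfolding g_def p_def using pos m by auto
  define h where "h = (\<lambda>n::real. n * exp (- (g * n powr p)) + exp (- (\<eta>\<^sup>2 * (\<beta> * n) / 2)))"
  define L where "L = Max {8, real M / ((\<epsilon>/2)/8 * \<beta>)}"
  have "((\<lambda>n::real. n * exp (- (g * n powr p))) \<longlongrightarrow> 0) at_top" using g by real_asymp
  moreover have "((\<lambda>n::real. exp (- (\<eta>\<^sup>2 * (\<beta> * n) / 2))) \<longlongrightarrow> 0) at_top" using pos by real_asymp
  ultimately have "(h \<longlongrightarrow> 0 + 0) at_top" unfolding h_def by (rule tendsto_add)
  then have "(h \<longlongrightarrow> 0) at_top" by simp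
  then have h1: "\<forall>\<^sub>F n in at_top. h n < 1" by (rule order_tendstoD) simp
  have "filterlim (\<lambda>n::real. n powr p) at_top at_top" using g by real_asymp
  then have h2: "\<forall>\<^sub>F n in at_top. 4 * L \<le> n powr p" unfolding filterlim_at_top by blast
  have "\<forall>\<^sub>F n in at_top. h n < 1 \<and> 4 * L \<le> n powr p \<and> 96 / ((\<epsilon>/2) * \<beta>) < n \<and> 4 / (\<tau> * \<beta>) < n \<and> 16 * (m + 1) / \<epsilon> < n"
    by (intro eventually_conj h1 h2 eventually_gt_at_top)
  then obtain N where N: "\<And>n. N \<le> n \<Longrightarrow> h n < 1 \<and> 4 * L \<le> n powr p \<and> 96 / ((\<epsilon>/2) * \<beta>) < n \<and> 4 / (\<tau> * \<beta>) < n \<and> 16 * (m + 1) / \<epsilon> < n"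
    unfolding eventually_at_top_linorder by blast
  define n0 where "n0 = nat \<lceil>N\<rceil>"
  show thesis
  proof (rule that[of n0 k0 C])
    fix V :: "'a set" and E and d lam :: real and t
    assume V: "finite V" and sym: "\<forall>u v. E u v \<longrightarrow> E v u" and irrefl: "\<forall>v. \<not> E v v"
      and pos': "0 < lam" "0 < d" and nV: "n0 \<le> card V" and k: "k0 \<le> d / lam"
      and C: "C * real (card V) \<le> d * (d / lam) ^ (2 * m - 2)" and dm: "card V \<le> (4 * d) ^ m"
      and mix: "\<forall>A B. A \<subseteq> V \<longrightarrow> B \<subseteq> V \<longrightarrow> (\<Sum>a\<in>A. real (dgr E a B)) \<le> d * card A * card B / card V + lam * sqrt (card A * card B)"
      and deg: "\<forall>v\<in>V. (1/2 + \<epsilon>) * d \<le> dgr E v V" and t: "2 * m \<le> t" "t \<le> card V"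
    define n where "n = card V"
    define \<kappa> where "\<kappa> = d / lam"
    have "N \<le> n" using nV unfolding n0_def n_def by linarith
    note Nn = N[OF this]
    note kk = k0[OF k[folded \<kappa>_def]]
    have \<kappa>0: "0 < \<kappa>" unfolding \<kappa>_def using pos' by simp
    have "real n powr p \<le> ((4 * d) ^ m) powr p"
      using dm g unfolding n_def by (intro powr_mono2) auto
    also have "((4 * d) ^ m) powr p = ((4 * d) powr m) powr p" using pos' by (simp add: powr_realpow)
    also have "\<dots> = 4 * d" using pos' m unfolding powr_powr p_def by simp
    finally have npd: "real n powr p \<le> 4 * d" .
    then have dL: "L \<le> d" using Nn by linarith
    have "\<kappa> ^ (2 * m - 2) = (\<kappa>\<^sup>2) ^ (m - 1)" by (simp add: power_mult[symmetric] diff_mult_distrib2)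
    then have C': "C * n \<le> d * (\<kappa>\<^sup>2) ^ (m - 1)" using C unfolding n_def \<kappa>_def by simp
    show "\<exists>xs. distinct xs \<and> set xs \<subseteq> V \<and> successively E xs \<and> E (last xs) (hd xs) \<and> length xs = t"
    proof (rule cycles_from_parameters[where V = V and E = E and t = t and M = M and m = m and \<epsilon> = \<epsilon> and d = d and lam = lam,
          folded n_def \<beta>_def \<tau>_def \<kappa>_def \<eta>_def])
      show "E u v \<Longrightarrow> E v u" "\<not> E v v" for u v using sym irrefl by auto
      show "(\<Sum>a\<in>A. real (dgr E a B)) \<le> d * card A * card B / n + lam * sqrt (card A * card B)"
        if "A \<subseteq> V" "B \<subseteq> V" for A B using mix that unfolding n_def by blast
      show "M \<le> (\<epsilon>/2)/8 * (\<beta> * d)"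
      proof -
        have "real M / ((\<epsilon>/2)/8 * \<beta>) \<le> d" using dL unfolding L_def by simp
        then show ?thesis using \<epsilon> pos by (simp add: field_simps)
      qed
      show "2 * M \<le> ((\<epsilon>/2)/4 * (\<beta> * \<kappa>))\<^sup>2" using kk by (simp add: mult.assoc)
      show "192 * M < (\<epsilon>/2) * (\<tau>/2 * (\<beta> * \<kappa>))\<^sup>2"
      proof -
        have "192 * M / (\<epsilon>/2) < (\<tau>/2 * (\<beta> * \<kappa>))\<^sup>2" using kk by (simp add: mult.assoc)
        then show ?thesis using \<epsilon> by (simp only: pos_divide_less_eq half_gt_zero mult.commute)
      qed
      show "6 \<le> ((\<epsilon>/2)/16 * (\<beta> * \<kappa>))\<^sup>2" using kk by (simp add: mult.assoc)
      show "1 < (\<epsilon>/2)/2 * (\<beta> * \<kappa>)"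
      proof -
        have "5 < \<kappa> * (\<epsilon> * \<beta>)" using kk \<epsilon> pos by (simp add: pos_divide_less_eq)
        then show ?thesis by (simp add: mult_ac)
      qed
      show "20 < (\<eta> * \<kappa>)\<^sup>2" using kk unfolding \<eta>_def by simp
      show "16 * (m + 1) / \<epsilon> \<le> (\<epsilon>/4 * \<kappa>)\<^sup>2" using kk by (auto intro: less_imp_le)
      show "96 \<le> (\<epsilon>/2) * (\<beta> * n)"
      proof -
        have "0 < (\<epsilon>/2) * \<beta>" using \<epsilon> pos by simp
        then have "96 < n * ((\<epsilon>/2) * \<beta>)" using Nn by (simp only: pos_divide_less_eq)
        then show ?thesis by (simp add: mult_ac)
      qed
      show "4 \<le> \<tau> * (\<beta> * n)"
      proof -
        have "0 < \<tau> * \<beta>" using pos by simp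
        then have "4 < n * (\<tau> * \<beta>)" using Nn by (simp only: pos_divide_less_eq)
        then show ?thesis by (simp add: mult_ac)
      qed
      show "16 * (m + 1) / \<epsilon> \<le> n" using Nn by simp
      show "8 \<le> d" using dL unfolding L_def by simp
      have C1: "n / c1 \<le> d * (\<kappa>\<^sup>2) ^ (m - 1)" and C2: "8 * n / c2 \<le> d * (\<kappa>\<^sup>2) ^ (m - 1)"
      proof -
        have "C * n = n / c1 + 8 * n / c2" unfolding C_def by (simp add: algebra_simps)
        moreover have "0 \<le> n / c1" "0 \<le> 8 * n / c2" using c by auto
        ultimately show "n / c1 \<le> d * (\<kappa>\<^sup>2) ^ (m - 1)" "8 * n / c2 \<le> d * (\<kappa>\<^sup>2) ^ (m - 1)" using C' by linarith+
      qed
      have "n \<le> d * (\<kappa>\<^sup>2) ^ (m - 1) * c1" using C1 c by (simp only: pos_divide_le_eq)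
      also have "(\<kappa>\<^sup>2) ^ (m - 1) * c1 = (((\<epsilon>/2)/4 * (\<beta> * \<kappa>))\<^sup>2 / M) ^ (m - 1)"
        unfolding c1_def power_mult_distrib[symmetric] by (simp add: power_divide power_mult_distrib mult_ac)
      then have "d * (\<kappa>\<^sup>2) ^ (m - 1) * c1 = d * (((\<epsilon>/2)/4 * (\<beta> * \<kappa>))\<^sup>2 / M) ^ (m - 1)" by (simp only: mult.assoc)
      finally show "n \<le> d * (((\<epsilon>/2)/4 * (\<beta> * \<kappa>))\<^sup>2 / M) ^ (m - 1)" .
      have "8 * n \<le> d * (\<kappa>\<^sup>2) ^ (m - 1) * c2" using C2 c by (simp only: pos_divide_le_eq)
      also have "m - 1 = Suc (m - 2)" using m by simp
      then have "(\<kappa>\<^sup>2) ^ (m - 1) * c2 = ((\<epsilon>/4 * \<kappa>)\<^sup>2 * ((\<epsilon>/4 * \<kappa>)\<^sup>2 / 8) ^ (m - 2))"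
        unfolding c2_def by (simp add: power_mult_distrib power_divide mult_ac)
      then have "d * (\<kappa>\<^sup>2) ^ (m - 1) * c2 = d * ((\<epsilon>/4 * \<kappa>)\<^sup>2 * ((\<epsilon>/4 * \<kappa>)\<^sup>2 / 8) ^ (m - 2))" by (simp only: mult.assoc)
      finally show "8 * real n \<le> d * ((\<epsilon>/4 * \<kappa>)\<^sup>2 * ((\<epsilon>/4 * \<kappa>)\<^sup>2 / 8) ^ (m - 2))" by simp
      have "n * exp (- (\<eta>\<^sup>2 * \<beta> * (d/2) / 2)) \<le> n * exp (- (g * n powr p))"
      proof -
        have "g * n powr p \<le> g * (4 * d)" using npd g by (intro mult_left_mono) auto
        then have "g * n powr p \<le> \<eta>\<^sup>2 * \<beta> * (d/2) / 2" unfolding g_def by (simp add: mult_ac)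
        then show ?thesis by (intro mult_left_mono) auto
      qed
      then show "n * exp (- (\<eta>\<^sup>2 * \<beta> * (d/2) / 2)) + exp (- (\<eta>\<^sup>2 * (\<beta> * n) / 2)) < 1"
        using Nn unfolding h_def by linarith
    qed (use V \<epsilon> m pos' M deg t in \<open>auto simp: n_def\<close>)
  qed
qed

section \<open>Triangles\<close>

text \<open>If \<open>E'\<close> is triangle-free, then every edge of \<open>E\<close> spanned by the \<open>E'\<close>-neighbourhood of an apex
  is missing from \<open>E'\<close>; seen from either end of that edge it joins an \<open>E'\<close>-neighbour to a deleted
  neighbour. Double counting hence makes the latter kind of edge the more frequent one, which mixing
  forbids.\<close>

lemma mixing_triangle:
  fixes d lam \<epsilon> :: real and n :: nat and E E' :: "'a \<Rightarrow> 'a \<Rightarrow> bool"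
  assumes V: "finite V" "V \<noteq> {}" "card V = n"
    and sym: "\<And>u v. E u v \<Longrightarrow> E v u" and sym': "\<And>u v. E' u v \<Longrightarrow> E' v u" and sub: "\<And>u v. E' u v \<Longrightarrow> E u v"
    and pos: "d > 0" "lam \<ge> 0" "\<epsilon> > 0" and big: "lam * n < \<epsilon> * d\<^sup>2"
    and reg: "\<And>v. v \<in> V \<Longrightarrow> dgr E v V = d" and deg: "\<And>v. v \<in> V \<Longrightarrow> (1/2 + \<epsilon>) * d \<le> dgr E' v V"
    and mix: "\<And>A B. A \<subseteq> V \<Longrightarrow> B \<subseteq> V \<Longrightarrow>
      \<bar>(\<Sum>a\<in>A. real (dgr E a B)) - d * card A * card B / n\<bar> \<le> lam * sqrt (card A * card B)"
  shows "\<exists>x\<in>V. \<exists>u\<in>V. \<exists>v\<in>V. E' x u \<and> E' x v \<and> E' u v"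
proof (rule ccontr)
  assume no: "\<not> ?thesis"
  define N where "N = (\<lambda>x. {u \<in> V. E' x u})"
  define H where "H = (\<lambda>x. {u \<in> V. E x u \<and> \<not> E' x u})"
  have n0: "0 < n" using V by (simp add: card_gt_0_iff flip: V(3))
  have count: "(\<Sum>a\<in>A. dgr E a B) = (\<Sum>u\<in>V. \<Sum>v\<in>V. of_bool (u \<in> A \<and> v \<in> B \<and> E u v))"
    if "A \<subseteq> V" "B \<subseteq> V" for A B
  proof -
    have "dgr E u B = (\<Sum>v\<in>V. of_bool (v \<in> B \<and> E u v))" for u
    proof -
      have "{v \<in> B. E u v} = V \<inter> {v. v \<in> B \<and> E u v}" using that by auto
      then show ?thesis unfolding dgr_def using V(1) by (simp add: of_bool_def sum.If_cases)
    qed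
    then have "(\<Sum>a\<in>A. dgr E a B) = (\<Sum>u\<in>V. if u \<in> A then (\<Sum>v\<in>V. of_bool (v \<in> B \<and> E u v)) else 0)"
      using that V(1) by (simp add: sum.If_cases Int_absorb1)
    also have "\<dots> = (\<Sum>u\<in>V. \<Sum>v\<in>V. of_bool (u \<in> A \<and> v \<in> B \<and> E u v))"
      by (intro sum.cong refl) auto
    finally show ?thesis .
  qed
  have NV: "N x \<subseteq> V" "H x \<subseteq> V" for x unfolding N_def H_def by auto
  have "(\<Sum>x\<in>V. \<Sum>u\<in>N x. dgr E u (N x)) = (\<Sum>x\<in>V. \<Sum>u\<in>V. \<Sum>v\<in>V. of_bool (u \<in> N x \<and> v \<in> N x \<and> E u v) :: nat)"
    using count NV by simp
  also have "\<dots> \<le> (\<Sum>x\<in>V. \<Sum>u\<in>V. \<Sum>v\<in>V. of_bool (x \<in> N u \<and> v \<in> H u \<and> E x v))"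
  proof (intro sum_mono)
    fix x u v assume xuv: "x \<in> V" "u \<in> V" "v \<in> V"
    have "x \<in> N u \<and> v \<in> H u \<and> E x v" if "u \<in> N x \<and> v \<in> N x \<and> E u v"
      using that xuv no sub sym' unfolding N_def H_def by blast
    then show "of_bool (u \<in> N x \<and> v \<in> N x \<and> E u v) \<le> (of_bool (x \<in> N u \<and> v \<in> H u \<and> E x v) :: nat)"
      by (simp add: of_bool_def)
  qed
  also have "\<dots> = (\<Sum>u\<in>V. \<Sum>x\<in>V. \<Sum>v\<in>V. of_bool (x \<in> N u \<and> v \<in> H u \<and> E x v))" by (rule sum.swap)
  also have "\<dots> = (\<Sum>u\<in>V. \<Sum>x\<in>N u. dgr E x (H u))" using count NV by simp
  finally have total: "(\<Sum>x\<in>V. \<Sum>u\<in>N x. dgr E u (N x)) \<le> (\<Sum>x\<in>V. \<Sum>u\<in>N x. dgr E u (H x))" .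
  have "\<exists>x\<in>V. (\<Sum>u\<in>N x. dgr E u (N x)) \<le> (\<Sum>u\<in>N x. dgr E u (H x))"
  proof (rule ccontr)
    assume "\<not> ?thesis"
    then have "(\<Sum>u\<in>N x. dgr E u (H x)) < (\<Sum>u\<in>N x. dgr E u (N x))" if "x \<in> V" for x
      using that not_le by blast
    then have "(\<Sum>x\<in>V. \<Sum>u\<in>N x. dgr E u (H x)) < (\<Sum>x\<in>V. \<Sum>u\<in>N x. dgr E u (N x))"
      by (rule sum_strict_mono[OF V(1,2)])
    then show False using total by simp
  qed
  then obtain x where x: "x \<in> V" "(\<Sum>u\<in>N x. dgr E u (N x)) \<le> (\<Sum>u\<in>N x. dgr E u (H x))" by blast
  define a h where "a = real (card (N x))" and "h = real (card (H x))"
  have "card (N x) + card (H x) = dgr E x V"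
  proof -
    have "{u \<in> V. E x u} = N x \<union> H x" "N x \<inter> H x = {}" unfolding N_def H_def using sub by auto
    moreover have "finite (N x)" "finite (H x)" using finite_subset[OF NV(1) V(1)] finite_subset[OF NV(2) V(1)] by auto
    ultimately show ?thesis unfolding dgr_def by (simp add: card_Un_disjoint)
  qed
  then have ah: "a + h = d" using reg[OF x(1)] unfolding a_def h_def by simp
  have a: "(1/2 + \<epsilon>) * d \<le> a" using deg[OF x(1)] unfolding a_def N_def dgr_def .
  have ed: "0 < \<epsilon> * d" using pos by simp
  \<comment> \<open>\<open>N x\<close> outnumbers \<open>H x\<close> by at least 2 \<epsilon> d, so
    the main terms for the two kinds of edges differ by more than two error terms, each at most
    \<open>lam * a\<close>, can bridge.\<close>
  have a_h: "2 * (\<epsilon> * d) \<le> a - h" using a ah by (simp add: algebra_simps)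
  have h0: "0 \<le> h" unfolding h_def by simp
  have a0: "0 < a" using a_h h0 ed by linarith
  have "d * a * a / n - lam * sqrt (a * a) \<le> (\<Sum>u\<in>N x. real (dgr E u (N x)))"
    using mix[OF NV(1) NV(1), of x x] unfolding a_def by simp
  also have "\<dots> \<le> (\<Sum>u\<in>N x. real (dgr E u (H x)))" using x(2) by (simp flip: of_nat_sum)
  also have "\<dots> \<le> d * a * h / n + lam * sqrt (a * h)"
    using mix[OF NV, of x x] unfolding a_def h_def by simp
  also have "lam * sqrt (a * h) \<le> lam * a"
  proof -
    have "a * h \<le> a * a" using a_h ed a0 by (intro mult_left_mono) auto
    then have "sqrt (a * h) \<le> a" using a0 by (simp add: real_le_lsqrt power2_eq_square)
    then show ?thesis using pos by (intro mult_left_mono) auto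
  qed
  finally have "d * a * a / n - lam * a \<le> d * a * h / n + lam * a" using a0 by simp
  then have "d * a * (a - h) / n \<le> 2 * lam * a"
    by (simp add: right_diff_distrib diff_divide_distrib mult_ac)
  then have "a * (d * (a - h)) \<le> a * (2 * (lam * n))" using n0 by (simp add: field_simps)
  then have "d * (a - h) \<le> 2 * (lam * n)" using a0 by simp
  moreover have "d * (2 * (\<epsilon> * d)) \<le> d * (a - h)" using a_h pos by (intro mult_left_mono) auto
  moreover have "d * (2 * (\<epsilon> * d)) = 2 * (\<epsilon> * d\<^sup>2)" by (simp add: power2_eq_square)
  ultimately show False using big by linarith
qed

section \<open>Expander mixing lemma\<close>

definition mat_trace :: "real mat \<Rightarrow> real" where
  "mat_trace A = (\<Sum>i<dim_row A. A $$ (i, i))"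

lemma mat_mult_entry:
  assumes "A \<in> carrier_mat n n" "B \<in> carrier_mat n n" "i < n" "j < n"
  shows "(A * B) $$ (i, j) = (\<Sum>k<n. A $$ (i, k) * B $$ (k, j))"
  using assms by (auto simp: scalar_prod_def atLeast0LessThan intro!: sum.cong)

lemma mat_trace_comm:
  assumes "A \<in> carrier_mat n n" "B \<in> carrier_mat n n"
  shows "mat_trace (A * B) = mat_trace (B * A)"
proof -
  have "mat_trace (A * B) = (\<Sum>i<n. \<Sum>k<n. A $$ (i, k) * B $$ (k, i))"
    unfolding mat_trace_def using assms mat_mult_entry[OF assms] by (intro sum.cong) auto
  also have "\<dots> = (\<Sum>k<n. \<Sum>i<n. B $$ (k, i) * A $$ (i, k))"
    by (subst sum.swap) (simp add: mult.commute)
  also have "\<dots> = mat_trace (B * A)"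
    unfolding mat_trace_def using assms mat_mult_entry[OF assms(2,1)] by (intro sum.cong) auto
  finally show ?thesis .
qed

lemma upper_triangular_pow_diag:
  fixes B :: "real mat"
  assumes B: "B \<in> carrier_mat n n" and ut: "upper_triangular B"
  shows "upper_triangular (B ^\<^sub>m k) \<and> (\<forall>i<n. (B ^\<^sub>m k) $$ (i, i) = (B $$ (i, i)) ^ k)"
proof (induction k)
  case 0
  then show ?case using B by auto
next
  case (Suc k)
  have Bk: "B ^\<^sub>m k \<in> carrier_mat n n" using B by simp
  have ent: "(B ^\<^sub>m Suc k) $$ (i, j) = (\<Sum>l<n. (B ^\<^sub>m k) $$ (i, l) * B $$ (l, j))" if "i < n" "j < n" for i j
    using mat_mult_entry[OF Bk B that] by simp
  have 1: "(B ^\<^sub>m k) $$ (i, l) = 0" if "l < i" "i < n" for i l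
    using Suc that Bk by (auto dest!: upper_triangularD)
  have 2: "B $$ (l, j) = 0" if "j < l" "l < n" for l j
    using ut that B by (auto dest!: upper_triangularD)
  have "upper_triangular (B ^\<^sub>m Suc k)"
  proof (rule upper_triangularI)
    fix i j assume ij: "j < i" "i < dim_row (B ^\<^sub>m Suc k)"
    then have "i < n" "j < n" using B by auto
    moreover have "(B ^\<^sub>m k) $$ (i, l) * B $$ (l, j) = 0" if "l < n" for l
      using 1[of l i] 2[of j l] ij \<open>i < n\<close> that by (cases "l < i") auto
    ultimately show "(B ^\<^sub>m Suc k) $$ (i, j) = 0" unfolding ent[OF \<open>i < n\<close> \<open>j < n\<close>] by (intro sum.neutral) auto
  qed
  moreover have "(B ^\<^sub>m Suc k) $$ (i, i) = (B $$ (i, i)) ^ Suc k" if i: "i < n" for i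
  proof -
    have "(B ^\<^sub>m Suc k) $$ (i, i) = (\<Sum>l<n. if l = i then (B ^\<^sub>m k) $$ (i, i) * B $$ (i, i) else 0)"
      unfolding ent[OF i i]
    proof (intro sum.cong refl)
      fix l assume "l \<in> {..<n}"
      then show "(B ^\<^sub>m k) $$ (i, l) * B $$ (l, i) = (if l = i then (B ^\<^sub>m k) $$ (i, i) * B $$ (i, i) else 0)"
        using 1[of l i] 2[of i l] i by (cases l i rule: linorder_cases) auto
    qed
    then show ?thesis using Suc i by simp
  qed
  ultimately show ?case by blast
qed

text \<open>Schur's triangular form suffices: the trace is invariant under similarity, and a power
  of a triangular matrix carries the powers of the diagonal entries on its diagonal.\<close>

lemma mat_trace_pow:
  fixes A :: "real mat"
  assumes A: "A \<in> carrier_mat n n" and es: "char_poly A = (\<Prod>e\<leftarrow>es. [:- e, 1:])"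
  shows "mat_trace (A ^\<^sub>m k) = (\<Sum>e\<leftarrow>es. e ^ k)"
proof -
  obtain B P Q where "schur_decomposition A es = (B, P, Q)" by (metis prod_cases3)
  from schur_decomposition[OF A es this]
  have wit: "similar_mat_wit A B P Q" and ut: "upper_triangular B" and diag: "diag_mat B = es" by auto
  note car = similar_mat_witD2[OF A wit]
  have Bk: "B ^\<^sub>m k \<in> carrier_mat n n" using car by simp
  have "A ^\<^sub>m k = P * B ^\<^sub>m k * Q" by (rule similar_mat_wit_pow_id[OF wit])
  also have "\<dots> = P * (B ^\<^sub>m k * Q)" using car Bk by (intro assoc_mult_mat) auto
  finally have "mat_trace (A ^\<^sub>m k) = mat_trace ((B ^\<^sub>m k * Q) * P)"
    using mat_trace_comm[of P n "B ^\<^sub>m k * Q"] mult_carrier_mat[OF Bk car(7)] car(6) by presburger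
  also have "(B ^\<^sub>m k * Q) * P = B ^\<^sub>m k * (Q * P)" using car Bk by (intro assoc_mult_mat) auto
  also have "\<dots> = B ^\<^sub>m k" using car Bk by simp
  also have "mat_trace (B ^\<^sub>m k) = (\<Sum>i<n. (B $$ (i, i)) ^ k)"
    unfolding mat_trace_def using upper_triangular_pow_diag[OF car(5) ut] Bk by auto
  also have "\<dots> = (\<Sum>e\<leftarrow>diag_mat B. e ^ k)"
    unfolding diag_mat_def using car(5)
    by (simp add: o_def interv_sum_list_conv_sum_set_nat atLeast0LessThan)
  finally show ?thesis unfolding diag .
qed

text \<open>The form \<open>z\<close>, the inner product of \<open>v\<close> with its image, is its
  own conjugate by symmetry and equals \<open>a\<close> times the squared norm of
  \<open>v\<close>.\<close>

lemma real_symmetric_eigenvalue_real: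
  fixes A :: "real mat"
  assumes A: "A \<in> carrier_mat n n" and symm: "\<And>i j. i < n \<Longrightarrow> j < n \<Longrightarrow> A $$ (i, j) = A $$ (j, i)"
    and ev: "eigenvalue (map_mat complex_of_real A) a"
  shows "a \<in> \<real>"
proof -
  obtain v where v: "v \<in> carrier_vec n" "v \<noteq> 0\<^sub>v n" and eq: "map_mat complex_of_real A *\<^sub>v v = a \<cdot>\<^sub>v v"
    using ev A unfolding eigenvalue_def eigenvector_def by auto
  have eqi: "(\<Sum>j<n. of_real (A $$ (i, j)) * v $ j) = a * v $ i" if "i < n" for i
  proof -
    have "(map_mat complex_of_real A *\<^sub>v v) $ i = (a \<cdot>\<^sub>v v) $ i" using eq by simp
    moreover have "(map_mat complex_of_real A *\<^sub>v v) $ i = (\<Sum>j<n. of_real (A $$ (i, j)) * v $ j)"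
      using A v that by (auto simp: scalar_prod_def atLeast0LessThan intro!: sum.cong)
    ultimately show ?thesis using v that by simp
  qed
  define z where "z = (\<Sum>i<n. \<Sum>j<n. cnj (v $ i) * of_real (A $$ (i, j)) * v $ j)"
  define s where "s = (\<Sum>i<n. (cmod (v $ i))\<^sup>2)"
  have "cnj z = (\<Sum>i<n. \<Sum>j<n. cnj (v $ j) * of_real (A $$ (j, i)) * v $ i)"
    unfolding z_def cnj_sum by (intro sum.cong) (simp_all add: symm mult_ac)
  also have "\<dots> = z" unfolding z_def by (subst sum.swap) simp
  finally have zr: "z \<in> \<real>" by (metis Reals_cnj_iff)
  have "z = (\<Sum>i<n. cnj (v $ i) * (\<Sum>j<n. of_real (A $$ (i, j)) * v $ j))"
    unfolding z_def by (simp add: sum_distrib_left mult.assoc)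
  also have "\<dots> = (\<Sum>i<n. cnj (v $ i) * (a * v $ i))" using eqi by simp
  also have "\<dots> = a * of_real s"
    unfolding s_def of_real_sum sum_distrib_left
    by (intro sum.cong refl) (simp add: complex_norm_square mult_ac flip: of_real_power)
  finally have za: "z = a * of_real s" .
  have "s \<noteq> 0"
  proof
    assume "s = 0"
    then have "v $ i = 0" if "i < n" for i
      using that unfolding s_def by (subst (asm) sum_nonneg_eq_0_iff) auto
    then have "v = 0\<^sub>v n" using v by auto
    then show False using v by simp
  qed
  then have "a = z / of_real s" using za by simp
  then show ?thesis using zr by (metis Reals_divide Reals_of_real)
qed

text \<open>\<open>schur_decomposition\<close> expects the linear factors of the characteristic
  polynomial. They exist over the complex numbers, and as all roots are real the factorisation is
  one of real polynomials.\<close>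

lemma real_symmetric_char_poly_splits:
  fixes A :: "real mat"
  assumes A: "A \<in> carrier_mat n n" and symm: "\<And>i j. i < n \<Longrightarrow> j < n \<Longrightarrow> A $$ (i, j) = A $$ (j, i)"
  obtains es where "char_poly A = (\<Prod>e\<leftarrow>es. [:- e, 1:])" "length es = n"
proof -
  define Ac where "Ac = map_mat complex_of_real A"
  have Ac: "Ac \<in> carrier_mat n n" unfolding Ac_def using A by simp
  obtain as where as: "char_poly Ac = (\<Prod>a\<leftarrow>as. [:- a, 1:])" "length as = n"
    using char_poly_factorized[OF Ac] by blast
  have "a \<in> \<real>" if "a \<in> set as" for a
  proof -
    have "poly (char_poly Ac) a = 0" unfolding as(1) poly_prod_list using that by (induction as) auto
    then have "eigenvalue Ac a" using eigenvalue_root_char_poly[OF Ac] by simp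
    then show ?thesis using real_symmetric_eigenvalue_real[OF A symm] unfolding Ac_def by blast
  qed
  then have as': "as = map complex_of_real (map Re as)" by (simp add: map_idI)
  have "map_poly complex_of_real (char_poly A) = char_poly Ac"
    unfolding Ac_def by (rule of_real_hom.char_poly_hom[OF A, symmetric])
  also have "\<dots> = (\<Prod>a\<leftarrow>map complex_of_real (map Re as). [:- a, 1:])" using as(1) as' by simp
  also have "\<dots> = map_poly complex_of_real (\<Prod>e\<leftarrow>map Re as. [:- e, 1:])"
  proof (induction as)
    case (Cons a as)
    interpret mp: map_poly_comm_ring_hom complex_of_real ..
    have "map_poly complex_of_real (\<Prod>e\<leftarrow>map Re (a # as). [:- e, 1:]) =
        map_poly complex_of_real [:- Re a, 1:] * map_poly complex_of_real (\<Prod>e\<leftarrow>map Re as. [:- e, 1:])"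
      by (simp only: list.map prod_list.Cons mp.hom_mult)
    also have "map_poly complex_of_real [:- Re a, 1:] = [:- complex_of_real (Re a), 1:]" by simp
    finally show ?case using Cons by simp
  qed simp
  finally have "char_poly A = (\<Prod>e\<leftarrow>map Re as. [:- e, 1:])"
    by (simp add: poly_eq_iff coeff_map_poly)
  then show thesis using that[of "map Re as"] as(2) by simp
qed

lemma mat_pow_carrier: "A \<in> carrier_mat n n \<Longrightarrow> A ^\<^sub>m k \<in> carrier_mat n n"
  by simp

lemma mat_pow_add:
  fixes A :: "real mat"
  assumes A: "A \<in> carrier_mat n n"
  shows "A ^\<^sub>m (j + k) = A ^\<^sub>m j * A ^\<^sub>m k"
proof (induction k)
  case 0
  then show ?case using A by simp
next
  case (Suc k)
  have "A ^\<^sub>m (j + Suc k) = (A ^\<^sub>m j * A ^\<^sub>m k) * A" using Suc by simp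
  also have "\<dots> = A ^\<^sub>m j * (A ^\<^sub>m k * A)" using A by (intro assoc_mult_mat) auto
  finally show ?case by simp
qed

section \<open>Powers of a symmetric matrix with constant row sums\<close>

locale symmetric_regular_matrix =
  fixes A :: "real mat" and n :: nat and d :: real
  assumes A: "A \<in> carrier_mat n n" and symm: "i < n \<Longrightarrow> j < n \<Longrightarrow> A $$ (i, j) = A $$ (j, i)"
    and row_sum: "i < n \<Longrightarrow> (\<Sum>j<n. A $$ (i, j)) = d" and nonneg: "i < n \<Longrightarrow> j < n \<Longrightarrow> 0 \<le> A $$ (i, j)"
    and n_pos: "n > 0"
begin

definition ent :: "nat \<Rightarrow> nat \<Rightarrow> nat \<Rightarrow> real" where
  "ent k i j = (A ^\<^sub>m k) $$ (i, j)"

lemma ent_0: "i < n \<Longrightarrow> j < n \<Longrightarrow> ent 0 i j = (if i = j then 1 else 0)"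
  unfolding ent_def using A by simp

lemma ent_1: "i < n \<Longrightarrow> j < n \<Longrightarrow> ent 1 i j = A $$ (i, j)"
  unfolding ent_def using A by simp

lemma ent_add:
  assumes "i < n" "j < n"
  shows "ent (k + l) i j = (\<Sum>s<n. ent k i s * ent l s j)"
  unfolding ent_def mat_pow_add[OF A]
  using mat_mult_entry[OF mat_pow_carrier[OF A] mat_pow_carrier[OF A] assms] .

lemma ent_sym: "i < n \<Longrightarrow> j < n \<Longrightarrow> ent k i j = ent k j i"
proof (induction k arbitrary: i j)
  case 0
  then show ?case by (simp add: ent_0)
next
  case (Suc k)
  have "ent (k + 1) i j = (\<Sum>s<n. ent k i s * ent 1 s j)" using ent_add Suc by blast
  also have "\<dots> = (\<Sum>s<n. ent 1 j s * ent k s i)"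
    using Suc ent_1 symm by (intro sum.cong) auto
  also have "\<dots> = ent (1 + k) j i" using ent_add[OF Suc(3,2), of 1 k] by simp
  finally show ?case by simp
qed

lemma ent_row_sum: "i < n \<Longrightarrow> (\<Sum>j<n. ent k i j) = d ^ k"
proof (induction k)
  case 0
  then show ?case by (simp add: ent_0)
next
  case (Suc k)
  have "(\<Sum>j<n. ent (k + 1) i j) = (\<Sum>j<n. \<Sum>s<n. ent k i s * ent 1 s j)"
    using ent_add[OF Suc(2), of _ k 1] by (intro sum.cong) auto
  also have "\<dots> = (\<Sum>s<n. ent k i s * (\<Sum>j<n. ent 1 s j))"
    by (subst sum.swap) (simp add: sum_distrib_left)
  also have "\<dots> = (\<Sum>s<n. ent k i s * d)" using ent_1 row_sum by (intro sum.cong) auto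
  also have "\<dots> = d ^ Suc k" using Suc by (simp flip: sum_distrib_right)
  finally show ?case by simp
qed

definition appl :: "nat \<Rightarrow> (nat \<Rightarrow> real) \<Rightarrow> nat \<Rightarrow> real" where
  "appl k y i = (\<Sum>j<n. ent k i j * y j)"

definition sq :: "(nat \<Rightarrow> real) \<Rightarrow> real" where
  "sq y = (\<Sum>i<n. (y i)\<^sup>2)"

lemma sq_nonneg: "0 \<le> sq y"
  unfolding sq_def by (intro sum_nonneg) simp

lemma mat_trace_double: "(\<Sum>i<n. \<Sum>j<n. (ent k i j)\<^sup>2) = mat_trace (A ^\<^sub>m (2 * k))"
proof -
  have "mat_trace (A ^\<^sub>m (2 * k)) = (\<Sum>i<n. ent (k + k) i i)"
    unfolding mat_trace_def ent_def using A by (simp add: mult_2)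
  also have "\<dots> = (\<Sum>i<n. \<Sum>j<n. ent k i j * ent k j i)" using ent_add by simp
  also have "\<dots> = (\<Sum>i<n. \<Sum>j<n. (ent k i j)\<^sup>2)"
    using ent_sym by (intro sum.cong refl) (auto simp: power2_eq_square)
  finally show ?thesis by simp
qed

text \<open>The right-hand factor is the squared Frobenius norm of \<open>A^k - (d^k / n) J\<close>, where \<open>J\<close> is the
  all-ones matrix.\<close>

lemma sq_appl_le:
  assumes y: "(\<Sum>i<n. y i) = 0"
  shows "sq (appl k y) \<le> (mat_trace (A ^\<^sub>m (2 * k)) - d ^ (2 * k)) * sq y"
proof -
  define c where "c = d ^ k / n"
  \<comment> \<open>Subtracting a constant from all entries changes nothing, since \<open>y\<close>
    sums to zero. The constant \<open>c\<close> is the mean of every row, the choice that makes the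
    Frobenius norm smallest.\<close>
  have "appl k y i = (\<Sum>j<n. (ent k i j - c) * y j)" for i
    unfolding appl_def by (simp add: left_diff_distrib sum_subtractf flip: sum_distrib_left) (simp add: y)
  then have "(appl k y i)\<^sup>2 \<le> (\<Sum>j<n. (ent k i j - c)\<^sup>2) * sq y" for i
    using Cauchy_Schwarz_ineq_sum[of "\<lambda>j. ent k i j - c" y "{..<n}"] unfolding sq_def by simp
  then have "sq (appl k y) \<le> (\<Sum>i<n. (\<Sum>j<n. (ent k i j - c)\<^sup>2) * sq y)"
    unfolding sq_def[of "appl k y"] by (intro sum_mono)
  also have "\<dots> = (\<Sum>i<n. \<Sum>j<n. (ent k i j - c)\<^sup>2) * sq y" by (simp flip: sum_distrib_right)
  also have "(\<Sum>i<n. \<Sum>j<n. (ent k i j - c)\<^sup>2) =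
      (\<Sum>i<n. (\<Sum>j<n. (ent k i j)\<^sup>2) - 2 * c * (\<Sum>j<n. ent k i j) + n * c\<^sup>2)"
  proof (intro sum.cong refl)
    fix i
    have "(\<Sum>j<n. (ent k i j - c)\<^sup>2) = (\<Sum>j<n. (ent k i j)\<^sup>2 - 2 * c * ent k i j + c\<^sup>2)"
      by (intro sum.cong refl) (simp add: power2_diff)
    then show "(\<Sum>j<n. (ent k i j - c)\<^sup>2) = (\<Sum>j<n. (ent k i j)\<^sup>2) - 2 * c * (\<Sum>j<n. ent k i j) + n * c\<^sup>2"
      by (simp add: sum.distrib sum_subtractf sum_distrib_left)
  qed
  also have "\<dots> = (\<Sum>i<n. (\<Sum>j<n. (ent k i j)\<^sup>2) - 2 * c * d ^ k + n * c\<^sup>2)"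
    using ent_row_sum by simp
  also have "\<dots> = mat_trace (A ^\<^sub>m (2 * k)) - 2 * (n * c) * d ^ k + (n * c) * (n * c)"
    unfolding sum.distrib sum_subtractf mat_trace_double by (simp add: power2_eq_square)
  also have "n * c = d ^ k" unfolding c_def using n_pos by simp
  also have "mat_trace (A ^\<^sub>m (2 * k)) - 2 * d ^ k * d ^ k + d ^ k * d ^ k = mat_trace (A ^\<^sub>m (2 * k)) - d ^ (2 * k)"
  proof -
    have "d ^ (2 * k) = d ^ k * d ^ k" by (simp only: mult_2 power_add)
    then show ?thesis by simp
  qed
  finally show ?thesis .
qed

text \<open>By symmetry, the squared norm of \<open>A^k y\<close> is the inner product of
  \<open>y\<close> and \<open>A^(2k) y\<close>; then Cauchy-Schwarz.\<close>

lemma sq_appl_double: "(sq (appl k y))\<^sup>2 \<le> sq y * sq (appl (2 * k) y)"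
proof -
  have "sq (appl k y) = (\<Sum>i<n. (\<Sum>j<n. ent k i j * y j) * (\<Sum>l<n. ent k i l * y l))"
    unfolding sq_def appl_def power2_eq_square ..
  also have "\<dots> = (\<Sum>i<n. \<Sum>j<n. \<Sum>l<n. y j * (ent k j i * ent k i l * y l))"
    unfolding sum_product using ent_sym by (intro sum.cong refl) (simp add: mult_ac)
  also have "\<dots> = (\<Sum>j<n. \<Sum>l<n. \<Sum>i<n. y j * (ent k j i * ent k i l * y l))"

  proof -
    have "(\<Sum>i<n. \<Sum>j<n. \<Sum>l<n. y j * (ent k j i * ent k i l * y l)) =
        (\<Sum>j<n. \<Sum>i<n. \<Sum>l<n. y j * (ent k j i * ent k i l * y l))" by (rule sum.swap)
    also have "\<dots> = (\<Sum>j<n. \<Sum>l<n. \<Sum>i<n. y j * (ent k j i * ent k i l * y l))"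
      by (intro sum.cong refl sum.swap)
    finally show ?thesis .
  qed
  also have "\<dots> = (\<Sum>j<n. y j * (\<Sum>l<n. ent (k + k) j l * y l))"
    using ent_add by (simp add: sum_distrib_left sum_distrib_right mult_ac)
  also have "\<dots> = (\<Sum>j<n. y j * appl (2 * k) y j)" unfolding appl_def mult_2 ..
  finally show ?thesis
    using Cauchy_Schwarz_ineq_sum[of y "appl (2 * k) y" "{..<n}"] unfolding sq_def by simp
qed

lemma sq_appl_power: "(sq (appl 1 y)) ^ (2 ^ i) \<le> (sq y) ^ (2 ^ i - 1) * sq (appl (2 ^ i) y)"
proof (induction i)
  case 0
  then show ?case by simp
next
  case (Suc i)
  define Y where "Y = sq y"
  have Y0: "0 \<le> Y" unfolding Y_def by (rule sq_nonneg)
  have "(sq (appl 1 y)) ^ (2 ^ Suc i) = ((sq (appl 1 y)) ^ (2 ^ i))\<^sup>2" by (simp add: power_mult[symmetric] mult.commute)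
  also have "\<dots> \<le> (Y ^ (2 ^ i - 1) * sq (appl (2 ^ i) y))\<^sup>2"
    using Suc sq_nonneg unfolding Y_def by (intro power_mono) auto
  also have "\<dots> = (Y ^ (2 ^ i - 1))\<^sup>2 * (sq (appl (2 ^ i) y))\<^sup>2" by (rule power_mult_distrib)
  also have "\<dots> \<le> (Y ^ (2 ^ i - 1))\<^sup>2 * (Y * sq (appl (2 * 2 ^ i) y))"
    using sq_appl_double[of "2 ^ i" y] unfolding Y_def by (intro mult_left_mono) auto
  also have "\<dots> = Y ^ (2 * (2 ^ i - 1) + 1) * sq (appl (2 ^ Suc i) y)"
    by (simp add: power_add power_mult power_mult_distrib mult_ac power2_eq_square)
  also have "2 * (2 ^ i - 1) + 1 = (2 ^ Suc i - 1 :: nat)"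
    using one_le_power[of "2::nat" i] unfolding power_Suc by arith
  finally show ?case unfolding Y_def .
qed

text \<open>The argument works without an eigenbasis. For vectors of sum zero the Frobenius bound on
  the power \<open>2^i\<close> gives the analogous estimate up to a factor \<open>n\<close>. By
  repeated doubling this factor enters the estimate for the first power only through its
  \<open>2^i\<close>-th root, which tends to 1.\<close>

lemma sq_appl_spectral:
  assumes es: "char_poly A = (\<Prod>e\<leftarrow>es. [:- e, 1:])" "length es = n"
    and lam: "\<And>x. x \<in># mset es - {#Max_mset (mset es)#} \<Longrightarrow> \<bar>x\<bar> \<le> lam" "0 \<le> lam"
    and y: "(\<Sum>i<n. y i) = 0"
  shows "sq (appl 1 y) \<le> lam\<^sup>2 * sq y"
proof -
  have root: "eigenvalue A x \<longleftrightarrow> x \<in> set es" for x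
    unfolding eigenvalue_root_char_poly[OF A] es(1) poly_prod_list by (induction es) auto
  have "eigenvalue A d"
  proof -
    have "eigenvector A (vec n (\<lambda>_. 1)) d"
      unfolding eigenvector_def
    proof (intro conjI)
      show "vec n (\<lambda>_. 1) \<in> carrier_vec (dim_row A)" using A by auto
      have "vec n (\<lambda>_. 1) $ 0 \<noteq> (0\<^sub>v n :: real vec) $ 0" using n_pos by simp
      then show "vec n (\<lambda>_. 1) \<noteq> (0\<^sub>v (dim_row A) :: real vec)" using A by auto
      show "A *\<^sub>v vec n (\<lambda>_. 1) = d \<cdot>\<^sub>v vec n (\<lambda>_. 1)"
        using A row_sum by (intro eq_vecI) (auto simp: scalar_prod_def atLeast0LessThan)
    qed
    then show ?thesis unfolding eigenvalue_def by blast
  qed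
  then have d_in: "d \<in> set es" using root by blast
  \<comment> \<open>Compare both sides of the eigenvalue equation at a coordinate where the
    eigenvector has maximal modulus.\<close>
  have le_d: "x \<le> d" if x: "x \<in> set es" for x
  proof -
    obtain v where v: "v \<in> carrier_vec n" "v \<noteq> 0\<^sub>v n" "A *\<^sub>v v = x \<cdot>\<^sub>v v"
      using root[of x, THEN iffD2, OF x] A unfolding eigenvalue_def eigenvector_def by auto
    define mx where "mx = Max ((\<lambda>i. \<bar>v $ i\<bar>) ` {..<n})"
    have fin: "finite ((\<lambda>i. \<bar>v $ i\<bar>) ` {..<n})" "(\<lambda>i. \<bar>v $ i\<bar>) ` {..<n} \<noteq> {}" using n_pos by auto
    obtain i where i: "i < n" "mx = \<bar>v $ i\<bar>" using Max_in[OF fin] unfolding mx_def by auto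
    have mx: "\<bar>v $ j\<bar> \<le> mx" if "j < n" for j unfolding mx_def using fin that by (intro Max_ge) auto
    obtain j where "j < n" "v $ j \<noteq> 0" using v(1,2) by (metis carrier_vecD eq_vecI index_zero_vec)
    then have mx0: "0 < mx" using mx[of j] by linarith
    have "x * v $ i = (x \<cdot>\<^sub>v v) $ i" using v i by simp
    also have "\<dots> = (A *\<^sub>v v) $ i" using v by simp
    also have "\<dots> = (\<Sum>j<n. A $$ (i, j) * v $ j)"
      using A v(1) i by (auto simp: scalar_prod_def atLeast0LessThan intro!: sum.cong)
    finally have "\<bar>x\<bar> * mx = \<bar>\<Sum>j<n. A $$ (i, j) * v $ j\<bar>" unfolding i(2) by (simp flip: abs_mult)
    also have "\<dots> \<le> (\<Sum>j<n. \<bar>A $$ (i, j) * v $ j\<bar>)" by (rule sum_abs)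
    also have "\<dots> \<le> (\<Sum>j<n. A $$ (i, j) * mx)"
      using nonneg i mx by (intro sum_mono) (auto simp: abs_mult intro!: mult_mono)
    also have "\<dots> = d * mx" using row_sum[OF i(1)] by (simp flip: sum_distrib_right)
    finally show ?thesis using mx0 by simp
  qed
  \<comment> \<open>The exempted eigenvalue is thus that of the all-ones vector, and deducting
    \<open>d ^ (2 * k)\<close> from the trace leaves only eigenvalues bounded by
    \<open>lam\<close>.\<close>
  have mx: "Max_mset (mset es) = d"
    using d_in le_d by (intro Max_eqI) auto
  have tr: "mat_trace (A ^\<^sub>m (2 * k)) - d ^ (2 * k) \<le> n * (lam\<^sup>2) ^ k" for k
  proof -
    define M where "M = mset es - {#d#}"
    have M: "mset es = add_mset d M" unfolding M_def using d_in by simp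
    have "mat_trace (A ^\<^sub>m (2 * k)) = (\<Sum>e\<in>#mset es. e ^ (2 * k))"
      using mat_trace_pow[OF A es(1)] by (metis mset_map sum_mset_sum_list)
    also have "\<dots> = d ^ (2 * k) + (\<Sum>e\<in>#M. e ^ (2 * k))" unfolding M by simp
    also have "(\<Sum>e\<in>#M. e ^ (2 * k)) \<le> (\<Sum>e\<in>#M. (lam\<^sup>2) ^ k)"
    proof (intro sum_mset_mono)
      fix e assume "e \<in># M"
      then have "\<bar>e\<bar> \<le> lam" using lam(1) unfolding mx M_def by blast
      then have "\<bar>e\<bar> \<le> \<bar>lam\<bar>" using lam(2) by linarith
      then have "e\<^sup>2 \<le> lam\<^sup>2" unfolding abs_le_square_iff .
      then show "e ^ (2 * k) \<le> (lam\<^sup>2) ^ k" unfolding power_mult by (rule power_mono) simp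
    qed
    also have "(\<Sum>e\<in>#M. (lam\<^sup>2) ^ k) = size M * (lam\<^sup>2) ^ k" by simp
    also have "\<dots> \<le> n * (lam\<^sup>2) ^ k"
    proof -
      have "size M \<le> n" using es(2) arg_cong[OF M, of size] by simp
      then show ?thesis by (intro mult_right_mono) auto
    qed
    finally show ?thesis by simp
  qed
  define R where "R = sq (appl 1 y)"
  define Y where "Y = sq y"
  have bound: "R ^ (2 ^ i) \<le> n * (lam\<^sup>2 * Y) ^ (2 ^ i)" for i
  proof -
    have "R ^ (2 ^ i) \<le> Y ^ (2 ^ i - 1) * sq (appl (2 ^ i) y)"
      unfolding R_def Y_def by (rule sq_appl_power)
    also have "\<dots> \<le> Y ^ (2 ^ i - 1) * (n * (lam\<^sup>2) ^ (2 ^ i) * Y)"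
    proof (rule mult_left_mono)
      show "sq (appl (2 ^ i) y) \<le> n * (lam\<^sup>2) ^ (2 ^ i) * Y"
        using sq_appl_le[OF y, of "2 ^ i"] mult_right_mono[OF tr[of "2 ^ i"] sq_nonneg[of y]]
        unfolding Y_def by linarith
      show "0 \<le> Y ^ (2 ^ i - 1)" unfolding Y_def using sq_nonneg by simp
    qed
    also have "\<dots> = n * (lam\<^sup>2) ^ (2 ^ i) * Y ^ Suc (2 ^ i - 1)" by (simp only: power_Suc mult_ac)
    also have "Suc (2 ^ i - 1) = (2::nat) ^ i" by simp
    finally show ?thesis by (simp add: power_mult_distrib mult.assoc)
  qed
  have R0: "0 \<le> R" "0 \<le> Y" unfolding R_def Y_def using sq_nonneg by auto
  show ?thesis
  proof (rule ccontr)
    assume "\<not> ?thesis"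
    then have less: "lam\<^sup>2 * Y < R" unfolding R_def Y_def by simp
    show False
    proof (cases "lam\<^sup>2 * Y = 0")
      case True
      have "R \<le> n * (lam\<^sup>2 * Y)" using bound[of 0] by simp
      then show False using less unfolding True by simp
    next
      case False
      then have pos: "0 < lam\<^sup>2 * Y" using R0 by (simp add: less_le)
      define q where "q = R / (lam\<^sup>2 * Y)"
      have q: "1 < q" unfolding q_def using less pos by simp
      have "q ^ (2 ^ i) \<le> n" for i
        unfolding q_def power_divide using bound[of i] pos by (simp add: pos_divide_le_eq del: power_mult_distrib)
      moreover obtain N where "real n < q ^ N" using real_arch_pow[OF q] by blast
      moreover have "q ^ N \<le> q ^ (2 ^ N)" using q by (intro power_increasing) (auto intro: less_imp_le)
      ultimately show False by (meson not_less order_trans)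
    qed
  qed
qed

text \<open>The indicator of \<open>J\<close> is split into its mean, which yields the main term by
  regularity, and a part \<open>y\<close> of sum zero, to which \<open>op\<close> applies. The inner
  product of \<open>A y\<close> with the indicator of \<open>I\<close> is bounded by
  Cauchy-Schwarz.\<close>

lemma expander_mixing:
  assumes op: "\<And>y. (\<Sum>i<n. y i) = 0 \<Longrightarrow> sq (appl 1 y) \<le> lam\<^sup>2 * sq y" "0 \<le> lam"
    and IJ: "I \<subseteq> {..<n}" "J \<subseteq> {..<n}"
  shows "\<bar>(\<Sum>i\<in>I. \<Sum>j\<in>J. A $$ (i, j)) - d * card I * card J / n\<bar> \<le> lam * sqrt (card I * card J)"
proof -
  define c where "c = card J / n"
  define y where "y = (\<lambda>j. (if j \<in> J then 1 else 0) - c)"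
  have fin: "finite I" "finite J" using IJ finite_subset by blast+
  have sumJ: "(\<Sum>j<n. f j * (if j \<in> J then 1 else 0)) = (\<Sum>j\<in>J. f j)" for f :: "nat \<Rightarrow> real"
    using IJ(2) by (simp add: sum.If_cases Int_absorb1 if_distrib[of "\<lambda>x. _ * x"] cong: if_cong)
  have sumI: "(\<Sum>j<n. (if j \<in> I then 1 else 0) * f j) = (\<Sum>j\<in>I. f j)" for f :: "nat \<Rightarrow> real"
    using IJ(1) by (simp add: sum.If_cases Int_absorb1 if_distrib[of "\<lambda>x. x * _"] cong: if_cong)
  have y0: "(\<Sum>j<n. y j) = 0"
    unfolding y_def using sumJ[of "\<lambda>_. 1"] n_pos by (simp add: sum_subtractf c_def)
  have sqy: "sq y \<le> card J"
  proof -
    have "sq y = (\<Sum>j<n. (1 - 2 * c) * (if j \<in> J then 1 else 0) + c\<^sup>2)"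
      unfolding sq_def y_def by (intro sum.cong refl) (simp add: power2_eq_square algebra_simps)
    also have "\<dots> = (1 - 2 * c) * card J + n * c\<^sup>2"
      unfolding sum.distrib sumJ by simp
    also have "n * c\<^sup>2 = c * card J" unfolding c_def using n_pos by (simp add: power2_eq_square)
    also have "(1 - 2 * c) * card J + c * card J = card J - c * card J" by (simp add: algebra_simps)
    also have "\<dots> \<le> card J" unfolding c_def by simp
    finally show ?thesis .
  qed
  have appl_y: "appl 1 y i = (\<Sum>j\<in>J. A $$ (i, j)) - c * d" if "i < n" for i
  proof -
    have "appl 1 y i = (\<Sum>j<n. A $$ (i, j) * (if j \<in> J then 1 else 0)) - (\<Sum>j<n. A $$ (i, j)) * c"
      unfolding appl_def y_def right_diff_distrib sum_subtractf sum_distrib_right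
      using ent_1 that by simp
    then show ?thesis unfolding sumJ row_sum[OF that] by simp
  qed
  have "(\<Sum>i\<in>I. appl 1 y i) = (\<Sum>i\<in>I. (\<Sum>j\<in>J. A $$ (i, j)) - c * d)"
    using appl_y IJ by (intro sum.cong) auto
  then have eq: "(\<Sum>i\<in>I. \<Sum>j\<in>J. A $$ (i, j)) - d * card I * card J / n = (\<Sum>i\<in>I. appl 1 y i)"
    unfolding c_def by (simp add: sum_subtractf mult_ac)
  have "(\<Sum>i\<in>I. appl 1 y i)\<^sup>2 = (\<Sum>i<n. (if i \<in> I then 1 else 0) * appl 1 y i)\<^sup>2" unfolding sumI ..
  also have "\<dots> \<le> (\<Sum>i<n. (if i \<in> I then 1 else 0)\<^sup>2) * sq (appl 1 y)"
    unfolding sq_def by (rule Cauchy_Schwarz_ineq_sum)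
  also have "(\<Sum>i<n. (if i \<in> I then 1 else 0)\<^sup>2) = real (card I)"
    using sumI[of "\<lambda>_. 1"] by (simp add: if_distrib[of "\<lambda>x. x\<^sup>2"] cong: if_cong)
  also have "card I * sq (appl 1 y) \<le> card I * (lam\<^sup>2 * card J)"
    using op(1)[OF y0] sqy mult_left_mono[OF sqy, of "lam\<^sup>2"] by (intro mult_left_mono) auto
  also have "\<dots> = (lam * sqrt (card I * card J))\<^sup>2" by (simp add: power_mult_distrib)
  finally have "\<bar>\<Sum>i\<in>I. appl 1 y i\<bar> \<le> \<bar>lam * sqrt (card I * card J)\<bar>" unfolding abs_le_square_iff .
  moreover have "0 \<le> lam * sqrt (card I * card J)" using op(2) by simp
  ultimately show ?thesis unfolding eq by linarith
qed

end

section \<open>From matrices to graphs\<close>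

definition edge :: "'a pair_pre_digraph \<Rightarrow> 'a \<Rightarrow> 'a \<Rightarrow> bool" where
  "edge G u v \<longleftrightarrow> (u, v) \<in> parcs G"

lemma out_degree_eq_dgr:
  assumes "pair_graph G"
  shows "out_degree (with_proj G) v = dgr (edge G) v (pverts G)"
proof -
  interpret pair_graph G by fact
  have "out_arcs (with_proj G) v = Pair v ` {u \<in> pverts G. edge G v u}"
    unfolding out_arcs_def edge_def using in_arcsD2 by force
  then show ?thesis unfolding out_degree_def dgr_def by (simp add: card_image inj_on_def)
qed

lemma pair_graph_edge:
  assumes "pair_graph G"
  shows "edge G u v \<Longrightarrow> edge G v u" "\<not> edge G v v" "finite (pverts G)"
    "edge G u v \<Longrightarrow> u \<in> pverts G" "edge G u v \<Longrightarrow> v \<in> pverts G"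
proof -
  interpret pair_graph G by fact
  show "edge G u v \<Longrightarrow> edge G v u" unfolding edge_def
    using pair_sym_arcs unfolding symmetric_def by (simp add: symD)
  show "\<not> edge G v v" unfolding edge_def using pair_no_loops by force
  show "finite (pverts G)" by (rule pair_finite_verts)
  show "edge G u v \<Longrightarrow> u \<in> pverts G" "edge G u v \<Longrightarrow> v \<in> pverts G"
    unfolding edge_def using in_arcsD1 in_arcsD2 by auto
qed

lemma ndl_graph_mixing:
  assumes G: "ndl_graph n d lam G" and n: "2 \<le> n" and AB: "A \<subseteq> pverts G" "B \<subseteq> pverts G"
  shows "\<bar>(\<Sum>a\<in>A. real (dgr (edge G) a B)) - d * card A * card B / n\<bar> \<le> lam * sqrt (card A * card B)"
    and "0 \<le> lam"
proof -
  obtain vs where pg: "pair_graph G" and cardV: "card (pverts G) = n"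
    and deg: "\<forall>v\<in>pverts G. out_degree (with_proj G) v = d"
    and vs: "distinct vs" "set vs = pverts G"
    and ev: "\<forall>x \<in># proots (char_poly (adjacency_matrix vs G)) -
               {#Max_mset (proots (char_poly (adjacency_matrix vs G)))#}. \<bar>x\<bar> \<le> lam"
    using G unfolding ndl_graph_def Let_def by blast
  define M where "M = adjacency_matrix vs G"
  have len: "length vs = n" using vs cardV by (metis distinct_card)
  have M: "M \<in> carrier_mat n n" unfolding M_def adjacency_matrix_def using len by simp
  have ent: "M $$ (i, j) = (if edge G (vs ! i) (vs ! j) then 1 else 0)" if "i < n" "j < n" for i j
    unfolding M_def adjacency_matrix_def edge_def using that len by simp
  have bij: "bij_betw (\<lambda>i. vs ! i) {..<n} (pverts G)"
    using bij_betw_nth[OF vs(1), of "{..<n}" "pverts G"] vs(2) len by simp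
  have sumS: "(\<Sum>j\<in>J. M $$ (i, j)) = dgr (edge G) (vs ! i) ((\<lambda>j. vs ! j) ` J)"
    if "i < n" "J \<subseteq> {..<n}" for i J
  proof -
    have fin: "finite J" using that finite_subset by blast
    have "(\<Sum>j\<in>J. M $$ (i, j)) = (\<Sum>j\<in>J. if edge G (vs ! i) (vs ! j) then 1 else 0)"
      using that ent by (intro sum.cong) auto
    also have "\<dots> = card {j \<in> J. edge G (vs ! i) (vs ! j)}"
      using fin by (simp add: sum.If_cases Int_def)
    also have "card {j \<in> J. edge G (vs ! i) (vs ! j)} = card ((\<lambda>j. vs ! j) ` {j \<in> J. edge G (vs ! i) (vs ! j)})"
      using bij that by (intro card_image[symmetric]) (auto simp: bij_betw_def intro: inj_on_subset)
    also have "(\<lambda>j. vs ! j) ` {j \<in> J. edge G (vs ! i) (vs ! j)} = {u \<in> (\<lambda>j. vs ! j) ` J. edge G (vs ! i) u}"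
      by auto
    finally show ?thesis unfolding dgr_def .
  qed
  interpret symmetric_regular_matrix M n d
  proof
    show "M $$ (i, j) = M $$ (j, i)" if "i < n" "j < n" for i j
      using that pair_graph_edge(1)[OF pg] by (auto simp: ent)
    show "(\<Sum>j<n. M $$ (i, j)) = d" if "i < n" for i
    proof -
      have "vs ! i \<in> pverts G" using that vs(2) len nth_mem by blast
      then have "dgr (edge G) (vs ! i) (pverts G) = d" using deg out_degree_eq_dgr[OF pg] by metis
      moreover have "(\<lambda>j. vs ! j) ` {..<n} = pverts G" using bij by (simp add: bij_betw_def)
      ultimately show ?thesis using sumS[OF that, of "{..<n}"] by simp
    qed
  qed (use M ent n in auto)
  obtain es where es: "char_poly M = (\<Prod>e\<leftarrow>es. [:- e, 1:])" "length es = n"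
    using real_symmetric_char_poly_splits[OF M symm] by blast
  have "proots (char_poly M) = mset es"
  proof -
    have "(\<Prod>e\<leftarrow>es. [:- e, 1:]) \<noteq> 0" by (auto simp: prod_list_zero_iff)
    moreover have "proots (\<Prod>e\<leftarrow>es'. [:- e, 1:]) = mset es'" for es' :: "real list"
    proof (induction es')
      case (Cons e es')
      have "(\<Prod>e\<leftarrow>es'. [:- e, 1:]) \<noteq> 0" by (auto simp: prod_list_zero_iff)
      then have "proots ([:- e, 1:] * (\<Prod>e\<leftarrow>es'. [:- e, 1:])) = proots [:- e, 1:] + proots (\<Prod>e\<leftarrow>es'. [:- e, 1:])"
        by (intro proots_mult) auto
      then show ?case using Cons by simp
    qed simp
    ultimately show ?thesis unfolding es(1) by blast
  qed
  then have lam: "\<And>x. x \<in># mset es - {#Max_mset (mset es)#} \<Longrightarrow> \<bar>x\<bar> \<le> lam"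
    using ev unfolding M_def by simp
  \<comment> \<open>With at least two eigenvalues, one survives the removal of the largest, and
    \<open>lam\<close> bounds its absolute value.\<close>
  show lam0: "0 \<le> lam"
  proof -
    have "size (mset es) - 1 \<le> size (mset es - {#Max_mset (mset es)#})"
      using diff_size_le_size_Diff[of "mset es" "{#Max_mset (mset es)#}"] by simp
    then have "0 < size (mset es - {#Max_mset (mset es)#})" using es(2) n by simp
    then obtain x where "x \<in># mset es - {#Max_mset (mset es)#}"
      by (metis multiset_nonemptyE size_empty less_irrefl)
    then show ?thesis using lam[of x] by linarith
  qed
  define I where "I = {i. i < n \<and> vs ! i \<in> A}"
  define J where "J = {i. i < n \<and> vs ! i \<in> B}"
  have IA: "(\<lambda>i. vs ! i) ` I = A" and JB: "(\<lambda>i. vs ! i) ` J = B"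
    using AB bij unfolding I_def J_def bij_betw_def by (auto simp: image_iff subset_iff)
  have IJ: "I \<subseteq> {..<n}" "J \<subseteq> {..<n}" unfolding I_def J_def by auto
  have inj: "inj_on (\<lambda>i. vs ! i) I" "inj_on (\<lambda>i. vs ! i) J"
    using bij IJ unfolding bij_betw_def by (auto intro: inj_on_subset)
  have cards: "card I = card A" "card J = card B" using card_image[OF inj(1)] card_image[OF inj(2)] IA JB by auto
  have "(\<Sum>i\<in>I. \<Sum>j\<in>J. M $$ (i, j)) = (\<Sum>i\<in>I. real (dgr (edge G) (vs ! i) B))"
    using sumS[OF _ IJ(2)] IJ(1) JB by (intro sum.cong) auto
  also have "\<dots> = (\<Sum>a\<in>A. real (dgr (edge G) a B))"
    unfolding IA[symmetric] by (rule sum.reindex[OF inj(1), symmetric, unfolded o_def])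
  finally show "\<bar>(\<Sum>a\<in>A. real (dgr (edge G) a B)) - d * card A * card B / n\<bar> \<le> lam * sqrt (card A * card B)"
    using expander_mixing[OF sq_appl_spectral[OF es lam lam0] lam0 IJ] unfolding cards by simp
qed

section \<open>Maximum cuts and resilience\<close>

text \<open>Take a bipartition with the fewest edges inside its sides. A vertex with more neighbours
  on its own side than across could be moved to lower that number. The quantity \<open>I\<close>
  counts every inner edge twice.\<close>

lemma max_cut_degrees:
  assumes "finite V" and sym: "\<And>u v. E u v \<Longrightarrow> E v u" and irrefl: "\<And>v. \<not> E v v"
  shows "\<exists>S\<subseteq>V. \<forall>v\<in>V. 2 * dgr E v {u \<in> V. u \<in> S \<longleftrightarrow> v \<in> S} \<le> dgr E v V"
proof -
  define g where "g = (\<lambda>S. \<Sum>u\<in>S. dgr E u S)"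
  have g_insert: "g (insert v S) = g S + 2 * dgr E v S" if "finite S" "v \<notin> S" for v S
  proof -
    have 1: "dgr E u (insert v S) = dgr E u S + (if E u v then 1 else 0)" for u
    proof -
      have "{w \<in> insert v S. E u w} = (if E u v then insert v {w \<in> S. E u w} else {w \<in> S. E u w})" by auto
      then show ?thesis unfolding dgr_def using that by simp
    qed
    have "(\<Sum>u\<in>S. if E u v then 1 else 0) = dgr E v S"
      unfolding dgr_def using that sym by (simp add: sum.If_cases Int_def) (metis)
    then show ?thesis unfolding g_def using that irrefl by (simp add: 1 sum.distrib)
  qed
  define I where "I = (\<lambda>S. g S + g (V - S))"
  obtain S where S: "S \<subseteq> V" "\<And>T. T \<subseteq> V \<Longrightarrow> I S \<le> I T"
    using ex_min_if_finite[of "I ` Pow V"] assms(1) by (metis (no_types, lifting) Pow_iff Pow_not_empty finite_Pow_iff finite_imageI arg_min_if_finite(1) arg_min_least)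
  have half: "dgr E v T \<le> dgr E v (V - T)" if T: "T \<subseteq> V" "v \<in> T" "\<And>R. R \<subseteq> V \<Longrightarrow> I T \<le> I R" for v T
  proof -
    define T' where "T' = T - {v}"
    have T': "T = insert v T'" "v \<notin> T'" "V - T' = insert v (V - T)" "v \<notin> V - T" "T' \<subseteq> V"
      using T unfolding T'_def by auto
    have fin: "finite T'" "finite (V - T)" using T'(5) assms(1) finite_subset by auto
    have "I T = g T' + 2 * dgr E v T' + g (V - T)" unfolding I_def using g_insert[OF fin(1) T'(2)] T'(1) by simp
    moreover have "I T' = g T' + (g (V - T) + 2 * dgr E v (V - T))"
      unfolding I_def T'(3) using g_insert[OF fin(2) T'(4)] by simp
    ultimately have "dgr E v T' \<le> dgr E v (V - T)" using T(3)[OF T'(5)] by linarith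
    moreover have "dgr E v T = dgr E v T'"
    proof -
      have "{w \<in> T. E v w} = {w \<in> T'. E v w}" using irrefl T'(1) by auto
      then show ?thesis unfolding dgr_def by simp
    qed
    ultimately show ?thesis by simp
  qed
  have split: "dgr E v V = dgr E v T + dgr E v (V - T)" if "T \<subseteq> V" for v T
  proof -
    have "{w \<in> V. E v w} = {w \<in> T. E v w} \<union> {w \<in> V - T. E v w}" using that by auto
    moreover have "finite T" "finite (V - T)" using that assms(1) finite_subset by auto
    ultimately show ?thesis unfolding dgr_def by (simp add: card_Un_disjoint disjoint_iff)
  qed
  have IC: "I (V - S) = I S" unfolding I_def using S(1) by (simp add: double_diff)
  show ?thesis
  proof (intro exI[of _ S] conjI ballI S(1))
    fix v assume v: "v \<in> V"
    show "2 * dgr E v {u \<in> V. (u \<in> S) = (v \<in> S)} \<le> dgr E v V"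
    proof (cases "v \<in> S")
      case True
      then have "{u \<in> V. (u \<in> S) = (v \<in> S)} = S" using S(1) by auto
      then show ?thesis using half[OF S(1) True] S(2) split[OF S(1), of v] by simp
    next
      case False
      then have "{u \<in> V. (u \<in> S) = (v \<in> S)} = V - S" by auto
      moreover have "dgr E v (V - S) \<le> dgr E v (V - (V - S))"
        using half[of "V - S" v] IC S v False by auto
      ultimately show ?thesis using split[OF S(1), of v] S(1) by (simp add: double_diff)
    qed
  qed
qed

lemma edge_delete: "edge (delete_edges G H) u v \<longleftrightarrow> edge G u v \<and> \<not> edge H u v"
  unfolding edge_def delete_edges_def by simp

lemma pverts_delete: "pverts (delete_edges G H) = pverts G"
  unfolding delete_edges_def by simp

lemma bipartite_walk_parity:
  assumes "pcas u p v" "\<And>x y. (x, y) \<in> set p \<Longrightarrow> (x \<in> S) \<noteq> (y \<in> S)"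
  shows "((u \<in> S) = (v \<in> S)) = even (length p)"
  using assms
proof (induction p arbitrary: u)
  case (Cons e p)
  then have e: "fst e = u" "pcas (snd e) p v" by auto
  have "(fst e, snd e) \<in> set (e # p)" by simp
  then have "(u \<in> S) \<noteq> (snd e \<in> S)" using Cons.prems(2) e(1) by blast
  moreover have "((snd e \<in> S) = (v \<in> S)) = even (length p)" using Cons.IH[OF e(2)] Cons.prems(2) by simp
  ultimately show ?case by auto
qed simp

lemma max_degree_le:
  assumes "pair_graph H" "\<And>v. v \<in> pverts H \<Longrightarrow> dgr (edge H) v (pverts H) \<le> r"
  shows "max_degree H \<le> r"
  unfolding max_degree_def using assms pair_graph_edge(3)[OF assms(1)] out_degree_eq_dgr[OF assms(1)]
  by (intro Max.boundedI) auto

lemma exists_bipartite_remainder: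
  assumes "pair_graph G" and deg: "\<And>v. v \<in> pverts G \<Longrightarrow> dgr (edge G) v (pverts G) = d"
  shows "\<exists>H. is_subgraph H G \<and> 2 * max_degree H \<le> d \<and>
           (\<forall>t. odd t \<longrightarrow> \<not> contains_cycle (delete_edges G H) t)"
proof -
  note pg = pair_graph_edge[OF assms(1)]
  obtain S where S: "S \<subseteq> pverts G"
    "\<And>v. v \<in> pverts G \<Longrightarrow> 2 * dgr (edge G) v {u \<in> pverts G. u \<in> S \<longleftrightarrow> v \<in> S} \<le> dgr (edge G) v (pverts G)"
  proof -
    have "\<exists>S\<subseteq>pverts G. \<forall>v\<in>pverts G.
        2 * dgr (edge G) v {u \<in> pverts G. u \<in> S \<longleftrightarrow> v \<in> S} \<le> dgr (edge G) v (pverts G)"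
      by (rule max_cut_degrees) (use pg in auto)
    then show thesis using that by blast
  qed
  define H where "H = \<lparr>pverts = pverts G, parcs = {(u, v) \<in> parcs G. (u \<in> S) = (v \<in> S)}\<rparr>"
  have edgeH: "edge H u v \<longleftrightarrow> edge G u v \<and> (u \<in> S) = (v \<in> S)" for u v
    unfolding edge_def H_def by auto
  have vH: "pverts H = pverts G" unfolding H_def by simp
  interpret G: pair_graph G by fact
  have pgH: "pair_graph H"
  proof
    show "finite (parcs H)"
      by (rule finite_subset[OF _ G.pair_finite_arcs]) (auto simp: H_def)
    show "symmetric (with_proj H)"
      unfolding symmetric_def with_proj_simps using pg(1) edgeH unfolding edge_def by (auto intro!: symI)
  qed (use pg edgeH vH in \<open>auto simp: edge_def H_def\<close>)
  interpret H: pair_graph H by fact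
  have sub: "is_subgraph H G"
    unfolding is_subgraph_def subgraph_def
    using pgH G.wf_digraph_axioms H.wf_digraph_axioms by (auto simp: H_def compatible_def)
  have "max_degree H \<le> d div 2"
  proof (rule max_degree_le[OF pgH])
    fix v assume v: "v \<in> pverts H"
    have "{u \<in> pverts H. edge H v u} = {u \<in> {u \<in> pverts G. u \<in> S \<longleftrightarrow> v \<in> S}. edge G v u}"
      unfolding vH edgeH by auto
    then have "2 * dgr (edge H) v (pverts H) \<le> d" using S(2)[of v] deg v vH unfolding dgr_def by simp
    then show "dgr (edge H) v (pverts H) \<le> d div 2" by simp
  qed
  moreover have "\<not> contains_cycle (delete_edges G H) t" if "odd t" for t
  proof
    assume "contains_cycle (delete_edges G H) t"
    then obtain p u where p: "length p = t" "pre_digraph.awalk (with_proj (delete_edges G H)) u p u"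
      unfolding contains_cycle_def pre_digraph.cycle_def by blast
    then have "pcas u p u" and arcs: "set p \<subseteq> parcs (delete_edges G H)"
      unfolding pre_digraph.awalk_def by (auto simp: cas_with_proj_eq)
    moreover have "(x \<in> S) \<noteq> (y \<in> S)" if xy: "(x, y) \<in> set p" for x y
    proof -
      have "edge (delete_edges G H) x y" using arcs xy unfolding edge_def by blast
      then show ?thesis unfolding edge_delete edgeH by blast
    qed
    ultimately have "even (length p)" using bipartite_walk_parity[of u p u S] by blast
    then show False using \<open>odd t\<close> p(1) by simp
  qed
  ultimately show ?thesis using sub by (intro exI[of _ H]) auto
qed

text \<open>Cycles of \<open>pre_digraph\<close> are lists of arcs: each vertex is paired with its
  successor, the last one with the first. The walk is built towards an arbitrary final vertex
  \<open>z\<close>, since the induction changes the head of the list but must keep the closing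
  vertex.\<close>

lemma contains_cycle_of_list:
  assumes "distinct xs" "set xs \<subseteq> pverts G" "successively (edge G) xs" "edge G (last xs) (hd xs)" "3 \<le> length xs"
  shows "contains_cycle G (length xs)"
proof -
  have walk: "pcas (hd ys) (zip ys (tl ys @ [z])) z \<and> pawalk_verts (hd ys) (zip ys (tl ys @ [z])) = ys @ [z] \<and>
      set (zip ys (tl ys @ [z])) \<subseteq> parcs G"
    if "ys \<noteq> []" "successively (edge G) ys" "edge G (last ys) z" for ys z
    using that
  proof (induction ys)
    case (Cons y ys)
    then show ?case
    proof (cases ys)
      case Nil
      then show ?thesis using Cons by (auto simp: edge_def)
    next
      case (Cons y' ys')
      have s: "successively (edge G) ys" "edge G y y'" "edge G (last ys) z"
        using Cons.prems Cons by (auto simp: successively_Cons)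
      have "zip (y # ys) (tl (y # ys) @ [z]) = (y, y') # zip ys (tl ys @ [z])" using Cons by simp
      then show ?thesis using Cons.IH[OF _ s(1,3)] s(2) Cons by (auto simp: edge_def)
    qed
  qed simp
  define p where "p = zip xs (tl xs @ [hd xs])"
  have ne: "xs \<noteq> []" using assms(5) by auto
  note w = walk[OF ne assms(3,4)]
  have "pre_digraph.cycle (with_proj G) p"
    unfolding pre_digraph.cycle_def pre_digraph.awalk_def cas_with_proj_eq awalk_verts_with_proj_eq
  proof (intro exI conjI)
    show "hd xs \<in> verts (with_proj G)" using assms(2) ne by auto
    show "set p \<subseteq> arcs (with_proj G)" "pcas (hd xs) p (hd xs)" using w unfolding p_def by auto
    have "tl (pawalk_verts (hd xs) p) = tl xs @ [hd xs]" using w ne unfolding p_def by simp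
    then show "distinct (tl (pawalk_verts (hd xs) p))" using assms(1) ne by (cases xs) auto
    show "p \<noteq> []" unfolding p_def using ne by (cases xs) auto
  qed
  moreover have "length p = length xs" unfolding p_def using ne by simp
  ultimately show ?thesis using assms(5) unfolding contains_cycle_def by blast
qed

text \<open>Mixing for a single vertex and its neighbourhood shows that \<open>d\<close> is at most
  \<open>4 * lam^2\<close> as long as \<open>2 * d \<le> n\<close>. Then \<open>(d/lam)^2\<close> is
  at most \<open>4 * d\<close>, and \<open>n\<close> is bounded by a power of \<open>d\<close>. For
  larger \<open>d\<close> the bound is immediate.\<close>

lemma mixing_degree_bound:
  fixes d :: nat and lam :: real
  assumes G: "ndl_graph n d lam G" and n: "2 \<le> n" and lam: "0 < lam" and d: "1 \<le> d"
    and k: "n \<le> d * (d / lam) ^ (2 * m - 2)" and m: "2 \<le> m"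
  shows "n \<le> (4 * real d) ^ m"
proof -
  have pg: "pair_graph G" and cardV: "card (pverts G) = n"
    and deg: "\<And>v. v \<in> pverts G \<Longrightarrow> dgr (edge G) v (pverts G) = d"
    using G out_degree_eq_dgr unfolding ndl_graph_def by metis+
  have D1: "1 \<le> 4 * real d" using d by simp
  show ?thesis
  proof (cases "2 * d \<le> n")
    case True
    obtain v where v: "v \<in> pverts G" using cardV n by fastforce
    define N where "N = {u \<in> pverts G. edge G v u}"
    have N: "card N = d" "dgr (edge G) v N = d" using deg[OF v] unfolding N_def dgr_def by (auto simp: conj_assoc)
    have "\<bar>real d - d * real 1 * d / n\<bar> \<le> lam * sqrt d"
      using ndl_graph_mixing(1)[OF G n, of "{v}" N] v N unfolding N_def by auto
    moreover have "real d * d / n \<le> d / 2"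
    proof -
      have "real d * (2 * d) \<le> real d * n" using True by (intro mult_left_mono) auto
      then show ?thesis using n by (simp add: field_simps)
    qed
    ultimately have "real d / 2 \<le> lam * sqrt d" by simp
    then have "(real d / 2)\<^sup>2 \<le> (lam * sqrt d)\<^sup>2" by (intro power_mono) auto
    moreover have "(lam * sqrt d)\<^sup>2 = lam\<^sup>2 * d" by (simp add: power_mult_distrib)
    moreover have "(real d / 2)\<^sup>2 = real d * d / 4" by (simp add: power2_eq_square)
    ultimately have "real d * d \<le> 4 * (lam\<^sup>2 * d)" by linarith
    then have "real d * d \<le> d * (4 * lam\<^sup>2)" by (simp add: mult_ac)
    then have "real d \<le> 4 * lam\<^sup>2" using d by simp
    then have "real d * d \<le> d * (4 * lam\<^sup>2)" by (intro mult_left_mono) auto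
    then have sq: "(d / lam)\<^sup>2 \<le> 4 * real d" using lam by (simp add: power_divide divide_le_eq power2_eq_square mult_ac)
    have "real n \<le> d * ((d / lam)\<^sup>2) ^ (m - 1)" using k by (simp add: power_mult[symmetric] diff_mult_distrib2)
    also have "\<dots> \<le> (4 * real d) * (4 * real d) ^ (m - 1)"
      using sq by (intro mult_mono power_mono) auto
    also have "\<dots> = (4 * real d) ^ m" using m by (simp add: power_eq_if)
    finally show ?thesis .
  next
    case False
    then have "real n \<le> (4 * real d) ^ 1" by simp
    also have "\<dots> \<le> (4 * real d) ^ m" using D1 m by (intro power_increasing) auto
    finally show ?thesis .
  qed
qed

lemma dgr_le_max_degree:
  assumes "pair_graph H" "finite V"
  shows "dgr (edge H) v V \<le> max_degree H"
proof (cases "v \<in> pverts H")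
  case True
  have "dgr (edge H) v V \<le> dgr (edge H) v (pverts H)"
    unfolding dgr_def using pair_graph_edge(3,5)[OF assms(1)] by (intro card_mono) auto
  also have "\<dots> \<le> max_degree H"
    unfolding max_degree_def out_degree_eq_dgr[OF assms(1), symmetric]
    using True pair_graph_edge(3)[OF assms(1)] by (intro Max_ge) auto
  finally show ?thesis .
next
  case False
  then have "{u \<in> V. edge H v u} = {}" using pair_graph_edge(4)[OF assms(1)] by auto
  then show ?thesis unfolding dgr_def by (simp only: card.empty)
qed

lemma dgr_delete_edges:
  assumes "ndl_graph n d lam G" "is_subgraph H G" "real (max_degree H) \<le> (1/2 - \<epsilon>) * d" "v \<in> pverts G"
  shows "(1/2 + \<epsilon>) * d \<le> dgr (edge (delete_edges G H)) v (pverts G)"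
proof -
  have pg: "pair_graph G" and deg: "dgr (edge G) v (pverts G) = d"
    using assms(1,4) out_degree_eq_dgr unfolding ndl_graph_def by metis+
  have pgH: "pair_graph H" using assms(2) unfolding is_subgraph_def by blast
  have fin: "finite (pverts G)" using pair_graph_edge(3)[OF pg] .
  have "{u \<in> pverts G. edge G v u} \<subseteq> {u \<in> pverts G. edge (delete_edges G H) v u} \<union> {u \<in> pverts G. edge H v u}"
    unfolding edge_delete by auto
  then have "card {u \<in> pverts G. edge G v u}
      \<le> card ({u \<in> pverts G. edge (delete_edges G H) v u} \<union> {u \<in> pverts G. edge H v u})"
    using fin by (intro card_mono) auto
  also have "\<dots> \<le> card {u \<in> pverts G. edge (delete_edges G H) v u} + card {u \<in> pverts G. edge H v u}"
    by (rule card_Un_le)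
  finally have "d \<le> dgr (edge (delete_edges G H)) v (pverts G) + dgr (edge H) v (pverts G)"
    using deg unfolding dgr_def by simp
  moreover have "dgr (edge H) v (pverts G) \<le> max_degree H" by (rule dgr_le_max_degree[OF pgH fin])
  ultimately have "real d \<le> dgr (edge (delete_edges G H)) v (pverts G) + (1/2 - \<epsilon>) * d"
    using assms(3) by linarith
  then show ?thesis by (simp add: algebra_simps)
qed

theorem theorem1p4:
  fixes k :: nat and d :: "nat \<Rightarrow> nat" and lam :: "nat \<Rightarrow> real"
    and G :: "nat \<Rightarrow> 'a pair_pre_digraph" and \<epsilon> :: real
  assumes "k = 3 \<or> (even k \<and> k \<ge> 4)"
    and "\<And>n. n \<ge> 1 \<Longrightarrow> ndl_graph n (d n) (lam n) (G n)"
    and "filterlim (\<lambda>n. real (d n) ^ (k - 1) / (real n * lam n ^ (k - 2))) at_top sequentially"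
    and "\<epsilon> > 0"
  shows "\<forall>\<^sub>F n in sequentially.
     (\<forall>H. is_subgraph H (G n) \<and> real (max_degree H) \<le> (1 / 2 - \<epsilon>) * real (d n) \<longrightarrow>
        (\<forall>t. k \<le> t \<and> t \<le> n \<longrightarrow> contains_cycle (delete_edges (G n) H) t)) \<and>
     (\<exists>H. is_subgraph H (G n) \<and> real (max_degree H) \<le> (1 / 2 + \<epsilon>) * real (d n) \<and>
        (\<exists>t. k \<le> t \<and> t \<le> n \<and> \<not> contains_cycle (delete_edges (G n) H) t))"
proof -
  \<comment> \<open>The locale \<open>expander\<close> wants a margin of at most 1/2; shrinking
    \<epsilon> only weakens the bound on the remaining degrees.\<close>
  define e where "e = min \<epsilon> (1/2)"
  have e: "0 < e" "e \<le> 1/2" "e \<le> \<epsilon>" unfolding e_def using assms(4) by auto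
  \<comment> \<open>For \<open>k = 3\<close> the lengths from 4 on are treated as for
    \<open>k = 4\<close>: once \<open>d/lam\<close> is at least 1, the growth condition for 3
    implies the one for 4. Only \<open>t = 3\<close> is then left to
    \<open>mixing_triangle\<close>.\<close>
  define m where "m = (if k = 3 then 2 else k div 2)"
  have m: "2 \<le> m" and km: "k = 3 \<and> m = 2 \<or> k = 2 * m" using assms(1) unfolding m_def by auto
  have k3: "3 \<le> k" using assms(1) by auto
  obtain n0 k0 C where core: "\<And>(V::'a set) E (d::real) (lam::real) t. \<lbrakk>finite V; \<forall>u v. E u v \<longrightarrow> E v u; \<forall>v. \<not> E v v;
    0 < lam; 0 < d; n0 \<le> card V; k0 \<le> d / lam; C * real (card V) \<le> d * (d / lam) ^ (2 * m - 2);
    card V \<le> (4 * d) ^ m;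
    \<forall>A B. A \<subseteq> V \<longrightarrow> B \<subseteq> V \<longrightarrow> (\<Sum>a\<in>A. real (dgr E a B)) \<le> d * card A * card B / card V + lam * sqrt (card A * card B);
    \<forall>v\<in>V. (1/2 + e) * d \<le> dgr E v V; 2 * m \<le> t; t \<le> card V\<rbrakk> \<Longrightarrow>
       \<exists>xs. distinct xs \<and> set xs \<subseteq> V \<and> successively E xs \<and> E (last xs) (hd xs) \<and> length xs = t"
    by (rule large_cycles_threshold[OF e(1,2) m, where 'a = 'a]) (rule that, blast)
  define k1 where "k1 = max k0 1"
  \<comment> \<open>\<open>C\<close> serves \<open>core\<close>, \<open>k1 ^ (k - 2)\<close> forces
    \<open>d/lam\<close> up to \<open>k1\<close>, \<open>2 / e\<close> is what
    \<open>mixing_triangle\<close> needs, and 1 excludes the degenerate values 0 of \<open>d\<close>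
    and \<open>lam\<close>.\<close>
  define c where "c = max (max C 1) (max (k1 ^ (k - 2)) (2 / e))"
  have "\<forall>\<^sub>F n in sequentially. c \<le> real (d n) ^ (k - 1) / (real n * lam n ^ (k - 2))"
    using assms(3) unfolding filterlim_at_top by blast
  moreover have "\<forall>\<^sub>F n in sequentially. max n0 (k + 2) \<le> n" by (rule eventually_ge_at_top)
  ultimately show ?thesis
  proof eventually_elim
    case (elim n)
    have n: "2 \<le> n" "n0 \<le> n" "k + 1 \<le> n" using elim(2) by auto
    have G: "ndl_graph n (d n) (lam n) (G n)" using assms(2) n(1) by simp
    have pg: "pair_graph (G n)" and cardV: "card (pverts (G n)) = n"
      and deg: "\<And>v. v \<in> pverts (G n) \<Longrightarrow> dgr (edge (G n)) v (pverts (G n)) = d n"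
      using G out_degree_eq_dgr unfolding ndl_graph_def by metis+
    note mixing = ndl_graph_mixing(1)[OF G n(1)]
    have finV: "finite (pverts (G n))" using pair_graph_edge(3)[OF pg] .
    have V0: "pverts (G n) \<noteq> {}" using cardV n by auto
    have c1: "1 \<le> c" unfolding c_def by simp
    \<comment> \<open>For \<open>lam n = 0\<close> the quotient in the hypothesis would be a
      division by zero, hence 0, and not at least 1.\<close>
    have lam_pos: "0 < lam n"
    proof (rule ccontr)
      assume "\<not> 0 < lam n"
      then have "lam n = 0" using ndl_graph_mixing(2)[OF G n(1), of "{}" "{}"] by simp
      then show False using elim(1) c1 k3 by (simp add: power_0_left)
    qed
    have d1: "1 \<le> d n"
    proof (rule ccontr)
      assume "\<not> 1 \<le> d n"
      then have "d n = 0" by simp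
      then show False using elim(1) c1 k3 by (simp add: power_0_left)
    qed
    define \<kappa> where "\<kappa> = d n / lam n"
    have \<kappa>0: "0 < \<kappa>" unfolding \<kappa>_def using lam_pos d1 by simp
    have "real (d n) ^ (k - 1) = d n * real (d n) ^ (k - 2)"
      using k3 by (simp flip: power_Suc add: Suc_diff_Suc numeral_2_eq_2 numeral_3_eq_3)
    then have "real (d n) ^ (k - 1) / (real n * lam n ^ (k - 2)) = d n * \<kappa> ^ (k - 2) / n"
      unfolding \<kappa>_def by (simp add: power_divide)
    then have "c \<le> d n * \<kappa> ^ (k - 2) / n" using elim(1) by simp
    then have ratio: "c * n \<le> d n * \<kappa> ^ (k - 2)" using n(1) by (simp add: pos_le_divide_eq)
    have dn: "d n \<le> n"
    proof -
      obtain v where v: "v \<in> pverts (G n)" using V0 by blast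
      have "dgr (edge (G n)) v (pverts (G n)) \<le> card (pverts (G n))"
        unfolding dgr_def using finV by (intro card_mono) auto
      then show ?thesis using deg[OF v] cardV by simp
    qed
    \<comment> \<open>As \<open>d n\<close> is at most \<open>n\<close>, the growth condition bounds
      \<open>\<kappa> ^ (k - 2)\<close> from below by \<open>c\<close>; so the divergence of the
      quotient alone makes \<open>d/lam\<close> large.\<close>
    have k1\<kappa>: "k1 \<le> \<kappa>"
    proof (rule ccontr)
      assume "\<not> k1 \<le> \<kappa>"
      then have "\<kappa> ^ (k - 2) < k1 ^ (k - 2)" using \<kappa>0 k3 by (intro power_strict_mono) auto
      then have less: "\<kappa> ^ (k - 2) < c" unfolding c_def by simp
      have "d n * \<kappa> ^ (k - 2) \<le> n * \<kappa> ^ (k - 2)" using dn \<kappa>0 by (intro mult_right_mono) auto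
      also have "\<dots> < n * c" using less n(1) by simp
      finally show False using ratio by (simp add: mult.commute)
    qed
    have \<kappa>1: "1 \<le> \<kappa>" using k1\<kappa> unfolding k1_def by simp
    have "\<kappa> ^ (k - 2) \<le> \<kappa> ^ (2 * m - 2)" using km \<kappa>1 by (intro power_increasing) auto
    then have ratio': "c * n \<le> d n * \<kappa> ^ (2 * m - 2)"
      using ratio mult_left_mono[of "\<kappa> ^ (k - 2)" "\<kappa> ^ (2 * m - 2)" "real (d n)"] by linarith
    have Cn: "C * n \<le> d n * \<kappa> ^ (2 * m - 2)"
    proof -
      have "C * n \<le> c * n" unfolding c_def by (intro mult_right_mono) auto
      then show ?thesis using ratio' by linarith
    qed
    have "1 * real n \<le> c * n" using c1 by (intro mult_right_mono) auto
    then have "n \<le> d n * (d n / lam n) ^ (2 * m - 2)" using ratio' unfolding \<kappa>_def by linarith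
    then have dm: "n \<le> (4 * real (d n)) ^ m" by (rule mixing_degree_bound[OF G n(1) lam_pos d1 _ m])
    have "contains_cycle (delete_edges (G n) H) t"
      if H: "is_subgraph H (G n)" "real (max_degree H) \<le> (1/2 - \<epsilon>) * d n" and t: "k \<le> t" "t \<le> n" for H t
    proof -
      define E where "E = edge (delete_edges (G n) H)"
      have pgH: "pair_graph H" using H unfolding is_subgraph_def by blast
      have sub: "E u v \<Longrightarrow> edge (G n) u v" for u v unfolding E_def edge_delete by blast
      have symE: "E u v \<Longrightarrow> E v u" and irrE: "\<not> E v v" for u v
        unfolding E_def edge_delete using pair_graph_edge[OF pg] pair_graph_edge[OF pgH] by blast+
      have "(1/2 - \<epsilon>) * d n \<le> (1/2 - e) * d n" using e by (intro mult_right_mono) auto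
      then have degE: "(1/2 + e) * d n \<le> dgr E v (pverts (G n))" if "v \<in> pverts (G n)" for v
        unfolding E_def using dgr_delete_edges[OF G H(1) _ that, of e] H(2) by linarith
      have mixE: "(\<Sum>a\<in>A. real (dgr E a B)) \<le> d n * card A * card B / n + lam n * sqrt (card A * card B)"
        if "A \<subseteq> pverts (G n)" "B \<subseteq> pverts (G n)" for A B
      proof -
        have "(\<Sum>a\<in>A. real (dgr E a B)) \<le> (\<Sum>a\<in>A. real (dgr (edge (G n)) a B))"
          unfolding dgr_def using sub finite_subset[OF that(2) finV] by (intro sum_mono of_nat_mono card_mono) auto
        then show ?thesis using mixing[OF that] by linarith
      qed
      have "\<exists>xs. distinct xs \<and> set xs \<subseteq> pverts (G n) \<and> successively E xs \<and> E (last xs) (hd xs) \<and> length xs = t"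
      proof (cases "2 * m \<le> t")
        case True
        show ?thesis
        proof (rule core[where d = "real (d n)" and lam = "lam n"])
          show "k0 \<le> real (d n) / lam n" using k1\<kappa> unfolding k1_def \<kappa>_def by simp
          show "C * real (card (pverts (G n))) \<le> real (d n) * (real (d n) / lam n) ^ (2 * m - 2)"
            using Cn unfolding cardV \<kappa>_def .
          show "\<forall>A B. A \<subseteq> pverts (G n) \<longrightarrow> B \<subseteq> pverts (G n) \<longrightarrow>
            (\<Sum>a\<in>A. real (dgr E a B)) \<le> real (d n) * card A * card B / card (pverts (G n)) + lam n * sqrt (card A * card B)"
          proof (intro allI impI)
            fix A B assume "A \<subseteq> pverts (G n)" "B \<subseteq> pverts (G n)"
            from mixE[OF this] show "(\<Sum>a\<in>A. real (dgr E a B))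
                \<le> real (d n) * card A * card B / card (pverts (G n)) + lam n * sqrt (card A * card B)"
              unfolding cardV by simp
          qed
        qed (use finV symE irrE lam_pos d1 n cardV dm degE True t in auto)
      next
        case False
        then have k: "k = 3" "t = 3" using km t by auto
        have "lam n * n < e * (real (d n))\<^sup>2"
        proof -
          have "(2 / e) * n \<le> c * n" unfolding c_def by (intro mult_right_mono) auto
          then have "(2 / e) * n \<le> d n * (d n / lam n)" using ratio unfolding k(1) \<kappa>_def by simp
          then have "2 * (lam n * n) \<le> e * (d n)\<^sup>2" using lam_pos e by (simp add: field_simps power2_eq_square)
          moreover have "0 < lam n * n" using lam_pos n by simp
          ultimately show ?thesis by simp
        qed
        then have "\<exists>x\<in>pverts (G n). \<exists>u\<in>pverts (G n). \<exists>v\<in>pverts (G n). E x u \<and> E x v \<and> E u v"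
          using mixing_triangle[OF finV V0 cardV, of "edge (G n)" E "real (d n)" "lam n" e]
            pair_graph_edge(1)[OF pg] symE sub d1 lam_pos e deg degE mixing by auto
        then obtain x u v where "x \<in> pverts (G n)" "u \<in> pverts (G n)" "v \<in> pverts (G n)" "E x u" "E x v" "E u v" by blast
        then show ?thesis using irrE symE k by (intro exI[of _ "[x, u, v]"]) auto
      qed
      then obtain xs where "distinct xs" "set xs \<subseteq> pverts (G n)" "successively E xs" "E (last xs) (hd xs)" "length xs = t"
        by blast
      then show ?thesis
        using contains_cycle_of_list[of xs "delete_edges (G n) H"] t k3 unfolding E_def pverts_delete by simp
    qed
    moreover have "\<exists>H. is_subgraph H (G n) \<and> real (max_degree H) \<le> (1/2 + \<epsilon>) * d n \<and>
        (\<exists>t. k \<le> t \<and> t \<le> n \<and> \<not> contains_cycle (delete_edges (G n) H) t)"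
    proof -
      obtain H where H: "is_subgraph H (G n)" "2 * max_degree H \<le> d n"
        "\<And>t. odd t \<Longrightarrow> \<not> contains_cycle (delete_edges (G n) H) t"
        using exists_bipartite_remainder[OF pg deg] by blast
      have "1/2 * real (d n) \<le> (1/2 + \<epsilon>) * d n" using assms(4) by (intro mult_right_mono) auto
      then have "real (max_degree H) \<le> (1/2 + \<epsilon>) * d n" using H(2) by linarith
      \<comment> \<open>The remainder has no odd cycle; one of \<open>k\<close> and
        \<open>k + 1\<close> is odd, and both are at most \<open>n\<close>.\<close>
      moreover have "\<exists>t. k \<le> t \<and> t \<le> n \<and> odd t"
        using n(3) by (cases "odd k") (auto intro: exI[of _ k] exI[of _ "k + 1"])
      ultimately show ?thesis using H by blast
    qed
    ultimately show ?case by blast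
  qed
qed

end
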